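(* Let $\pi$ be a recursive supernatural number. Then the pseudovariety $\mathsf{Ab}_\pi$ is completely $\sigma$-reducible, where $\sigma=\sigma_\pi$.
   Context: $\mathbb{N}$ contains $0$. A supernatural number is a function $\pi$ from the set of primes to $\mathbb{N}\cup\{\infty\}$; positive integers are regarded as supernatural numbers via their prime factorization; $\pi'$ divides $\pi$ if $\pi'(p)\le\pi(p)$ for all primes $p$. $\pi$ is recursive if $\pi(p)$ is computable from $p$. $P_\pi$ is the set of primes $p$ with $\pi(p)\in\mathbb{N}$. $\mathsf{Ab}_\pi$ is the class of all finite abelian groups whose exponent divides $\pi$. $\mathsf{S}$ is the pseudovariety of all finite semigroups. For a pseudovariety $\mathsf{V}$ and a finite set $A$, $\overline{\Omega}_A\mathsf{V}$ is the free pro-$\mathsf{V}$ semigroup on $A$, and $\psi_{\mathsf V}:\overline{\Omega}_A\mathsf{S}\to\overline{\Omega}_A\mathsf{V}$ is the continuous homomorphism restricting to the identity on $A$. $\mathsf V$ satisfies $u=v$ ($u,v\in\overline{\Omega}_A\mathsf{S}$) if $\psi_{\mathsf V}(u)=\psi_{\mathsf V}(v)$. The implicit signature $\sigma=\sigma_\pi$ consists of multiplication, $x\mapsto x^{\omega-1}=\lim_k x^{k!-1}$, and $x\mapsto x^{p^{\omega-1}}=\lim_k x^{p^{k!-1}}$ for $p\in P_\pi$. $\Omega_A^\sigma\mathsf{V}$ is the $\sigma$-subalgebra of $\overline{\Omega}_A\mathsf{V}$ generated by $A$. Let $X$ (variables), $P$ (parameters) be disjoint finite sets, $A$ a finite alphabet.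 A system of equations of $\sigma$-terms consists of finitely many equations $u_i=v_i$ with $u_i,v_i\in\Omega^\sigma_{X\cup P}\mathsf{S}$, rational constraints $L_x\subseteq A^*$ ($x\in X$), and elements $w_p\in\Omega_A^\sigma\mathsf{S}$ ($p\in P$). $Cl(L_x)$ is the closure of $L_x$ in $(\overline{\Omega}_A\mathsf{S})^1$ (the adjoined $1$ being isolated). A solution modulo $\mathsf{V}$ is a continuous homomorphism $\delta:\overline{\Omega}_{X\cup P}\mathsf{S}\to\overline{\Omega}_A\mathsf{S}$ with $\delta(x)\in Cl(L_x)$ for $x\in X$, $\delta(p)=w_p$ for $p\in P$, and such that $\mathsf V$ satisfies $\delta(u_i)=\delta(v_i)$ for all $i$. $\mathsf V$ is $\sigma$-reducible for the system if, whenever the system has a solution modulo $\mathsf V$, it has a solution $\delta$ modulo $\mathsf V$ with $\delta(x)\in\Omega_A^\sigma\mathsf{S}$ for all $x\in X$. $\mathsf V$ is completely $\sigma$-reducible if it is $\sigma$-reducible for every such system. *)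

theory Defs
  imports "HOL-Analysis.Analysis" "HOL-Algebra.Group" "HOL-Library.Extended_Nat"
    "HOL-Computational_Algebra.Primes"
begin

section \<open>Recursive functions and supernatural numbers\<close>

datatype recf =
    Zero
  | Succ
  | Proj nat
  | Comp recf "recf list"
  | PrimRec recf recf
  | Minim recf

text \<open>\<^term>\<open>computes f xs y\<close>: the partial recursive function denoted by \<^term>\<open>f\<close> is defined
  on \<^term>\<open>xs\<close> and has value \<^term>\<open>y\<close> there.\<close>

inductive computes :: "recf \<Rightarrow> nat list \<Rightarrow> nat \<Rightarrow> bool" where
  Zero: "computes Zero xs 0"
| Succ: "computes Succ [x] (Suc x)"
| Proj: "i < length xs \<Longrightarrow> computes (Proj i) xs (xs ! i)"
| Comp: "\<lbrakk>list_all2 (\<lambda>g y. computes g xs y) gs ys; computes f ys z\<rbrakk>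
    \<Longrightarrow> computes (Comp f gs) xs z"
| PrimRec_0: "computes f xs y \<Longrightarrow> computes (PrimRec f g) (0 # xs) y"
| PrimRec_Suc: "\<lbrakk>computes (PrimRec f g) (n # xs) y; computes g (n # y # xs) z\<rbrakk>
    \<Longrightarrow> computes (PrimRec f g) (Suc n # xs) z"
| Minim: "\<lbrakk>computes f (n # xs) 0; \<forall>i<n. \<exists>y. computes f (i # xs) (Suc y)\<rbrakk>
    \<Longrightarrow> computes (Minim f) xs n"
monos list_all2_mono

text \<open>A supernatural number is represented by a function on all naturals of which only the values
  at primes matter.\<close>

type_synonym supernatural = "nat \<Rightarrow> enat"

definition supernatural_of_nat :: "nat \<Rightarrow> supernatural" where
  "supernatural_of_nat n = (\<lambda>p. enat (multiplicity p n))"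

definition supernatural_dvd :: "supernatural \<Rightarrow> supernatural \<Rightarrow> bool" where
  "supernatural_dvd \<pi>' \<pi> \<longleftrightarrow> (\<forall>p. prime p \<longrightarrow> \<pi>' p \<le> \<pi> p)"

fun enat_code :: "enat \<Rightarrow> nat" where
  "enat_code (enat n) = Suc n"
| "enat_code \<infinity> = 0"

definition recursive_supernatural :: "supernatural \<Rightarrow> bool" where
  "recursive_supernatural \<pi> \<longleftrightarrow> (\<exists>f. \<forall>p. prime p \<longrightarrow> computes f [p] (enat_code (\<pi> p)))"

definition finite_primes :: "supernatural \<Rightarrow> nat set" where
  "finite_primes \<pi> = {p. prime p \<and> \<pi> p \<noteq> \<infinity>}"

section \<open>Semigroups\<close>

record 'a sgrp = "'a partial_object" +
  smult :: "'a \<Rightarrow> 'a \<Rightarrow> 'a"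

definition sgrp_hom :: "'a sgrp \<Rightarrow> 'b sgrp \<Rightarrow> ('a \<Rightarrow> 'b) set" where
  "sgrp_hom S T = {h. h \<in> carrier S \<rightarrow> carrier T \<and>
     (\<forall>x\<in>carrier S. \<forall>y\<in>carrier S. h (smult S x y) = smult T (h x) (h y))}"

inductive_set generated :: "'a sgrp \<Rightarrow> 'a set \<Rightarrow> 'a set" for S B where
  base: "b \<in> B \<Longrightarrow> b \<in> generated S B"
| mult: "\<lbrakk>x \<in> generated S B; y \<in> generated S B\<rbrakk> \<Longrightarrow> smult S x y \<in> generated S B"

text \<open>\<open>x\<^sup>n\<close> for \<open>n \<ge> 1\<close>; the value at \<open>n = 0\<close> is immaterial, as powers are only used along
  sequences of exponents that are eventually positive.\<close>

definition spow :: "'a sgrp \<Rightarrow> 'a \<Rightarrow> nat \<Rightarrow> 'a" where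
  "spow S x n = (smult S x ^^ (n - 1)) x"

text \<open>Classes of finite semigroups (closed under isomorphism) are represented by their members
  carried by sets of natural numbers.\<close>

definition fin_sgrps :: "nat sgrp set" where
  "fin_sgrps = {S. finite (carrier S) \<and> carrier S \<noteq> {} \<and>
     (\<forall>x\<in>carrier S. \<forall>y\<in>carrier S. smult S x y \<in> carrier S) \<and>
     (\<forall>x\<in>carrier S. \<forall>y\<in>carrier S. \<forall>z\<in>carrier S.
        smult S (smult S x y) z = smult S x (smult S y z))}"

definition with_one :: "'a sgrp \<Rightarrow> 'a \<Rightarrow> 'a monoid" where
  "with_one S e = \<lparr>carrier = carrier S, monoid.mult = smult S, one = e\<rparr>"

definition group_exponent :: "('a, 'b) monoid_scheme \<Rightarrow> nat" where
  "group_exponent G = (LEAST n. 0 < n \<and> (\<forall>x\<in>carrier G. x [^]\<^bsub>G\<^esub> n = \<one>\<^bsub>G\<^esub>))"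

definition Ab :: "supernatural \<Rightarrow> nat sgrp set" where
  "Ab \<pi> = {S \<in> fin_sgrps. \<exists>e. comm_group (with_one S e) \<and>
     supernatural_dvd (supernatural_of_nat (group_exponent (with_one S e))) \<pi>}"

section \<open>Free pro-V semigroups\<close>

text \<open>The free pro-V semigroup on \<open>A\<close> is the inverse limit of the \<open>A\<close>-generated members of V.
  The index \<open>(S, \<phi>)\<close> stands for the \<open>A\<close>-generated subsemigroup of \<open>S\<close> generated by \<open>\<phi> ` A\<close>,
  and the connecting morphisms are those that respect the choice of generators.\<close>

type_synonym 'a gen_sgrp = "nat sgrp \<times> ('a \<Rightarrow> nat)"

type_synonym 'a pro = "'a gen_sgrp \<Rightarrow> nat"

definition gen_sgrps :: "nat sgrp set \<Rightarrow> 'a set \<Rightarrow> 'a gen_sgrp set" where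
  "gen_sgrps V A = {(S, \<phi>). S \<in> V \<and> \<phi> \<in> A \<rightarrow>\<^sub>E carrier S}"

definition free_pro :: "nat sgrp set \<Rightarrow> 'a set \<Rightarrow> 'a pro sgrp" where
  "free_pro V A = \<lparr>
     carrier = {x \<in> (\<Pi>\<^sub>E (S, \<phi>) \<in> gen_sgrps V A. generated S (\<phi> ` A)).
       \<forall>(S, \<phi>) \<in> gen_sgrps V A. \<forall>(T, \<theta>) \<in> gen_sgrps V A. \<forall>h \<in> sgrp_hom S T.
         (\<forall>a\<in>A. h (\<phi> a) = \<theta> a) \<longrightarrow> h (x (S, \<phi>)) = x (T, \<theta>)},
     smult = (\<lambda>x y. \<lambda>(S, \<phi>) \<in> gen_sgrps V A. smult S (x (S, \<phi>)) (y (S, \<phi>)))\<rparr>"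

definition free_pro_topology :: "nat sgrp set \<Rightarrow> 'a set \<Rightarrow> 'a pro topology" where
  "free_pro_topology V A = subtopology
     (product_topology (\<lambda>(S, \<phi>). discrete_topology (carrier S)) (gen_sgrps V A))
     (carrier (free_pro V A))"

definition gen :: "nat sgrp set \<Rightarrow> 'a set \<Rightarrow> 'a \<Rightarrow> 'a pro" where
  "gen V A a = (\<lambda>(S, \<phi>) \<in> gen_sgrps V A. \<phi> a)"

definition cont_hom ::
  "nat sgrp set \<Rightarrow> 'a set \<Rightarrow> nat sgrp set \<Rightarrow> 'b set \<Rightarrow> ('a pro \<Rightarrow> 'b pro) set" where
  "cont_hom V A W B = {f \<in> sgrp_hom (free_pro V A) (free_pro W B).
     continuous_map (free_pro_topology V A) (free_pro_topology W B) f}"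

text \<open>For a pseudovariety V the canonical projection exists and is unique on the carrier.\<close>

definition canonical_proj :: "nat sgrp set \<Rightarrow> 'a set \<Rightarrow> ('a pro \<Rightarrow> 'a pro) \<Rightarrow> bool" where
  "canonical_proj V A \<psi> \<longleftrightarrow> \<psi> \<in> cont_hom fin_sgrps A V A \<and>
     (\<forall>a\<in>A. \<psi> (gen fin_sgrps A a) = gen V A a)"

definition satisfies :: "nat sgrp set \<Rightarrow> 'a set \<Rightarrow> 'a pro \<Rightarrow> 'a pro \<Rightarrow> bool" where
  "satisfies V A u v \<longleftrightarrow> (\<exists>\<psi>. canonical_proj V A \<psi> \<and> \<psi> u = \<psi> v)"

section \<open>Implicit signatures\<close>

text \<open>An implicit signature consists of multiplication and a set of unary operations
  \<open>x \<mapsto> lim\<^sub>k x\<^bsup>e k\<^esup>\<close>, each given by its sequence of exponents \<open>e\<close>.\<close>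

type_synonym signature = "(nat \<Rightarrow> nat) set"

definition sigma :: "supernatural \<Rightarrow> signature" where
  "sigma \<pi> = insert (\<lambda>k. fact k - 1) ((\<lambda>p k. p ^ (fact k - 1)) ` finite_primes \<pi>)"

inductive_set sig_subalgebra :: "signature \<Rightarrow> nat sgrp set \<Rightarrow> 'a set \<Rightarrow> 'a pro set"
  for \<sigma> V A where
  gen: "a \<in> A \<Longrightarrow> gen V A a \<in> sig_subalgebra \<sigma> V A"
| mult: "\<lbrakk>x \<in> sig_subalgebra \<sigma> V A; y \<in> sig_subalgebra \<sigma> V A\<rbrakk>
    \<Longrightarrow> smult (free_pro V A) x y \<in> sig_subalgebra \<sigma> V A"
| unary: "\<lbrakk>e \<in> \<sigma>; x \<in> sig_subalgebra \<sigma> V A;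
      limitin (free_pro_topology V A) (\<lambda>k. spow (free_pro V A) x (e k)) y sequentially\<rbrakk>
    \<Longrightarrow> y \<in> sig_subalgebra \<sigma> V A"

section \<open>Rational constraints\<close>

inductive rational :: "'a set \<Rightarrow> 'a list set \<Rightarrow> bool" for A where
  empty: "rational A {}"
| epsilon: "rational A {[]}"
| letter: "a \<in> A \<Longrightarrow> rational A {[a]}"
| union: "\<lbrakk>rational A K; rational A L\<rbrakk> \<Longrightarrow> rational A (K \<union> L)"
| product: "\<lbrakk>rational A K; rational A L\<rbrakk> \<Longrightarrow> rational A {u @ v | u v. u \<in> K \<and> v \<in> L}"
| star: "rational A K \<Longrightarrow> rational A (concat ` lists K)"

text \<open>The adjoined identity element is \<^const>\<open>None\<close>, and it is isolated.\<close>

definition adjoin_point :: "'a topology \<Rightarrow> 'a option topology" where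
  "adjoin_point X = topology (\<lambda>U. U \<subseteq> insert None (Some ` topspace X) \<and> openin X {x. Some x \<in> U})"

lemma openin_adjoin_point:
  "openin (adjoin_point X) U \<longleftrightarrow>
     U \<subseteq> insert None (Some ` topspace X) \<and> openin X {x. Some x \<in> U}"
proof -
  have 1: "{x. Some x \<in> S \<inter> T} = {x. Some x \<in> S} \<inter> {x. Some x \<in> T}" for S T :: "'a option set"
    by auto
  have 2: "{x. Some x \<in> \<Union>\<K>} = (\<Union>K\<in>\<K>. {x. Some x \<in> K})" for \<K> :: "'a option set set"
    by auto
  have "istopology (\<lambda>U. U \<subseteq> insert None (Some ` topspace X) \<and> openin X {x. Some x \<in> U})"
    unfolding istopology_def 1 2 by blast
  then show ?thesis
    by (simp add: adjoin_point_def)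
qed

fun word_value :: "'a set \<Rightarrow> 'a list \<Rightarrow> 'a pro option" where
  "word_value A [] = None"
| "word_value A (a # w) = Some (case word_value A w of
     None \<Rightarrow> gen fin_sgrps A a
   | Some x \<Rightarrow> smult (free_pro fin_sgrps A) (gen fin_sgrps A a) x)"

definition Cl :: "'a set \<Rightarrow> 'a list set \<Rightarrow> 'a pro option set" where
  "Cl A L = adjoin_point (free_pro_topology fin_sgrps A) closure_of (word_value A ` L)"

section \<open>Systems of equations and reducibility\<close>

definition is_system ::
  "signature \<Rightarrow> 'v set \<Rightarrow> 'v set \<Rightarrow> 'a set \<Rightarrow> ('v pro \<times> 'v pro) set \<Rightarrow>
     ('v \<Rightarrow> 'a list set) \<Rightarrow> ('v \<Rightarrow> 'a pro) \<Rightarrow> bool" where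
  "is_system \<sigma> X P A E L w \<longleftrightarrow>
     finite X \<and> finite P \<and> X \<inter> P = {} \<and> finite A \<and> finite E \<and>
     E \<subseteq> sig_subalgebra \<sigma> fin_sgrps (X \<union> P) \<times> sig_subalgebra \<sigma> fin_sgrps (X \<union> P) \<and>
     (\<forall>x\<in>X. rational A (L x)) \<and>
     (\<forall>p\<in>P. w p \<in> sig_subalgebra \<sigma> fin_sgrps A)"

definition is_solution ::
  "nat sgrp set \<Rightarrow> 'v set \<Rightarrow> 'v set \<Rightarrow> 'a set \<Rightarrow> ('v pro \<times> 'v pro) set \<Rightarrow>
     ('v \<Rightarrow> 'a list set) \<Rightarrow> ('v \<Rightarrow> 'a pro) \<Rightarrow> ('v pro \<Rightarrow> 'a pro) \<Rightarrow> bool" where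
  "is_solution V X P A E L w \<delta> \<longleftrightarrow>
     \<delta> \<in> cont_hom fin_sgrps (X \<union> P) fin_sgrps A \<and>
     (\<forall>x\<in>X. Some (\<delta> (gen fin_sgrps (X \<union> P) x)) \<in> Cl A (L x)) \<and>
     (\<forall>p\<in>P. \<delta> (gen fin_sgrps (X \<union> P) p) = w p) \<and>
     (\<forall>(u, v)\<in>E. satisfies V A (\<delta> u) (\<delta> v))"

definition reducible_for ::
  "signature \<Rightarrow> nat sgrp set \<Rightarrow> 'v set \<Rightarrow> 'v set \<Rightarrow> 'a set \<Rightarrow> ('v pro \<times> 'v pro) set \<Rightarrow>
     ('v \<Rightarrow> 'a list set) \<Rightarrow> ('v \<Rightarrow> 'a pro) \<Rightarrow> bool" where
  "reducible_for \<sigma> V X P A E L w \<longleftrightarrow>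
     (\<exists>\<delta>. is_solution V X P A E L w \<delta>) \<longrightarrow>
     (\<exists>\<delta>. is_solution V X P A E L w \<delta> \<and>
        (\<forall>x\<in>X. \<delta> (gen fin_sgrps (X \<union> P) x) \<in> sig_subalgebra \<sigma> fin_sgrps A))"

text \<open>The type arguments are the types from which variables and parameters, respectively letters,
  are drawn.\<close>

definition completely_reducible ::
  "'v itself \<Rightarrow> 'a itself \<Rightarrow> signature \<Rightarrow> nat sgrp set \<Rightarrow> bool" where
  "completely_reducible _ _ \<sigma> V \<longleftrightarrow>
     (\<forall>(X :: 'v set) P (A :: 'a set) E L w.
        is_system \<sigma> X P A E L w \<longrightarrow> reducible_for \<sigma> V X P A E L w)"

end

theory Submission
  imports "HOL-Number_Theory.Residues" Defs
begin

text \<open>A pseudoword is seen by \<open>Ab \<pi>\<close> only through the exponents of its letters modulo the positive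
  integers dividing \<open>\<pi>\<close>. For \<open>\<sigma>\<close>-words these exponents are fractions whose denominators \<open>q\<close> are
  products of primes in \<open>P\<^sub>\<pi>\<close>, except modulo the finitely many primes dividing \<open>q\<close>, where \<open>\<pi>\<close> is
  finite. By Parikh's argument the exponent vectors of a rational language lie in finitely many cosets
  \<open>a + G\<close> of subgroups of \<open>\<int>\<^sup>A\<close>, and conversely \<open>\<sigma>\<close>-words in its closure realise every element of
  \<open>a + G\<close> modulo the primes dividing \<open>q\<close> together with, independently, every element of \<open>a + G / q\<close>
  away from them. A solution modulo \<open>Ab \<pi>\<close> thus amounts to a linear system over \<open>\<int>\<close> solvable modulo
  every divisor of \<open>\<pi>\<close> prime to some \<open>q\<close>, and such a system is solvable in fractions after
  enlarging \<open>q\<close>.\<close>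

section \<open>Words in free pro-V semigroups\<close>

text \<open>Primes with infinite and with finite value of \<pi> need opposite treatment. The
  signature supplies no division by a prime \<open>p\<close> with
  \<open>\<pi> p = \<infinity>\<close>, but divisors of \<pi> may be multiplied by \<open>p\<close>
  at will, so solving modulo a larger divisor makes room for a factor \<open>p\<close>. For
  \<open>p\<close> in \<open>finite_primes \<pi>\<close> the moduli are bounded at \<open>p\<close>,
  but x -> x^(p^(omega-1)) divides exponents by \<open>p\<close> modulo integers prime to
  \<open>p\<close> and annihilates them modulo powers of \<open>p\<close>. The second effect makes
  the two kinds of exponents independent: if z has the exponents of x / q modulo integers prime to
  q, and exponent 0 modulo divisors of powers of q, then integer combinations of x and z can be
  prescribed separately on the two sides. At the primes of q nothing has to be divided: a single
  modulus captures all divisors of \<pi> there, and the given solution is kept. The order of the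
  choices matters as well: q comes out of an elimination in a subgroup built from the constraints,
  so the description of a rational language must serve all q in advance.\<close>

definition is_sgrp :: "'a sgrp \<Rightarrow> bool" where
  "is_sgrp S \<longleftrightarrow>
     (\<forall>x\<in>carrier S. \<forall>y\<in>carrier S. smult S x y \<in> carrier S) \<and>
     (\<forall>x\<in>carrier S. \<forall>y\<in>carrier S. \<forall>z\<in>carrier S.
        smult S (smult S x y) z = smult S x (smult S y z))"

lemma is_sgrp_closed: "is_sgrp S \<Longrightarrow> x \<in> carrier S \<Longrightarrow> y \<in> carrier S \<Longrightarrow> smult S x y \<in> carrier S"
  by (simp add: is_sgrp_def)

lemma is_sgrp_assoc:
  "is_sgrp S \<Longrightarrow> x \<in> carrier S \<Longrightarrow> y \<in> carrier S \<Longrightarrow> z \<in> carrier S \<Longrightarrow>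
    smult S (smult S x y) z = smult S x (smult S y z)"
  by (simp add: is_sgrp_def)

lemma fin_sgrps_is_sgrp: "S \<in> fin_sgrps \<Longrightarrow> is_sgrp S"
  by (simp add: fin_sgrps_def is_sgrp_def)

text \<open>There is no unit to start from, hence the separate clause for one letter; the empty word
  gets a default value and is excluded wherever the value matters.\<close>

fun eval_word :: "'b sgrp \<Rightarrow> ('a \<Rightarrow> 'b) \<Rightarrow> 'a list \<Rightarrow> 'b" where
  "eval_word S \<phi> [] = undefined"
| "eval_word S \<phi> [a] = \<phi> a"
| "eval_word S \<phi> (a # b # w) = smult S (\<phi> a) (eval_word S \<phi> (b # w))"

lemma eval_word_Cons: "w \<noteq> [] \<Longrightarrow> eval_word S \<phi> (a # w) = smult S (\<phi> a) (eval_word S \<phi> w)"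
  by (cases w) auto

lemma eval_word_closed:
  assumes "is_sgrp S" "\<phi> \<in> A \<rightarrow> carrier S"
  shows "w \<in> lists A \<Longrightarrow> w \<noteq> [] \<Longrightarrow> eval_word S \<phi> w \<in> carrier S"
proof (induction w)
  case (Cons a w)
  then show ?case using assms by (cases "w = []") (auto simp: eval_word_Cons is_sgrp_closed Pi_iff)
qed simp

lemma eval_word_append:
  assumes "is_sgrp S" "\<phi> \<in> A \<rightarrow> carrier S" and v: "v \<in> lists A" "v \<noteq> []"
  shows "u \<in> lists A \<Longrightarrow> u \<noteq> [] \<Longrightarrow>
    eval_word S \<phi> (u @ v) = smult S (eval_word S \<phi> u) (eval_word S \<phi> v)"
proof (induction u)
  case (Cons a u)
  have a: "\<phi> a \<in> carrier S" using Cons.prems assms(2) by auto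
  show ?case
  proof (cases "u = []")
    case False
    then show ?thesis
      using Cons a eval_word_closed[OF assms(1,2), of u] eval_word_closed[OF assms(1,2), of v] v
      by (simp add: eval_word_Cons is_sgrp_assoc[OF assms(1)])
  qed (simp add: eval_word_Cons v)
qed simp

lemma eval_word_hom:
  assumes "is_sgrp S" "\<phi> \<in> A \<rightarrow> carrier S" "h \<in> sgrp_hom S T" "\<And>a. a \<in> A \<Longrightarrow> h (\<phi> a) = \<theta> a"
  shows "w \<in> lists A \<Longrightarrow> w \<noteq> [] \<Longrightarrow> h (eval_word S \<phi> w) = eval_word T \<theta> w"
proof (induction w)
  case (Cons a w)
  then show ?case
    using assms eval_word_closed[OF assms(1,2), of w]
    by (cases "w = []") (auto simp: eval_word_Cons sgrp_hom_def Pi_iff)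
qed simp

lemma generated_eval_wordE:
  assumes "x \<in> generated S (\<phi> ` A)" "is_sgrp S" "\<phi> \<in> A \<rightarrow> carrier S"
  shows "\<exists>w. w \<in> lists A \<and> w \<noteq> [] \<and> x = eval_word S \<phi> w"
  using assms(1)
proof induction
  case (base b)
  then obtain a where "a \<in> A" "b = \<phi> a" by auto
  then show ?case by (intro exI[of _ "[a]"]) auto
next
  case (mult x y)
  then obtain u v where "u \<in> lists A \<and> u \<noteq> [] \<and> x = eval_word S \<phi> u"
    "v \<in> lists A \<and> v \<noteq> [] \<and> y = eval_word S \<phi> v" by blast
  then show ?case
    by (intro exI[of _ "u @ v"]) (auto simp: eval_word_append[OF assms(2,3)])
qed

lemma generated_subset_carrier:
  assumes "is_sgrp S" "B \<subseteq> carrier S" shows "generated S B \<subseteq> carrier S"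
proof
  fix x assume "x \<in> generated S B"
  then show "x \<in> carrier S" by induction (use assms in \<open>auto intro: is_sgrp_closed\<close>)
qed

lemma generated_subset_generated:
  assumes "B \<subseteq> generated S C" shows "generated S B \<subseteq> generated S C"
proof
  fix x assume "x \<in> generated S B"
  then show "x \<in> generated S C" by induction (use assms in \<open>auto intro: generated.intros\<close>)
qed

section \<open>The inverse limit and its coordinates\<close>

lemma gen_sgrps_iff: "(S, \<phi>) \<in> gen_sgrps V A \<longleftrightarrow> S \<in> V \<and> \<phi> \<in> A \<rightarrow>\<^sub>E carrier S"
  by (simp add: gen_sgrps_def)

lemma gen_sgrps_mono: "V \<subseteq> W \<Longrightarrow> gen_sgrps V A \<subseteq> gen_sgrps W A"
  by (auto simp: gen_sgrps_def)

lemma free_pro_carrier_iff: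
  "x \<in> carrier (free_pro V A) \<longleftrightarrow> x \<in> extensional (gen_sgrps V A) \<and>
    (\<forall>S \<phi>. (S, \<phi>) \<in> gen_sgrps V A \<longrightarrow> x (S, \<phi>) \<in> generated S (\<phi> ` A)) \<and>
    (\<forall>S \<phi> T \<theta> h. (S, \<phi>) \<in> gen_sgrps V A \<longrightarrow> (T, \<theta>) \<in> gen_sgrps V A \<longrightarrow> h \<in> sgrp_hom S T \<longrightarrow>
       (\<forall>a\<in>A. h (\<phi> a) = \<theta> a) \<longrightarrow> h (x (S, \<phi>)) = x (T, \<theta>))"
proof -
  have "x \<in> carrier (free_pro V A) \<longleftrightarrow> x \<in> extensional (gen_sgrps V A) \<and>
    (\<forall>i\<in>gen_sgrps V A. case i of (S, \<phi>) \<Rightarrow> x (S, \<phi>) \<in> generated S (\<phi> ` A)) \<and>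
    (\<forall>(S, \<phi>) \<in> gen_sgrps V A. \<forall>(T, \<theta>) \<in> gen_sgrps V A. \<forall>h \<in> sgrp_hom S T.
         (\<forall>a\<in>A. h (\<phi> a) = \<theta> a) \<longrightarrow> h (x (S, \<phi>)) = x (T, \<theta>))"
    by (auto simp: free_pro_def PiE_iff split: prod.splits)
  then show ?thesis by fast
qed

lemma free_pro_extensional: "x \<in> carrier (free_pro V A) \<Longrightarrow> x \<in> extensional (gen_sgrps V A)"
  by (simp add: free_pro_carrier_iff)

lemma free_pro_generated:
  "x \<in> carrier (free_pro V A) \<Longrightarrow> (S, \<phi>) \<in> gen_sgrps V A \<Longrightarrow> x (S, \<phi>) \<in> generated S (\<phi> ` A)"
  by (simp add: free_pro_carrier_iff)

lemma free_pro_compatible: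
  "x \<in> carrier (free_pro V A) \<Longrightarrow> (S, \<phi>) \<in> gen_sgrps V A \<Longrightarrow> (T, \<theta>) \<in> gen_sgrps V A \<Longrightarrow>
    h \<in> sgrp_hom S T \<Longrightarrow> (\<And>a. a \<in> A \<Longrightarrow> h (\<phi> a) = \<theta> a) \<Longrightarrow> h (x (S, \<phi>)) = x (T, \<theta>)"
  by (simp add: free_pro_carrier_iff)

lemma free_pro_eqI:
  "x \<in> carrier (free_pro V A) \<Longrightarrow> y \<in> carrier (free_pro V A) \<Longrightarrow>
    (\<And>S \<phi>. (S, \<phi>) \<in> gen_sgrps V A \<Longrightarrow> x (S, \<phi>) = y (S, \<phi>)) \<Longrightarrow> x = y"
  by (rule extensionalityI[of _ "gen_sgrps V A"]) (auto simp: free_pro_carrier_iff)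

lemma free_pro_smult:
  "(S, \<phi>) \<in> gen_sgrps V A \<Longrightarrow> smult (free_pro V A) x y (S, \<phi>) = smult S (x (S, \<phi>)) (y (S, \<phi>))"
  by (simp add: free_pro_def)

lemma free_pro_smult_extensional: "smult (free_pro V A) x y \<in> extensional (gen_sgrps V A)"
  by (simp add: free_pro_def)

lemma gen_sgrps_carrier:
  assumes "V \<subseteq> fin_sgrps" "(S, \<phi>) \<in> gen_sgrps V A"
  shows "is_sgrp S \<and> finite (carrier S) \<and> \<phi> \<in> A \<rightarrow> carrier S \<and> generated S (\<phi> ` A) \<subseteq> carrier S"
proof -
  have S: "S \<in> fin_sgrps" "\<phi> \<in> A \<rightarrow> carrier S" using assms by (auto simp: gen_sgrps_iff)
  moreover have "finite (carrier S)" using S(1) by (simp add: fin_sgrps_def)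
  ultimately show ?thesis
    using generated_subset_carrier[of S "\<phi> ` A"] fin_sgrps_is_sgrp[of S] by auto
qed

lemma free_pro_in_carrier:
  "V \<subseteq> fin_sgrps \<Longrightarrow> x \<in> carrier (free_pro V A) \<Longrightarrow> (S, \<phi>) \<in> gen_sgrps V A \<Longrightarrow>
    x (S, \<phi>) \<in> carrier S"
  using gen_sgrps_carrier[of V S \<phi> A] free_pro_generated[of x V A S \<phi>] by auto

lemma free_pro_is_sgrp:
  assumes "V \<subseteq> fin_sgrps" shows "is_sgrp (free_pro V A)"
proof -
  have 1: "smult (free_pro V A) x y \<in> carrier (free_pro V A)"
    if x: "x \<in> carrier (free_pro V A)" and y: "y \<in> carrier (free_pro V A)" for x y
    unfolding free_pro_carrier_iff
  proof (intro conjI allI impI free_pro_smult_extensional)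
    fix S \<phi> assume S: "(S, \<phi>) \<in> gen_sgrps V A"
    then show "smult (free_pro V A) x y (S, \<phi>) \<in> generated S (\<phi> ` A)"
      using x y by (simp add: free_pro_smult free_pro_generated generated.mult)
    fix T \<theta> h assume T: "(T, \<theta>) \<in> gen_sgrps V A" "h \<in> sgrp_hom S T" "\<forall>a\<in>A. h (\<phi> a) = \<theta> a"
    have "h (smult S (x (S, \<phi>)) (y (S, \<phi>))) = smult T (h (x (S, \<phi>))) (h (y (S, \<phi>)))"
      using T(2) free_pro_in_carrier[OF assms x S] free_pro_in_carrier[OF assms y S]
      by (auto simp: sgrp_hom_def)
    then show "h (smult (free_pro V A) x y (S, \<phi>)) = smult (free_pro V A) x y (T, \<theta>)"
      using T S x y by (simp add: free_pro_smult free_pro_compatible[of _ V A S \<phi> T \<theta>])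
  qed
  have 2: "smult (free_pro V A) (smult (free_pro V A) x y) z =
      smult (free_pro V A) x (smult (free_pro V A) y z)"
    if x: "x \<in> carrier (free_pro V A)" and y: "y \<in> carrier (free_pro V A)"
      and z: "z \<in> carrier (free_pro V A)" for x y z
  proof (rule free_pro_eqI)
    fix S \<phi> assume S: "(S, \<phi>) \<in> gen_sgrps V A"
    then show "smult (free_pro V A) (smult (free_pro V A) x y) z (S, \<phi>) =
      smult (free_pro V A) x (smult (free_pro V A) y z) (S, \<phi>)"
      using is_sgrp_assoc[of S "x (S, \<phi>)" "y (S, \<phi>)" "z (S, \<phi>)"] gen_sgrps_carrier[OF assms S]
        free_pro_in_carrier[OF assms x S] free_pro_in_carrier[OF assms y S]
        free_pro_in_carrier[OF assms z S]
      by (simp add: free_pro_smult)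
  qed (use 1 x y z in auto)
  show ?thesis using 1 2 by (simp add: is_sgrp_def)
qed

lemma gen_carrier: "a \<in> A \<Longrightarrow> gen V A a \<in> carrier (free_pro V A)"
  by (auto simp: free_pro_carrier_iff gen_def intro: generated.base)

lemma gen_apply: "(S, \<phi>) \<in> gen_sgrps V A \<Longrightarrow> gen V A a (S, \<phi>) = \<phi> a"
  by (simp add: gen_def)

lemma free_pro_word_carrier:
  "V \<subseteq> fin_sgrps \<Longrightarrow> w \<in> lists A \<Longrightarrow> w \<noteq> [] \<Longrightarrow>
    eval_word (free_pro V A) (gen V A) w \<in> carrier (free_pro V A)"
  by (rule eval_word_closed[OF free_pro_is_sgrp]) (auto simp: gen_carrier)

lemma eval_word_apply:
  assumes "(S, \<phi>) \<in> gen_sgrps V A"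
  shows "w \<noteq> [] \<Longrightarrow> eval_word (free_pro V A) (gen V A) w (S, \<phi>) = eval_word S \<phi> w"
proof (induction w)
  case (Cons a w)
  then show ?case using assms
    by (cases "w = []") (auto simp: eval_word_Cons gen_apply free_pro_smult)
qed simp

lemma word_value_eq: "w \<noteq> [] \<Longrightarrow> word_value A w = Some (eval_word (free_pro fin_sgrps A) (gen fin_sgrps A) w)"
proof (induction w)
  case (Cons a w)
  then show ?case by (cases "w = []") (auto simp: eval_word_Cons)
qed simp

section \<open>Density of words\<close>

definition sgrp_prod :: "nat sgrp \<Rightarrow> nat sgrp \<Rightarrow> nat sgrp" where
  "sgrp_prod S T = \<lparr>carrier = prod_encode ` (carrier S \<times> carrier T),
     smult = (\<lambda>x y. prod_encode (smult S (fst (prod_decode x)) (fst (prod_decode y)),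
                               smult T (snd (prod_decode x)) (snd (prod_decode y))))\<rparr>"

lemma sgrp_prod_fin: "S \<in> fin_sgrps \<Longrightarrow> T \<in> fin_sgrps \<Longrightarrow> sgrp_prod S T \<in> fin_sgrps"
  by (auto simp: fin_sgrps_def sgrp_prod_def)

lemma sgrp_prod_fst: "(\<lambda>x. fst (prod_decode x)) \<in> sgrp_hom (sgrp_prod S T) S"
  by (auto simp: sgrp_hom_def sgrp_prod_def)

lemma sgrp_prod_snd: "(\<lambda>x. snd (prod_decode x)) \<in> sgrp_hom (sgrp_prod S T) T"
  by (auto simp: sgrp_hom_def sgrp_prod_def)

lemma sgrp_hom_comp: "h \<in> sgrp_hom S T \<Longrightarrow> g \<in> sgrp_hom T U \<Longrightarrow> (\<lambda>x. g (h x)) \<in> sgrp_hom S U"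
  by (simp add: sgrp_hom_def Pi_iff)

text \<open>Two indices are dominated by their product with the diagonal assignment of generators,
  the projections being the connecting morphisms. The product is transported by
  \<open>prod_encode\<close> because indices must be carried by sets of naturals.\<close>

lemma gen_sgrps_directed:
  assumes "finite F" "F \<subseteq> gen_sgrps fin_sgrps A"
  shows "\<exists>T \<theta>. (T, \<theta>) \<in> gen_sgrps fin_sgrps A \<and>
    (\<forall>S \<phi>. (S, \<phi>) \<in> F \<longrightarrow> (\<exists>h \<in> sgrp_hom T S. \<forall>a\<in>A. h (\<theta> a) = \<phi> a))"
  using assms
proof (induction F)
  case empty
  let ?T = "\<lparr>carrier = {0}, smult = (\<lambda>x y. 0)\<rparr> :: nat sgrp"
  have "(?T, \<lambda>a\<in>A. 0) \<in> gen_sgrps fin_sgrps A"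
    by (auto simp: gen_sgrps_iff fin_sgrps_def)
  then show ?case by blast
next
  case (insert i F)
  obtain T \<theta> where T: "(T, \<theta>) \<in> gen_sgrps fin_sgrps A"
    "\<And>S \<phi>. (S, \<phi>) \<in> F \<Longrightarrow> \<exists>h \<in> sgrp_hom T S. \<forall>a\<in>A. h (\<theta> a) = \<phi> a"
    using insert by auto
  obtain S \<phi> where i: "i = (S, \<phi>)" by (cases i)
  have S: "(S, \<phi>) \<in> gen_sgrps fin_sgrps A" using insert i by auto
  define U where "U = sgrp_prod S T"
  define \<eta> where "\<eta> = (\<lambda>a\<in>A. prod_encode (\<phi> a, \<theta> a))"
  have U: "(U, \<eta>) \<in> gen_sgrps fin_sgrps A"
    using S T(1) sgrp_prod_fin[of S T]
    by (auto simp: gen_sgrps_iff U_def \<eta>_def sgrp_prod_def PiE_iff)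
  have "\<exists>h \<in> sgrp_hom U S'. \<forall>a\<in>A. h (\<eta> a) = \<phi>' a" if "(S', \<phi>') \<in> insert i F" for S' \<phi>'
  proof (cases "(S', \<phi>') = i")
    case True
    then show ?thesis
      by (intro bexI[of _ "\<lambda>x. fst (prod_decode x)"])
        (auto simp: i \<eta>_def U_def sgrp_prod_fst)
  next
    case False
    then obtain h where "h \<in> sgrp_hom T S'" "\<forall>a\<in>A. h (\<theta> a) = \<phi>' a" using T(2) \<open>(S', \<phi>') \<in> insert i F\<close> by blast
    then show ?thesis
      by (intro bexI[of _ "\<lambda>x. h (snd (prod_decode x))"])
        (auto simp: \<eta>_def U_def intro: sgrp_hom_comp[OF sgrp_prod_snd])
  qed
  with U show ?case by blast
qed

text \<open>One index dominates all of \<open>F\<close>; its coordinate of \<open>x\<close> lies in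
  the subsemigroup generated by the letters, hence is the value of a word, and the connecting
  morphisms carry this word to every member of \<open>F\<close>.\<close>

lemma free_pro_approx:
  assumes "x \<in> carrier (free_pro fin_sgrps A)" "finite F" "F \<subseteq> gen_sgrps fin_sgrps A"
  shows "\<exists>w. w \<in> lists A \<and> w \<noteq> [] \<and> (\<forall>S \<phi>. (S, \<phi>) \<in> F \<longrightarrow> x (S, \<phi>) = eval_word S \<phi> w)"
proof -
  obtain T \<theta> where T: "(T, \<theta>) \<in> gen_sgrps fin_sgrps A"
    "\<And>S \<phi>. (S, \<phi>) \<in> F \<Longrightarrow> \<exists>h \<in> sgrp_hom T S. \<forall>a\<in>A. h (\<theta> a) = \<phi> a"
    using gen_sgrps_directed[OF assms(2,3)] by blast
  have T': "is_sgrp T" "\<theta> \<in> A \<rightarrow> carrier T" using gen_sgrps_carrier[OF _ T(1)] by auto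
  obtain w where w: "w \<in> lists A" "w \<noteq> []" "x (T, \<theta>) = eval_word T \<theta> w"
    using generated_eval_wordE[OF free_pro_generated[OF assms(1) T(1)] T'] by blast
  have "x (S, \<phi>) = eval_word S \<phi> w" if S: "(S, \<phi>) \<in> F" for S \<phi>
  proof -
    obtain h where h: "h \<in> sgrp_hom T S" "\<And>a. a \<in> A \<Longrightarrow> h (\<theta> a) = \<phi> a" using T(2)[OF S] by blast
    have "x (S, \<phi>) = h (x (T, \<theta>))"
      using free_pro_compatible[OF assms(1) T(1) _ h] S assms(3) by auto
    also have "\<dots> = eval_word S \<phi> w"
      using eval_word_hom[OF T' h w(1,2)] w(3) by simp
    finally show ?thesis .
  qed
  with w show ?thesis by blast
qed

section \<open>Topology by finitely many coordinates, and closures of languages\<close>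

lemma topspace_free_pro:
  assumes "V \<subseteq> fin_sgrps" shows "topspace (free_pro_topology V A) = carrier (free_pro V A)"
proof -
  have "carrier (free_pro V A) \<subseteq> (\<Pi>\<^sub>E (S, \<phi>) \<in> gen_sgrps V A. carrier S)"
    by (intro subsetI PiE_I) (auto simp: free_pro_in_carrier[OF assms] extensional_arb[OF free_pro_extensional])
  then show ?thesis
    using free_pro_in_carrier[OF assms]
    by (auto simp: free_pro_topology_def PiE_iff free_pro_extensional split: prod.splits)
qed

text \<open>A basic open set of the product restricts only finitely many coordinates, so agreeing
  with \<open>x\<close> on these is enough to lie in it.\<close>

lemma free_pro_nbhd:
  assumes "V \<subseteq> fin_sgrps" "openin (free_pro_topology V A) U" "x \<in> U"
  shows "\<exists>F. finite F \<and> F \<subseteq> gen_sgrps V A \<and> {y \<in> carrier (free_pro V A). \<forall>i\<in>F. y i = x i} \<subseteq> U"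
proof -
  let ?X = "\<lambda>(S, \<phi>). discrete_topology (carrier S)"
  obtain W where W: "openin (product_topology ?X (gen_sgrps V A)) W" "U = W \<inter> carrier (free_pro V A)"
    using assms(2) by (auto simp: free_pro_topology_def openin_subtopology)
  then obtain B where B: "finite {i \<in> gen_sgrps V A. B i \<noteq> topspace (?X i)}"
    "x \<in> Pi\<^sub>E (gen_sgrps V A) B" "Pi\<^sub>E (gen_sgrps V A) B \<subseteq> W"
    using assms(3) unfolding openin_product_topology_alt by blast
  have x: "x \<in> topspace (product_topology ?X (gen_sgrps V A))"
    using W assms(3) openin_subset by blast
  show ?thesis
  proof (intro exI conjI subsetI)
    fix y assume y: "y \<in> {y \<in> carrier (free_pro V A). \<forall>i\<in>{i \<in> gen_sgrps V A. B i \<noteq> topspace (?X i)}. y i = x i}"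
    then have "y \<in> U \<or> y \<notin> Pi\<^sub>E (gen_sgrps V A) B" using W B by auto
    moreover have "y i \<in> B i" if i: "i \<in> gen_sgrps V A" for i
    proof (cases "B i = topspace (?X i)")
      case True
      then show ?thesis using y i free_pro_in_carrier[OF assms(1)] by (cases i) auto
    next
      case False
      then show ?thesis using y i B(2) by (auto simp del: split_paired_All)
    qed
    moreover have "y \<in> extensional (gen_sgrps V A)" using y by (simp add: free_pro_carrier_iff)
    ultimately show "y \<in> U" by (auto simp: PiE_iff)
  qed (use B in auto)
qed

lemma openin_free_pro_cylinder:
  assumes "V \<subseteq> fin_sgrps" "finite F" "F \<subseteq> gen_sgrps V A" "x \<in> carrier (free_pro V A)"
  shows "openin (free_pro_topology V A) {y \<in> carrier (free_pro V A). \<forall>i\<in>F. y i = x i}"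
proof -
  let ?X = "\<lambda>(S, \<phi>). discrete_topology (carrier S)"
  define B where "B i = (if i \<in> F then {x i} else topspace (?X i))" for i
  have x: "x i \<in> topspace (?X i)" if "i \<in> gen_sgrps V A" for i
    using free_pro_in_carrier[OF assms(1,4)] that by (cases i) auto
  have "openin (product_topology ?X (gen_sgrps V A)) (Pi\<^sub>E (gen_sgrps V A) B)"
    unfolding openin_PiE_gen
  proof (intro disjI2 conjI ballI)
    show "finite {i \<in> gen_sgrps V A. B i \<noteq> topspace (?X i)}"
      by (rule finite_subset[OF _ assms(2)]) (auto simp: B_def)
    fix i assume "i \<in> gen_sgrps V A"
    then show "openin (?X i) (B i)"
      using x[of i] by (cases i) (auto simp: B_def)
  qed
  moreover have "{y \<in> carrier (free_pro V A). \<forall>i\<in>F. y i = x i} = Pi\<^sub>E (gen_sgrps V A) B \<inter> carrier (free_pro V A)"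
  proof (intro equalityI subsetI)
    fix y assume "y \<in> {y \<in> carrier (free_pro V A). \<forall>i\<in>F. y i = x i}"
    then have y: "y \<in> carrier (free_pro V A)" "\<forall>i\<in>F. y i = x i" by blast+
    have "y \<in> Pi\<^sub>E (gen_sgrps V A) B"
    proof (rule PiE_I)
      fix i assume "i \<in> gen_sgrps V A"
      then show "y i \<in> B i" using y free_pro_in_carrier[OF assms(1) y(1)] by (cases i) (auto simp: B_def)
    next
      fix i assume "i \<notin> gen_sgrps V A"
      then show "y i = undefined" using extensional_arb[OF free_pro_extensional[OF y(1)]] by blast
    qed
    with y show "y \<in> Pi\<^sub>E (gen_sgrps V A) B \<inter> carrier (free_pro V A)" by blast
  next
    fix y assume y: "y \<in> Pi\<^sub>E (gen_sgrps V A) B \<inter> carrier (free_pro V A)"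
    have "y i = x i" if "i \<in> F" for i
    proof -
      have "y i \<in> B i" using assms(3) y that by blast
      then show ?thesis using that by (simp add: B_def)
    qed
    with y show "y \<in> {y \<in> carrier (free_pro V A). \<forall>i\<in>F. y i = x i}" by blast
  qed
  ultimately show ?thesis by (auto simp: free_pro_topology_def openin_subtopology)
qed

lemma rational_subset_lists: "rational A L \<Longrightarrow> L \<subseteq> lists A"
proof (induction rule: rational.induct)
  case (star K)
  then show ?case by (auto simp: lists_eq_set subset_iff) blast
qed (auto simp: lists_eq_set subset_iff)

lemma topspace_adjoin_point: "topspace (adjoin_point X) = insert None (Some ` topspace X)"
proof
  have "{x. Some x \<in> insert None (Some ` topspace X)} = topspace X" by auto
  then have "openin (adjoin_point X) (insert None (Some ` topspace X))"
    by (simp add: openin_adjoin_point)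
  then show "insert None (Some ` topspace X) \<subseteq> topspace (adjoin_point X)"
    by (rule openin_subset)
qed (use openin_adjoin_point[of X "topspace (adjoin_point X)"] in simp)

text \<open>Replaces the topology by finite approximation: neighbourhoods of \<open>t\<close> amount
  to finite sets of coordinates, and since the adjoined identity is isolated, only nonempty words
  can approximate \<open>Some t\<close>.\<close>

lemma Some_in_Cl_iff:
  assumes "L \<subseteq> lists A"
  shows "Some t \<in> Cl A L \<longleftrightarrow> t \<in> carrier (free_pro fin_sgrps A) \<and>
    (\<forall>F. finite F \<longrightarrow> F \<subseteq> gen_sgrps fin_sgrps A \<longrightarrow>
      (\<exists>w\<in>L. w \<noteq> [] \<and> (\<forall>S \<phi>. (S, \<phi>) \<in> F \<longrightarrow> t (S, \<phi>) = eval_word S \<phi> w)))"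
    (is "?l \<longleftrightarrow> ?r")
proof
  assume l: ?l
  then have t: "t \<in> carrier (free_pro fin_sgrps A)"
    by (auto simp: Cl_def in_closure_of topspace_adjoin_point topspace_free_pro)
  have "\<exists>w\<in>L. w \<noteq> [] \<and> (\<forall>S \<phi>. (S, \<phi>) \<in> F \<longrightarrow> t (S, \<phi>) = eval_word S \<phi> w)"
    if F: "finite F" "F \<subseteq> gen_sgrps fin_sgrps A" for F
  proof -
    define U where "U = {y \<in> carrier (free_pro fin_sgrps A). \<forall>i\<in>F. y i = t i}"
    have "openin (free_pro_topology fin_sgrps A) U"
      using openin_free_pro_cylinder[OF _ F t] by (simp add: U_def)
    moreover have "{x. Some x \<in> Some ` U} = U" by auto
    moreover have "U \<subseteq> carrier (free_pro fin_sgrps A)" by (auto simp: U_def)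
    ultimately have "openin (adjoin_point (free_pro_topology fin_sgrps A)) (Some ` U)"
      by (auto simp: openin_adjoin_point topspace_free_pro)
    moreover have "Some t \<in> Some ` U" using t by (simp add: U_def)
    moreover have "Some t \<in> adjoin_point (free_pro_topology fin_sgrps A) closure_of (word_value A ` L)"
      using l by (simp add: Cl_def)
    ultimately have "\<exists>y. y \<in> word_value A ` L \<and> y \<in> Some ` U"
      unfolding in_closure_of by (meson imageE)
    then obtain w where w: "w \<in> L" "word_value A w \<in> Some ` U"
      by blast
    then have w0: "w \<noteq> []" by auto
    have wU: "eval_word (free_pro fin_sgrps A) (gen fin_sgrps A) w \<in> U"
      using w(2) unfolding word_value_eq[OF w0] by blast
    have "t (S, \<phi>) = eval_word S \<phi> w" if S: "(S, \<phi>) \<in> F" for S \<phi>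
    proof -
      have "t (S, \<phi>) = eval_word (free_pro fin_sgrps A) (gen fin_sgrps A) w (S, \<phi>)" using wU S by (simp add: U_def)
      then show ?thesis using eval_word_apply[OF subsetD[OF F(2) S] w0] by simp
    qed
    then show ?thesis using w w0 by blast
  qed
  with t show ?r by blast
next
  assume r: ?r
  then have t: "t \<in> carrier (free_pro fin_sgrps A)" by blast
  show ?l
    unfolding Cl_def in_closure_of
  proof (intro conjI allI impI)
    show "Some t \<in> topspace (adjoin_point (free_pro_topology fin_sgrps A))"
      using t by (simp add: topspace_adjoin_point topspace_free_pro)
    fix T assume T: "Some t \<in> T \<and> openin (adjoin_point (free_pro_topology fin_sgrps A)) T"
    then have "openin (free_pro_topology fin_sgrps A) {x. Some x \<in> T}" "t \<in> {x. Some x \<in> T}"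
      by (auto simp: openin_adjoin_point)
    from free_pro_nbhd[OF order.refl this] obtain F where F: "finite F" "F \<subseteq> gen_sgrps fin_sgrps A"
      "{y \<in> carrier (free_pro fin_sgrps A). \<forall>i\<in>F. y i = t i} \<subseteq> {x. Some x \<in> T}" by blast
    obtain w where w: "w \<in> L" "w \<noteq> []" "\<And>S \<phi>. (S, \<phi>) \<in> F \<Longrightarrow> t (S, \<phi>) = eval_word S \<phi> w"
      using r F by blast
    have "w \<in> lists A" using w(1) assms by blast
    then have "eval_word (free_pro fin_sgrps A) (gen fin_sgrps A) w \<in> {x. Some x \<in> T}"
      using F w by (intro subsetD[OF F(3)]) (auto simp: free_pro_word_carrier eval_word_apply)
    then show "\<exists>y. y \<in> word_value A ` L \<and> y \<in> T"
      using w by (intro exI[of _ "word_value A w"]) (simp add: word_value_eq image_iff, metis word_value_eq)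
  qed
qed

section \<open>Continuous homomorphisms and satisfaction of identities\<close>

lemma cont_hom_carrier:
  "f \<in> cont_hom V A W B \<Longrightarrow> x \<in> carrier (free_pro V A) \<Longrightarrow> f x \<in> carrier (free_pro W B)"
  by (auto simp: cont_hom_def sgrp_hom_def)

text \<open>By continuity, agreement with \<open>u\<close> on a further finite set of coordinates
  forces agreement of the images on \<open>G\<close>. A word approximating \<open>u\<close> on
  \<open>F\<close> together with that set therefore serves on both sides.\<close>

lemma cont_hom_approx:
  assumes W: "W \<subseteq> fin_sgrps" and \<delta>: "\<delta> \<in> cont_hom fin_sgrps B W A"
    and u: "u \<in> carrier (free_pro fin_sgrps B)"
    and F: "finite F" "F \<subseteq> gen_sgrps fin_sgrps B" and G: "finite G" "G \<subseteq> gen_sgrps W A"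
  shows "\<exists>w. w \<in> lists B \<and> w \<noteq> [] \<and> (\<forall>S \<phi>. (S, \<phi>) \<in> F \<longrightarrow> u (S, \<phi>) = eval_word S \<phi> w) \<and>
    (\<forall>S \<phi>. (S, \<phi>) \<in> G \<longrightarrow> \<delta> u (S, \<phi>) = eval_word S (\<lambda>b. \<delta> (gen fin_sgrps B b) (S, \<phi>)) w)"
proof -
  let ?O = "{y \<in> carrier (free_pro W A). \<forall>i\<in>G. y i = \<delta> u i}"
  have \<delta>': "\<delta> \<in> sgrp_hom (free_pro fin_sgrps B) (free_pro W A)"
    and c: "continuous_map (free_pro_topology fin_sgrps B) (free_pro_topology W A) \<delta>"
    using \<delta> by (auto simp: cont_hom_def)
  have \<delta>u: "\<delta> u \<in> carrier (free_pro W A)" using cont_hom_carrier[OF \<delta> u] .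
  have "openin (free_pro_topology fin_sgrps B) {x \<in> carrier (free_pro fin_sgrps B). \<delta> x \<in> ?O}"
    using openin_continuous_map_preimage[OF c openin_free_pro_cylinder[OF W G \<delta>u]]
    by (simp add: topspace_free_pro)
  moreover have "u \<in> {x \<in> carrier (free_pro fin_sgrps B). \<delta> x \<in> ?O}" using u \<delta>u by auto
  ultimately obtain F' where F': "finite F'" "F' \<subseteq> gen_sgrps fin_sgrps B"
    "{y \<in> carrier (free_pro fin_sgrps B). \<forall>i\<in>F'. y i = u i} \<subseteq> {x \<in> carrier (free_pro fin_sgrps B). \<delta> x \<in> ?O}"
    by (rule free_pro_nbhd[OF order.refl, THEN exE]) blast
  obtain w where w: "w \<in> lists B" "w \<noteq> []" "\<And>S \<phi>. (S, \<phi>) \<in> F \<union> F' \<Longrightarrow> u (S, \<phi>) = eval_word S \<phi> w"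
    using free_pro_approx[OF u, of "F \<union> F'"] F F' by blast
  let ?w = "eval_word (free_pro fin_sgrps B) (gen fin_sgrps B) w"
  have "?w \<in> {y \<in> carrier (free_pro fin_sgrps B). \<forall>i\<in>F'. y i = u i}"
    using w F'(2) by (auto simp: free_pro_word_carrier eval_word_apply)
  then have "\<delta> ?w \<in> ?O" using F'(3) by blast
  moreover have "\<delta> ?w = eval_word (free_pro W A) (\<lambda>b. \<delta> (gen fin_sgrps B b)) w"
    by (rule eval_word_hom[OF free_pro_is_sgrp _ \<delta>' _ w(1,2), of "gen fin_sgrps B"])
      (auto simp: gen_carrier)
  moreover have "eval_word (free_pro W A) (\<lambda>b. \<delta> (gen fin_sgrps B b)) w (S, \<phi>) =
      eval_word S (\<lambda>b. \<delta> (gen fin_sgrps B b) (S, \<phi>)) w" if "(S, \<phi>) \<in> G" for S \<phi>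
    using w(2)
  proof (induction w)
    case (Cons a w)
    then show ?case using that G(2)
      by (cases "w = []") (auto simp: eval_word_Cons free_pro_smult)
  qed simp
  ultimately have "\<delta> u (S, \<phi>) = eval_word S (\<lambda>b. \<delta> (gen fin_sgrps B b) (S, \<phi>)) w" if "(S, \<phi>) \<in> G" for S \<phi>
    using that by fastforce
  with w show ?thesis by blast
qed

lemma eval_word_cong: "w \<in> lists A \<Longrightarrow> (\<And>a. a \<in> A \<Longrightarrow> \<phi> a = \<theta> a) \<Longrightarrow> eval_word S \<phi> w = eval_word S \<theta> w"
proof (induction w)
  case (Cons a w)
  then show ?case by (cases "w = []") (auto simp: eval_word_Cons)
qed simp

lemma continuous_map_free_proI:
  assumes V: "V \<subseteq> fin_sgrps" and W: "W \<subseteq> fin_sgrps"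
    and f: "\<And>x. x \<in> carrier (free_pro V A) \<Longrightarrow> f x \<in> carrier (free_pro W B)"
    and ix: "\<And>i. i \<in> gen_sgrps W B \<Longrightarrow> \<exists>j \<in> gen_sgrps V A.
      \<forall>x \<in> carrier (free_pro V A). f x i = x j"
  shows "continuous_map (free_pro_topology V A) (free_pro_topology W B) f"
  unfolding continuous_map_def
proof (intro conjI allI impI)
  show "f \<in> topspace (free_pro_topology V A) \<rightarrow> topspace (free_pro_topology W B)"
    using f by (simp add: topspace_free_pro V W)
  fix U assume U: "openin (free_pro_topology W B) U"
  show "openin (free_pro_topology V A) {x \<in> topspace (free_pro_topology V A). f x \<in> U}"
    unfolding topspace_free_pro[OF V]
  proof (subst openin_subopen, intro ballI)
    fix x assume x: "x \<in> {x \<in> carrier (free_pro V A). f x \<in> U}"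
    then obtain F where F: "finite F" "F \<subseteq> gen_sgrps W B"
      "{y \<in> carrier (free_pro W B). \<forall>i\<in>F. y i = f x i} \<subseteq> U"
      using free_pro_nbhd[OF W U, of "f x"] by blast
    obtain j where j: "\<And>i. i \<in> gen_sgrps W B \<Longrightarrow> j i \<in> gen_sgrps V A \<and>
        (\<forall>x \<in> carrier (free_pro V A). f x i = x (j i))"
      using ix by metis
    have "openin (free_pro_topology V A) {y \<in> carrier (free_pro V A). \<forall>i\<in>j ` F. y i = x i}"
      using x F j by (intro openin_free_pro_cylinder V) auto
    moreover have "{y \<in> carrier (free_pro V A). \<forall>i\<in>j ` F. y i = x i} \<subseteq> {x \<in> carrier (free_pro V A). f x \<in> U}"
    proof safe
      fix y assume y: "y \<in> carrier (free_pro V A)" "\<forall>i\<in>j ` F. y i = x i"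
      then have "f y i = f x i" if "i \<in> F" for i
        using j[OF subsetD[OF F(2) that]] that x by auto
      then have "\<forall>i\<in>F. f y i = f x i" by blast
      then show "f y \<in> U" using F(3) f y by blast
    qed
    ultimately show "\<exists>T. openin (free_pro_topology V A) T \<and> x \<in> T \<and> T \<subseteq> {x \<in> carrier (free_pro V A). f x \<in> U}"
      using x by blast
  qed
qed

lemma restrict_canonical_proj:
  assumes "V \<subseteq> fin_sgrps"
  shows "canonical_proj V A (\<lambda>x. restrict x (gen_sgrps V A))"
proof -
  have sub: "gen_sgrps V A \<subseteq> gen_sgrps fin_sgrps A" using assms by (rule gen_sgrps_mono)
  have c: "restrict x (gen_sgrps V A) \<in> carrier (free_pro V A)" if "x \<in> carrier (free_pro fin_sgrps A)" for x
    using that sub by (auto simp: free_pro_carrier_iff subset_iff)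
  have "(\<lambda>x. restrict x (gen_sgrps V A)) \<in> sgrp_hom (free_pro fin_sgrps A) (free_pro V A)"
    using c subsetD[OF sub] by (auto simp: sgrp_hom_def free_pro_def fun_eq_iff)
  moreover have "continuous_map (free_pro_topology fin_sgrps A) (free_pro_topology V A) (\<lambda>x. restrict x (gen_sgrps V A))"
    using c sub by (intro continuous_map_free_proI assms order.refl) auto
  ultimately show ?thesis
    using sub by (auto simp: canonical_proj_def cont_hom_def gen_def fun_eq_iff)
qed

text \<open>Every canonical projection keeps the coordinates indexed by V: a word can be chosen that
  gives the coordinate of both \<open>x\<close> and its image at the index, and on words the two
  agree because the generators do. Conversely, restriction to these coordinates is a canonical
  projection.\<close>

lemma satisfies_iff:
  assumes V: "V \<subseteq> fin_sgrps" and "u \<in> carrier (free_pro fin_sgrps A)" "v \<in> carrier (free_pro fin_sgrps A)"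
  shows "satisfies V A u v \<longleftrightarrow> (\<forall>S \<phi>. (S, \<phi>) \<in> gen_sgrps V A \<longrightarrow> u (S, \<phi>) = v (S, \<phi>))"
proof
  assume "satisfies V A u v"
  then obtain \<psi> where \<psi>: "canonical_proj V A \<psi>" "\<psi> u = \<psi> v" by (auto simp: satisfies_def)
  have "\<psi> x (S, \<phi>) = x (S, \<phi>)"
    if x: "x \<in> carrier (free_pro fin_sgrps A)" and S: "(S, \<phi>) \<in> gen_sgrps V A" for x S \<phi>
  proof -
    have S': "{(S, \<phi>)} \<subseteq> gen_sgrps fin_sgrps A" "{(S, \<phi>)} \<subseteq> gen_sgrps V A" using S V gen_sgrps_mono[OF V] by auto
    have \<psi>': "\<psi> \<in> cont_hom fin_sgrps A V A" and g: "\<And>a. a \<in> A \<Longrightarrow> \<psi> (gen fin_sgrps A a) = gen V A a"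
      using \<psi>(1) by (auto simp: canonical_proj_def)
    obtain w where w: "w \<in> lists A" "x (S, \<phi>) = eval_word S \<phi> w"
       "\<psi> x (S, \<phi>) = eval_word S (\<lambda>b. \<psi> (gen fin_sgrps A b) (S, \<phi>)) w"
      using cont_hom_approx[OF V \<psi>' x _ S'(1) _ S'(2)] by auto
    have "eval_word S (\<lambda>b. \<psi> (gen fin_sgrps A b) (S, \<phi>)) w = eval_word S \<phi> w"
      using S by (intro eval_word_cong[OF w(1)]) (simp add: g gen_apply)
    then show ?thesis using w by simp
  qed
  then show "\<forall>S \<phi>. (S, \<phi>) \<in> gen_sgrps V A \<longrightarrow> u (S, \<phi>) = v (S, \<phi>)"
    using assms \<psi>(2) by metis
next
  assume "\<forall>S \<phi>. (S, \<phi>) \<in> gen_sgrps V A \<longrightarrow> u (S, \<phi>) = v (S, \<phi>)"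
  then have "restrict u (gen_sgrps V A) = restrict v (gen_sgrps V A)" by (auto simp: fun_eq_iff)
  then show "satisfies V A u v"
    unfolding satisfies_def using restrict_canonical_proj[OF V] by blast
qed

text \<open>The extension of \<open>t\<close> given by freeness. A coordinate in \<open>S\<close> is
  read off from a coordinate of \<open>u\<close> in the same \<open>S\<close>, after sending each
  generator to the value of its substitute there.\<close>

definition subst_hom :: "'b set \<Rightarrow> 'a set \<Rightarrow> ('b \<Rightarrow> 'a pro) \<Rightarrow> 'b pro \<Rightarrow> 'a pro" where
  "subst_hom B A t u = (\<lambda>(S, \<phi>) \<in> gen_sgrps fin_sgrps A. u (S, \<lambda>b\<in>B. t b (S, \<phi>)))"

context
  fixes A :: "'a set" and B :: "'b set" and t :: "'b \<Rightarrow> 'a pro"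
  assumes t: "\<And>b. b \<in> B \<Longrightarrow> t b \<in> carrier (free_pro fin_sgrps A)"
begin

lemma subst_index: "(S, \<phi>) \<in> gen_sgrps fin_sgrps A \<Longrightarrow> (S, \<lambda>b\<in>B. t b (S, \<phi>)) \<in> gen_sgrps fin_sgrps B"
  using free_pro_in_carrier[OF order.refl t, of _ S \<phi>] by (auto simp: gen_sgrps_iff)

lemma subst_hom_gen: "b \<in> B \<Longrightarrow> subst_hom B A t (gen fin_sgrps B b) = t b"
  by (rule extensionalityI[of _ "gen_sgrps fin_sgrps A"])
    (auto simp: subst_hom_def gen_apply subst_index free_pro_extensional[OF t])

lemma subst_hom_carrier:
  assumes u: "u \<in> carrier (free_pro fin_sgrps B)"
  shows "subst_hom B A t u \<in> carrier (free_pro fin_sgrps A)"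
  unfolding free_pro_carrier_iff
proof (intro conjI allI impI)
  show "subst_hom B A t u \<in> extensional (gen_sgrps fin_sgrps A)" by (simp add: subst_hom_def)
  fix S \<phi> assume S: "(S, \<phi>) \<in> gen_sgrps fin_sgrps A"
  have "u (S, \<lambda>b\<in>B. t b (S, \<phi>)) \<in> generated S ((\<lambda>b\<in>B. t b (S, \<phi>)) ` B)"
    using free_pro_generated[OF u subst_index[OF S]] .
  also have "\<dots> \<subseteq> generated S (\<phi> ` A)"
    using free_pro_generated[OF t S] by (intro generated_subset_generated) auto
  finally show "subst_hom B A t u (S, \<phi>) \<in> generated S (\<phi> ` A)" using S by (simp add: subst_hom_def)
  fix T \<theta> h assume T: "(T, \<theta>) \<in> gen_sgrps fin_sgrps A" "h \<in> sgrp_hom S T" "\<forall>a\<in>A. h (\<phi> a) = \<theta> a"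
  have "h (u (S, \<lambda>b\<in>B. t b (S, \<phi>))) = u (T, \<lambda>b\<in>B. t b (T, \<theta>))"
    by (rule free_pro_compatible[OF u subst_index[OF S] subst_index[OF T(1)] T(2)])
      (use free_pro_compatible[OF t S T(1,2)] T(3) in auto)
  then show "h (subst_hom B A t u (S, \<phi>)) = subst_hom B A t u (T, \<theta>)"
    using S T by (simp add: subst_hom_def)
qed

lemma subst_hom_cont_hom: "subst_hom B A t \<in> cont_hom fin_sgrps B fin_sgrps A"
proof -
  have "subst_hom B A t \<in> sgrp_hom (free_pro fin_sgrps B) (free_pro fin_sgrps A)"
    using subst_hom_carrier subst_index
    by (auto simp: sgrp_hom_def subst_hom_def fun_eq_iff free_pro_def)
  moreover have "continuous_map (free_pro_topology fin_sgrps B) (free_pro_topology fin_sgrps A) (subst_hom B A t)"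
  proof (rule continuous_map_free_proI)
    fix i assume i: "i \<in> gen_sgrps fin_sgrps A"
    obtain S \<phi> where [simp]: "i = (S, \<phi>)" by (cases i)
    show "\<exists>j\<in>gen_sgrps fin_sgrps B. \<forall>x\<in>carrier (free_pro fin_sgrps B). subst_hom B A t x i = x j"
      using i subst_index[of S \<phi>] by (intro bexI[of _ "(S, \<lambda>b\<in>B. t b (S, \<phi>))"]) (auto simp: subst_hom_def)
  qed (auto intro: subst_hom_carrier)
  ultimately show ?thesis by (simp add: cont_hom_def)
qed

end

lemma limitin_free_pro_iff:
  assumes V: "V \<subseteq> fin_sgrps" and f: "\<And>k. f k \<in> carrier (free_pro V A)"
  shows "limitin (free_pro_topology V A) f y sequentially \<longleftrightarrow>
    y \<in> carrier (free_pro V A) \<and> (\<forall>i \<in> gen_sgrps V A. \<forall>\<^sub>F k in sequentially. f k i = y i)"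
  unfolding limitin_def topspace_free_pro[OF V]
proof (intro conj_cong refl iffI allI impI ballI)
  fix i assume y: "y \<in> carrier (free_pro V A)" and i: "i \<in> gen_sgrps V A"
    and *: "\<forall>U. openin (free_pro_topology V A) U \<and> y \<in> U \<longrightarrow> (\<forall>\<^sub>F x in sequentially. f x \<in> U)"
  have "openin (free_pro_topology V A) {x \<in> carrier (free_pro V A). \<forall>i\<in>{i}. x i = y i}"
    using i y by (intro openin_free_pro_cylinder V) auto
  with * y have "\<forall>\<^sub>F k in sequentially. f k \<in> {x \<in> carrier (free_pro V A). \<forall>i\<in>{i}. x i = y i}" by blast
  then show "\<forall>\<^sub>F k in sequentially. f k i = y i" by eventually_elim auto
next
  fix U assume y: "y \<in> carrier (free_pro V A)" and U: "openin (free_pro_topology V A) U \<and> y \<in> U"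
    and *: "\<forall>i \<in> gen_sgrps V A. \<forall>\<^sub>F k in sequentially. f k i = y i"
  obtain F where F: "finite F" "F \<subseteq> gen_sgrps V A" "{x \<in> carrier (free_pro V A). \<forall>i\<in>F. x i = y i} \<subseteq> U"
    using free_pro_nbhd[OF V conjunct1[OF U] conjunct2[OF U]] by (elim exE conjE) (rule that)
  have "\<forall>\<^sub>F k in sequentially. \<forall>i\<in>F. f k i = y i"
    using F(2) * by (intro eventually_ball_finite F(1)) blast
  then show "\<forall>\<^sub>F k in sequentially. f k \<in> U"
  proof eventually_elim
    case (elim k)
    then have "f k \<in> {x \<in> carrier (free_pro V A). \<forall>i\<in>F. x i = y i}" using f by simp
    then show ?case by (rule subsetD[OF F(3)])
  qed
qed

section \<open>Exponents of letters\<close>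

text \<open>Positivity is demanded because \<open>multiplicity p 0 = 0\<close>, so that 0 would
  otherwise count as a divisor of every \<pi>.\<close>

definition nat_dvd_supernatural :: "supernatural \<Rightarrow> nat \<Rightarrow> bool" where
  "nat_dvd_supernatural \<pi> m \<longleftrightarrow> 0 < m \<and> supernatural_dvd (supernatural_of_nat m) \<pi>"

lemma nat_dvd_supernatural_iff:
  "nat_dvd_supernatural \<pi> m \<longleftrightarrow> 0 < m \<and> (\<forall>p. prime p \<longrightarrow> enat (multiplicity p m) \<le> \<pi> p)"
  by (simp add: nat_dvd_supernatural_def supernatural_dvd_def supernatural_of_nat_def)

lemma nat_dvd_supernatural_dvd:
  "nat_dvd_supernatural \<pi> m \<Longrightarrow> d dvd m \<Longrightarrow> nat_dvd_supernatural \<pi> d"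
  unfolding nat_dvd_supernatural_iff
  by (metis dual_order.trans dvd_imp_multiplicity_le enat_ord_simps(1) nat_dvd_not_less not_gr_zero dvd_0_left_iff)

lemma nat_dvd_supernatural_lcm:
  "nat_dvd_supernatural \<pi> a \<Longrightarrow> nat_dvd_supernatural \<pi> b \<Longrightarrow> nat_dvd_supernatural \<pi> (lcm a b)"
  unfolding nat_dvd_supernatural_iff
  by (auto simp: multiplicity_lcm lcm_pos_nat max_def)

lemma nat_dvd_supernatural_1: "nat_dvd_supernatural \<pi> 1"
  by (simp add: nat_dvd_supernatural_iff zero_enat_def[symmetric])

section \<open>Cyclic groups as counters of letters\<close>

definition cyc :: "nat \<Rightarrow> nat sgrp" where
  "cyc m = \<lparr>carrier = {..<m}, smult = (\<lambda>x y. (x + y) mod m)\<rparr>"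

lemma cyc_simps [simp]: "carrier (cyc m) = {..<m}" "smult (cyc m) x y = (x + y) mod m"
  by (simp_all add: cyc_def)

lemma cyc_fin_sgrps: "0 < m \<Longrightarrow> cyc m \<in> fin_sgrps"
  by (auto simp: fin_sgrps_def mod_simps add.assoc)

lemma with_one_simps [simp]:
  "carrier (with_one S e) = carrier S" "monoid.mult (with_one S e) = smult S" "one (with_one S e) = e"
  by (simp_all add: with_one_def)

lemma comm_group_cyc:
  assumes "0 < m" shows "comm_group (with_one (cyc m) 0)"
proof (rule comm_groupI)
  fix x assume "x \<in> carrier (with_one (cyc m) 0)"
  then show "\<exists>y\<in>carrier (with_one (cyc m) 0). y \<otimes>\<^bsub>with_one (cyc m) 0\<^esub> x = \<one>\<^bsub>with_one (cyc m) 0\<^esub>"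
    using assms by (intro bexI[of _ "(m - x) mod m"]) (auto simp: mod_simps)
qed (use assms in \<open>auto simp: mod_simps ac_simps\<close>)

lemma cyc_nat_pow: 
  assumes "0 < m" "x < m" shows "x [^]\<^bsub>with_one (cyc m) 0\<^esub> (n::nat) = (n * x) mod m"
proof (induction n)
  case (Suc n)
  then show ?case using assms by (simp add: nat_pow_Suc mod_simps algebra_simps)
qed (use assms in simp)

lemma group_exponent_cyc:
  assumes "0 < m" shows "group_exponent (with_one (cyc m) 0) = m"
  unfolding group_exponent_def
proof (rule Least_equality)
  show "0 < m \<and> (\<forall>x\<in>carrier (with_one (cyc m) 0). x [^]\<^bsub>with_one (cyc m) 0\<^esub> m = \<one>\<^bsub>with_one (cyc m) 0\<^esub>)"
    using assms by (auto simp: cyc_nat_pow)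
next
  fix n :: nat assume n: "0 < n \<and> (\<forall>x\<in>carrier (with_one (cyc m) 0). x [^]\<^bsub>with_one (cyc m) 0\<^esub> n = \<one>\<^bsub>with_one (cyc m) 0\<^esub>)"
  \<comment> \<open>The generator is written \<open>1 mod m\<close> so that the trivial group,
    \<open>m = 1\<close>, is covered.\<close>
  have "1 mod m \<in> carrier (with_one (cyc m) 0)" using assms by simp
  with n have "(1 mod m) [^]\<^bsub>with_one (cyc m) 0\<^esub> n = \<one>\<^bsub>with_one (cyc m) 0\<^esub>" by blast
  then have "n mod m = 0" using assms by (simp add: cyc_nat_pow mod_mult_right_eq[of n 1 m, simplified])
  then show "m \<le> n" using n by (auto intro: dvd_imp_le)
qed

lemma cyc_in_Ab: "nat_dvd_supernatural \<pi> m \<Longrightarrow> cyc m \<in> Ab \<pi>"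
  by (auto simp: Ab_def nat_dvd_supernatural_def cyc_fin_sgrps group_exponent_cyc
      intro!: exI[of _ 0] comm_group_cyc)

lemma Ab_fin_sgrps: "Ab \<pi> \<subseteq> fin_sgrps"
  by (auto simp: Ab_def)

text \<open>The coordinate at this index counts occurrences of \<open>a\<close> modulo
  \<open>m\<close>; the reduction of \<open>of_bool\<close> makes a difference only for
  \<open>m = 1\<close>.\<close>

definition cyc_gen :: "'a set \<Rightarrow> nat \<Rightarrow> 'a \<Rightarrow> 'a gen_sgrp" where
  "cyc_gen A m a = (cyc m, \<lambda>b\<in>A. of_bool (b = a) mod m)"

text \<open>The exponent of the letter \<open>a\<close> in \<open>t\<close>, modulo \<open>m\<close>.\<close>

definition val :: "'a set \<Rightarrow> nat \<Rightarrow> 'a \<Rightarrow> 'a pro \<Rightarrow> nat" where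
  "val A m a t = t (cyc_gen A m a)"

lemma cyc_gen_in: "cyc m \<in> V \<Longrightarrow> 0 < m \<Longrightarrow> cyc_gen A m a \<in> gen_sgrps V A"
  by (auto simp: cyc_gen_def gen_sgrps_iff)

lemma cyc_gen_fin: "0 < m \<Longrightarrow> cyc_gen A m a \<in> gen_sgrps fin_sgrps A"
  by (simp add: cyc_gen_in cyc_fin_sgrps)

lemma eval_word_cyc:
  assumes "finite B" "\<And>b. b \<in> B \<Longrightarrow> c b < m"
  shows "w \<in> lists B \<Longrightarrow> w \<noteq> [] \<Longrightarrow> eval_word (cyc m) c w = (\<Sum>b\<in>B. count_list w b * c b) mod m"
proof (induction w)
  case (Cons b w)
  have b: "b \<in> B" using Cons.prems by auto
  have "(\<Sum>x\<in>B. count_list (b # w) x * c x) = (\<Sum>x\<in>B. (if x = b then c x else 0) + count_list w x * c x)"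
    by (intro sum.cong) (auto simp: algebra_simps)
  also have "\<dots> = c b + (\<Sum>x\<in>B. count_list w x * c x)"
    using assms(1) b by (simp add: sum.distrib)
  finally have *: "(\<Sum>x\<in>B. count_list (b # w) x * c x) = c b + (\<Sum>x\<in>B. count_list w x * c x)" .
  show ?case
  proof (cases "w = []")
    case True
    then show ?thesis using * b assms(2) by simp
  next
    case False
    then show ?thesis unfolding * using Cons by (simp add: eval_word_Cons mod_simps)
  qed
qed simp

lemma eval_word_cyc_gen:
  assumes "finite A" "0 < m" "a \<in> A" "w \<in> lists A" "w \<noteq> []"
  shows "eval_word (cyc m) (\<lambda>b\<in>A. of_bool (b = a) mod m) w = count_list w a mod m"
proof -
  have "eval_word (cyc m) (\<lambda>b\<in>A. of_bool (b = a) mod m) w =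
    (\<Sum>b\<in>A. count_list w b * (of_bool (b = a) mod m)) mod m"
    using assms by (subst eval_word_cyc[OF assms(1) _ assms(4,5)]) auto
  also have "(\<Sum>b\<in>A. count_list w b * (of_bool (b = a) mod m)) = (\<Sum>b\<in>A. if b = a then count_list w b * (1 mod m) else 0)"
    by (intro sum.cong) auto
  also have "\<dots> = count_list w a * (1 mod m)" using assms by simp
  finally show ?thesis using mod_mult_right_eq[of "count_list w a" 1 m] by (simp only: mult_1_right)
qed

lemma val_approx:
  assumes A: "finite A" "a \<in> A" "0 < m" "w \<in> lists A" "w \<noteq> []"
    and t: "\<And>S \<phi>. (S, \<phi>) \<in> F \<Longrightarrow> t (S, \<phi>) = eval_word S \<phi> w" and "cyc_gen A m a \<in> F"
  shows "val A m a t = count_list w a mod m"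
  using assms(7) t eval_word_cyc_gen[OF A(1,3,2,4,5)] by (simp add: val_def cyc_gen_def)

lemma val_less: "0 < m \<Longrightarrow> t \<in> carrier (free_pro fin_sgrps A) \<Longrightarrow> val A m a t < m"
  using free_pro_in_carrier[OF order.refl, of t A "cyc m"] cyc_gen_fin[of m A a]
  by (auto simp: val_def cyc_gen_def)

lemma val_smult: "0 < m \<Longrightarrow> val A m a (smult (free_pro fin_sgrps A) s t) = (val A m a s + val A m a t) mod m"
  using cyc_gen_fin[of m A a] by (simp add: val_def cyc_gen_def free_pro_smult)

lemma val_gen: "0 < m \<Longrightarrow> b \<in> A \<Longrightarrow> val A m a (gen fin_sgrps A b) = of_bool (b = a) mod m"
  using cyc_gen_fin[of m A a] by (simp add: val_def cyc_gen_def gen_apply)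

text \<open>Reduction from \<open>cyc m\<close> to \<open>cyc d\<close> is a connecting morphism
  between the two counting indices.\<close>

lemma val_mod:
  assumes "0 < m" "d dvd m" "t \<in> carrier (free_pro fin_sgrps A)"
  shows "val A m a t mod d = val A d a t"
proof -
  have d: "0 < d" using assms by (auto dest: dvd_pos_nat)
  have "(\<lambda>x. x mod d) \<in> sgrp_hom (cyc m) (cyc d)"
    using d assms(2) by (auto simp: sgrp_hom_def mod_simps mod_mod_cancel)
  then show ?thesis
    using free_pro_compatible[OF assms(3), of "cyc m" _ "cyc d" _ "\<lambda>x. x mod d"]
      cyc_gen_fin[OF d, of A a] cyc_gen_fin[OF assms(1), of A a] assms(2)
    by (auto simp: val_def cyc_gen_def mod_mod_cancel)
qed

text \<open>On exponent vectors a continuous homomorphism acts as a matrix. For a word this is a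
  count of letters, and one word can be chosen that is right at all counting indices involved, for
  \<open>u\<close> as well as for its image.\<close>

lemma val_cont_hom:
  assumes \<delta>: "\<delta> \<in> cont_hom fin_sgrps B fin_sgrps A" and B: "finite B" and m: "0 < m"
    and u: "u \<in> carrier (free_pro fin_sgrps B)"
  shows "val A m a (\<delta> u) = (\<Sum>b\<in>B. val B m b u * val A m a (\<delta> (gen fin_sgrps B b))) mod m"
proof -
  let ?c = "\<lambda>b. val A m a (\<delta> (gen fin_sgrps B b))"
  have "{cyc_gen A m a} \<subseteq> gen_sgrps fin_sgrps A" "cyc_gen B m ` B \<subseteq> gen_sgrps fin_sgrps B"
    by (auto simp: cyc_gen_fin[OF m])
  note cont_hom_approx[OF order.refl \<delta> u finite_imageI[OF B] this(2) _ this(1)]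
  then obtain w where w: "w \<in> lists B" "w \<noteq> []"
    "\<And>S \<phi>. (S, \<phi>) \<in> cyc_gen B m ` B \<Longrightarrow> u (S, \<phi>) = eval_word S \<phi> w"
    "\<And>S \<phi>. (S, \<phi>) \<in> {cyc_gen A m a} \<Longrightarrow> \<delta> u (S, \<phi>) = eval_word S (\<lambda>b. \<delta> (gen fin_sgrps B b) (S, \<phi>)) w"
    by blast
  have "val A m a (\<delta> u) = eval_word (cyc m) ?c w"
    using w(4)[of "fst (cyc_gen A m a)" "snd (cyc_gen A m a)"] by (simp add: val_def cyc_gen_def)
  also have "\<dots> = (\<Sum>b\<in>B. count_list w b * ?c b) mod m"
    using eval_word_cyc[OF B _ w(1,2), of ?c m] val_less[OF m cont_hom_carrier[OF \<delta> gen_carrier]] by blast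
  also have "\<dots> = (\<Sum>b\<in>B. (count_list w b mod m) * ?c b) mod m"
    by (subst (1 2) mod_sum_eq[symmetric]) (simp add: mod_simps)
  also have "(\<Sum>b\<in>B. (count_list w b mod m) * ?c b) = (\<Sum>b\<in>B. val B m b u * ?c b)"
    using val_approx[OF B _ m w(1,2,3)] by (intro sum.cong) auto
  finally show ?thesis .
qed

lemma (in comm_group) nat_pow_mod_eq:
  assumes "x \<in> carrier G" "x [^] (n::nat) = \<one>"
  shows "x [^] (k mod n) = x [^] (k::nat)"
proof -
  have "x [^] k = x [^] (n * (k div n) + k mod n)" by simp
  also have "\<dots> = (x [^] n) [^] (k div n) \<otimes> x [^] (k mod n)"
    using assms(1) by (simp only: nat_pow_mult nat_pow_pow)
  finally show ?thesis using assms by simp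
qed

lemma eval_word_comm_group:
  assumes "comm_group (with_one S e)" and "finite A" "\<phi> \<in> A \<rightarrow> carrier S"
  shows "w \<in> lists A \<Longrightarrow> w \<noteq> [] \<Longrightarrow>
    eval_word S \<phi> w = finprod (with_one S e) (\<lambda>a. \<phi> a [^]\<^bsub>with_one S e\<^esub> count_list w a) A"
proof (induction w)
  let ?G = "with_one S e"
  interpret comm_group ?G by fact
  have \<phi>: "\<phi> \<in> A \<rightarrow> carrier ?G" using assms(3) by simp
  case (Cons b w)
  have b: "b \<in> A" using Cons.prems by auto
  have "finprod ?G (\<lambda>a. \<phi> a [^]\<^bsub>?G\<^esub> count_list (b # w) a) A =
      finprod ?G (\<lambda>a. (if b = a then \<phi> a else \<one>\<^bsub>?G\<^esub>) \<otimes>\<^bsub>?G\<^esub> \<phi> a [^]\<^bsub>?G\<^esub> count_list w a) A"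
    using \<phi> by (intro finprod_cong') (auto simp: m_comm Pi_iff simp del: with_one_simps)
  also have "\<dots> = \<phi> b \<otimes>\<^bsub>?G\<^esub> finprod ?G (\<lambda>a. \<phi> a [^]\<^bsub>?G\<^esub> count_list w a) A"
    using \<phi> b assms(2) by (subst finprod_multf) (auto simp: finprod_singleton Pi_iff simp del: with_one_simps)
  finally have *: "finprod ?G (\<lambda>a. \<phi> a [^]\<^bsub>?G\<^esub> count_list (b # w) a) A = \<dots>" .
  show ?case
  proof (cases "w = []")
    case True
    then have "finprod ?G (\<lambda>a. \<phi> a [^]\<^bsub>?G\<^esub> count_list w a) A = \<one>\<^bsub>?G\<^esub>"
      by (intro finprod_one_eqI) auto
    moreover have "\<phi> b \<in> carrier ?G" using \<phi> b by blast
    ultimately show ?thesis using * True by (simp del: with_one_simps)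
  next
    case False
    then show ?thesis unfolding * using Cons by (simp add: eval_word_Cons)
  qed
qed simp

text \<open>In a finite abelian group the value of a word depends only on its letter counts modulo
  the exponent of the group, so the cyclic groups in \<open>Ab \<pi>\<close> already detect every
  difference that \<open>Ab \<pi>\<close> detects.\<close>

lemma satisfies_Ab_iff:
  assumes A: "finite A" and u: "u \<in> carrier (free_pro fin_sgrps A)" and v: "v \<in> carrier (free_pro fin_sgrps A)"
  shows "satisfies (Ab \<pi>) A u v \<longleftrightarrow>
    (\<forall>m. nat_dvd_supernatural \<pi> m \<longrightarrow> (\<forall>a\<in>A. val A m a u = val A m a v))"
  unfolding satisfies_iff[OF Ab_fin_sgrps u v]
proof (intro iffI allI impI ballI)
  fix m a assume "nat_dvd_supernatural \<pi> m" "a \<in> A"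
    and *: "\<forall>S \<phi>. (S, \<phi>) \<in> gen_sgrps (Ab \<pi>) A \<longrightarrow> u (S, \<phi>) = v (S, \<phi>)"
  then show "val A m a u = val A m a v"
    using cyc_gen_in[OF cyc_in_Ab, of \<pi> m A a] by (simp add: val_def cyc_gen_def nat_dvd_supernatural_iff)
next
  fix S \<phi> assume *: "\<forall>m. nat_dvd_supernatural \<pi> m \<longrightarrow> (\<forall>a\<in>A. val A m a u = val A m a v)"
    and S: "(S, \<phi>) \<in> gen_sgrps (Ab \<pi>) A"
  have S': "(S, \<phi>) \<in> gen_sgrps fin_sgrps A" using S gen_sgrps_mono[OF Ab_fin_sgrps] by blast
  obtain e where e: "comm_group (with_one S e)"
    "supernatural_dvd (supernatural_of_nat (group_exponent (with_one S e))) \<pi>"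
    using S by (auto simp: gen_sgrps_iff Ab_def)
  let ?G = "with_one S e" and ?n = "group_exponent (with_one S e)"
  interpret comm_group ?G by fact
  have fin: "finite (carrier ?G)" and \<phi>: "\<phi> \<in> A \<rightarrow> carrier S"
    using gen_sgrps_carrier[OF _ S'] by auto
  \<comment> \<open>The order of the group witnesses that the \<open>LEAST\<close> in
    \<open>group_exponent\<close> is attained.\<close>
  have n: "0 < ?n \<and> (\<forall>x\<in>carrier ?G. x [^]\<^bsub>?G\<^esub> ?n = \<one>\<^bsub>?G\<^esub>)"
    unfolding group_exponent_def
    by (rule LeastI[of _ "Coset.order ?G"])
      (use fin pow_order_eq_1 order_gt_0_iff_finite in \<open>auto simp del: with_one_simps\<close>)
  then have n': "nat_dvd_supernatural \<pi> ?n" using e(2) by (simp add: nat_dvd_supernatural_def)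
  \<comment> \<open>A single word has to give the coordinate in \<open>S\<close> and all letter
    counts modulo the exponent of \<open>S\<close>.\<close>
  define F where "F = insert (S, \<phi>) (cyc_gen A ?n ` A)"
  have F: "finite F" "F \<subseteq> gen_sgrps fin_sgrps A" using A S' cyc_gen_fin[of ?n A] n by (auto simp: F_def)
  obtain w where w: "w \<in> lists A" "w \<noteq> []" "\<And>S \<phi>. (S, \<phi>) \<in> F \<Longrightarrow> u (S, \<phi>) = eval_word S \<phi> w"
    using free_pro_approx[OF u F] by blast
  obtain x where x: "x \<in> lists A" "x \<noteq> []" "\<And>S \<phi>. (S, \<phi>) \<in> F \<Longrightarrow> v (S, \<phi>) = eval_word S \<phi> x"
    using free_pro_approx[OF v F] by blast
  have c: "count_list w a mod ?n = count_list x a mod ?n" if "a \<in> A" for a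
  proof -
    have "cyc_gen A ?n a \<in> F" using that by (simp add: F_def)
    then have "val A ?n a u = count_list w a mod ?n" "val A ?n a v = count_list x a mod ?n"
      using val_approx[OF A that _ w] val_approx[OF A that _ x] n by blast+
    then show ?thesis using n' * that by metis
  qed
  have pw: "\<phi> a [^]\<^bsub>?G\<^esub> count_list w a = \<phi> a [^]\<^bsub>?G\<^esub> count_list x a" if "a \<in> A" for a
  proof -
    have \<phi>a: "\<phi> a \<in> carrier ?G" using \<phi> that by auto
    then have "\<phi> a [^]\<^bsub>?G\<^esub> ?n = \<one>\<^bsub>?G\<^esub>" using n by blast
    from nat_pow_mod_eq[OF \<phi>a this, of "count_list w a"] nat_pow_mod_eq[OF \<phi>a this, of "count_list x a"]
    show ?thesis using c[OF that] by simp
  qed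
  have \<phi>': "\<phi> \<in> A \<rightarrow> carrier ?G" using \<phi> by simp
  have "u (S, \<phi>) = eval_word S \<phi> w" "v (S, \<phi>) = eval_word S \<phi> x" using w x by (auto simp: F_def)
  moreover have "eval_word S \<phi> w = eval_word S \<phi> x"
    unfolding eval_word_comm_group[OF e(1) A \<phi> w(1,2)] eval_word_comm_group[OF e(1) A \<phi> x(1,2)]
    using \<phi>' by (intro finprod_cong') (auto simp: pw Pi_iff simp del: with_one_simps)
  ultimately show "u (S, \<phi>) = v (S, \<phi>)" by simp
qed

section \<open>Local-global principle for subgroups of \<open>\<int>\<^sup>I\<close>\<close>

definition int_subgroup :: "('i \<Rightarrow> int) set \<Rightarrow> bool" where
  "int_subgroup H \<longleftrightarrow> (\<lambda>_. 0) \<in> H \<and> (\<forall>g\<in>H. \<forall>h\<in>H. (\<lambda>i. g i - h i) \<in> H)"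

lemma int_subgroup_zero: "int_subgroup H \<Longrightarrow> (\<lambda>_. 0) \<in> H"
  by (simp add: int_subgroup_def)

lemma int_subgroup_diff: "int_subgroup H \<Longrightarrow> g \<in> H \<Longrightarrow> h \<in> H \<Longrightarrow> (\<lambda>i. g i - h i) \<in> H"
  by (simp add: int_subgroup_def)

lemma int_subgroup_add: "int_subgroup H \<Longrightarrow> g \<in> H \<Longrightarrow> h \<in> H \<Longrightarrow> (\<lambda>i. g i + h i) \<in> H"
  using int_subgroup_diff[of H g "\<lambda>i. 0 - h i"] int_subgroup_diff[of H "\<lambda>_. 0" h] int_subgroup_zero[of H] by simp

lemma int_subgroup_mult:
  assumes H: "int_subgroup H" and "h \<in> H"
  shows "(\<lambda>i. k * h i) \<in> H"
proof (induction k rule: int_induct[where k = 0])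
  case base
  then show ?case using int_subgroup_zero[OF H] by simp
next
  case (step1 i)
  then show ?case using int_subgroup_add[OF H step1(2) assms(2)] by (simp add: algebra_simps)
next
  case (step2 i)
  then show ?case using int_subgroup_diff[OF H step2(2) assms(2)] by (simp add: algebra_simps)
qed

text \<open>Eliminate one coordinate \<open>j\<close> at a time: the \<open>j\<close>-th coordinates of \<open>H\<close> form a subgroup
  \<open>d\<int>\<close>; the part of \<open>d\<close> that is not invertible modulo \<open>MM\<close> can be absorbed into the modulus.\<close>

lemma subgroup_local_global:
  fixes H :: "('i \<Rightarrow> int) set" and c :: "'i \<Rightarrow> int" and Q MM :: "nat set"
  assumes Q: "1 \<in> Q" "\<And>q r. q \<in> Q \<Longrightarrow> r \<in> Q \<Longrightarrow> q * r \<in> Q"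
    and fact: "\<And>n::nat. 0 < n \<Longrightarrow> \<exists>q\<in>Q. \<exists>m0. n dvd q * m0 \<and> (\<forall>m\<in>MM. m * m0 \<in> MM)"
    and inf: "infinite MM"
    and I: "finite I"
    and H: "int_subgroup H"
    and c: "\<And>m. m \<in> MM \<Longrightarrow> \<exists>h\<in>H. \<forall>i\<in>I. [h i = c i] (mod int m)"
  shows "\<exists>q\<in>Q. \<exists>h\<in>H. \<forall>i\<in>I. h i = int q * c i"
  using I H c
proof (induction I arbitrary: H c)
  case empty
  then show ?case using Q int_subgroup_zero by blast
next
  case (insert j I H c)
  note H = insert.prems(1) and c = insert.prems(2)
  note Hk = int_subgroup_mult[OF H] and Hd = int_subgroup_diff[OF H]
  show ?case
  proof (cases "\<forall>h\<in>H. h j = 0")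
    case True
    \<comment> \<open>Coordinate \<open>j\<close> imposes nothing on \<open>H\<close>; on the other
      side, \<open>c j\<close> is divisible by arbitrarily large moduli and hence zero.\<close>
    have dv: "int m dvd c j" if "m \<in> MM" for m
      using c[OF that] True by (force simp: cong_0_iff dest: cong_sym)
    have "c j = 0"
    proof (rule ccontr)
      assume "c j \<noteq> 0"
      then have "m \<le> nat \<bar>c j\<bar>" if "m \<in> MM" for m
        using dv[OF that] zdvd_imp_le[of "int m" "\<bar>c j\<bar>"] by auto
      then show False using inf finite_subset[of MM "{..nat \<bar>c j\<bar>}"] by auto
    qed
    moreover obtain q h where "q \<in> Q" "h \<in> H" "\<forall>i\<in>I. h i = int q * c i"
      using insert.IH[OF H] c by blast
    ultimately show ?thesis using True by (intro bexI[of _ q] bexI[of _ h]) auto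
  next
    case False
    \<comment> \<open>The least such \<open>d\<close> generates the group of all values at
      \<open>j\<close>.\<close>
    define P where "P d \<longleftrightarrow> 0 < d \<and> (\<exists>h\<in>H. h j = int d)" for d
    obtain h where h: "h \<in> H" "h j \<noteq> 0" using False by blast
    have "P (nat \<bar>h j\<bar>)"
      using h Hk[OF h(1), of "sgn (h j)"] unfolding P_def
      by (auto simp: sgn_mult_abs intro!: bexI[of _ "\<lambda>i. sgn (h j) * h i"]) (simp add: sgn_if)
    then have PL: "P (LEAST d. P d)" by (rule LeastI)
    define d where "d = (LEAST d. P d)"
    obtain h0 where d: "0 < d" and h0: "h0 \<in> H" "h0 j = int d" using PL by (auto simp: P_def d_def)
    have dvd: "int d dvd h j" if "h \<in> H" for h
    proof (rule ccontr)
      assume "\<not> int d dvd h j"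
      then have r: "h j mod int d \<noteq> 0" by (simp add: dvd_eq_mod_eq_0)
      have "(\<lambda>i. h i - (h j div int d) * h0 i) \<in> H" using Hd[OF that Hk[OF h0(1)]] .
      moreover have "h j - (h j div int d) * h0 j = int (nat (h j mod int d))"
        using d by (simp add: h0 minus_div_mult_eq_mod)
      moreover have "0 < nat (h j mod int d)"
        using r d pos_mod_sign[of "int d" "h j"] by linarith
      ultimately have "P (nat (h j mod int d))"
        unfolding P_def by (intro conjI bexI)
      then have "d \<le> nat (h j mod int d)" unfolding d_def by (rule Least_le)
      then show False using d pos_mod_bound[of "int d" "h j"] by linarith
    qed
    obtain q m0 where q: "q \<in> Q" and m0: "d dvd q * m0" "\<And>m. m \<in> MM \<Longrightarrow> m * m0 \<in> MM"
      using fact[OF d] by blast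
    have m0': "int d dvd int q * int m0" using m0(1) by (metis int_dvd_int_iff of_nat_mult)
    \<comment> \<open>One modulus of the form \<open>m1 * m0\<close> shows that \<open>d\<close>
      divides \<open>q * c j\<close>: it divides both \<open>g j\<close> and
      \<open>q * m0\<close>.\<close>
    obtain m1 where "m1 \<in> MM" using infinite_imp_nonempty[OF inf] by blast
    then obtain g where g: "g \<in> H" "[g j = c j] (mod int (m1 * m0))"
      using c[OF m0(2)] by blast
    then obtain t where t: "c j = g j + int (m1 * m0) * t" using cong_iff_lin by blast
    have "int q * c j = int q * g j + (int q * int m0) * (int m1 * t)"
      unfolding t by (simp add: algebra_simps)
    then have "int d dvd int q * c j" using dvd[OF g(1)] m0' by (simp add: dvd_add)
    then obtain k where k: "int q * c j = int d * k" by blast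
    \<comment> \<open>\<open>h1\<close> has the exact value \<open>q * c j\<close> at
      \<open>j\<close>; after subtracting it, the problem continues among the elements of
      \<open>H\<close> that vanish at \<open>j\<close>.\<close>
    define h1 where "h1 = (\<lambda>i. k * h0 i)"
    have h1: "h1 \<in> H" "h1 j = int q * c j" using Hk[OF h0(1)] by (auto simp: h1_def h0(2) k)
    define H' where "H' = {h \<in> H. h j = 0}"
    define c' where "c' = (\<lambda>i. int q * c i - h1 i)"
    have "\<exists>q'\<in>Q. \<exists>h\<in>H'. \<forall>i\<in>I. h i = int q' * c' i"
    proof (rule insert.IH)
      fix m assume m: "m \<in> MM"
      \<comment> \<open>The larger modulus makes \<open>g' j\<close> divisible by
        \<open>d * m\<close>. The multiple of \<open>h0\<close> that cancels it then has a
        coefficient divisible by \<open>m\<close>, so it does not disturb the other congruences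
        modulo \<open>m\<close>.\<close>
      obtain g where g: "g \<in> H" "\<And>i. i \<in> insert j I \<Longrightarrow> [g i = c i] (mod int (m * m0))"
        using c[OF m0(2)[OF m]] by blast
      define g' where "g' = (\<lambda>i. int q * g i - h1 i)"
      have g': "g' \<in> H" unfolding g'_def by (intro Hd Hk g h1)
      have "[int q * g j = int q * c j] (mod (int q * int (m * m0)))"
        using g(2)[of j] cong_cmult_leftI by blast
      then have "int q * int (m * m0) dvd g' j"
        by (simp add: g'_def h1(2) cong_iff_dvd_diff)
      then have "int d * int m dvd g' j"
        using m0' mult_dvd_mono[OF m0' dvd_refl, of "int m"] dvd_trans by (fastforce simp: mult_ac)
      then obtain k where k: "g' j = int d * int m * k" by blast
      define g2 where "g2 = (\<lambda>i. g' i - (int m * k) * h0 i)"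
      have "g2 \<in> H'" using Hd[OF g' Hk[OF h0(1)]] k by (simp add: H'_def g2_def h0(2))
      moreover have "[g2 i = c' i] (mod int m)" if "i \<in> I" for i
      proof -
        have "[g i = c i] (mod int m)" using g(2)[of i] that cong_dvd_modulus[of _ _ "int (m * m0)" "int m"] by simp
        then have "[int q * g i - h1 i - int m * k * h0 i = int q * c i - h1 i - 0] (mod int m)"
          by (intro cong_diff cong_mult cong_refl) (auto simp: cong_0_iff)
        then show ?thesis by (simp add: g2_def g'_def c'_def)
      qed
      ultimately show "\<exists>h\<in>H'. \<forall>i\<in>I. [h i = c' i] (mod int m)" by blast
    qed (use H in \<open>auto simp: H'_def int_subgroup_def\<close>)
    then obtain q' h' where q': "q' \<in> Q" "h' \<in> H'" "\<And>i. i \<in> I \<Longrightarrow> h' i = int q' * c' i" by blast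
    have "(\<lambda>i. h' i - (- int q') * h1 i) \<in> H"
      using q'(2) by (intro Hd Hk h1) (simp add: H'_def)
    moreover have "\<forall>i\<in>insert j I. h' i - (- int q') * h1 i = int (q' * q) * c i"
      using q' h1(2) by (auto simp: c'_def H'_def algebra_simps)
    ultimately show ?thesis
      using Q(2)[OF q'(1) q] by (intro bexI[of _ "q' * q"] bexI[of _ "\<lambda>i. h' i - (- int q') * h1 i"])
  qed
qed

section \<open>Splitting integers and supernatural numbers by primes\<close>

lemma not_coprime_primeE:
  fixes a b :: nat
  assumes "\<not> coprime a b"
  shows "\<exists>p. prime p \<and> p dvd a \<and> p dvd b"
  using assms by (metis prime_factor_nat coprime_iff_gcd_eq_1 dvd_trans gcd_dvd1 gcd_dvd2)

definition smooth :: "supernatural \<Rightarrow> nat set" where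
  "smooth \<pi> = {q. 0 < q \<and> (\<forall>p. prime p \<longrightarrow> p dvd q \<longrightarrow> p \<in> finite_primes \<pi>)}"

lemma smooth_1: "1 \<in> smooth \<pi>"
  by (auto simp: smooth_def)

lemma smooth_mult: "q \<in> smooth \<pi> \<Longrightarrow> r \<in> smooth \<pi> \<Longrightarrow> q * r \<in> smooth \<pi>"
  by (auto simp: smooth_def prime_dvd_mult_iff)

lemma smooth_pos: "q \<in> smooth \<pi> \<Longrightarrow> 0 < q"
  by (simp add: smooth_def)

text \<open>Separates the part \<open>q\<close> of \<open>n\<close> that may become a denominator
  from the part \<open>m0\<close> that can be multiplied into any divisor of \<pi>, since \<pi> is
  infinite at its primes.\<close>

lemma smooth_factor:
  assumes "0 < n"
  shows "\<exists>q\<in>smooth \<pi>. \<exists>m0. 0 < m0 \<and> n = q * m0 \<and> (\<forall>p. prime p \<longrightarrow> p dvd m0 \<longrightarrow> p \<notin> finite_primes \<pi>)"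
  using assms
proof (induction n rule: prime_divisors_induct)
  case zero then show ?case by simp
next
  case (unit n)
  then show ?case using smooth_1 by (intro bexI[of _ 1] exI[of _ 1]) auto
next
  case (factor p n)
  then obtain q m0 where q: "q \<in> smooth \<pi>" "0 < m0" "n = q * m0" "\<And>p. prime p \<Longrightarrow> p dvd m0 \<Longrightarrow> p \<notin> finite_primes \<pi>"
    by auto
  show ?case
  proof (cases "p \<in> finite_primes \<pi>")
    case True
    have "p' \<in> finite_primes \<pi>" if "prime p'" "p' dvd p" for p'
      using True that factor.hyps primes_dvd_imp_eq[of p' p] by blast
    then have "p \<in> smooth \<pi>" using factor.hyps prime_gt_0_nat[of p] by (simp add: smooth_def)
    then have "p * q \<in> smooth \<pi>" using q(1) by (rule smooth_mult)
    then show ?thesis using q by (intro bexI[of _ "p * q"] exI[of _ m0]) auto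
  next
    case False
    have "p' \<notin> finite_primes \<pi>" if "prime p'" "p' dvd p * m0" for p'
      using False that factor.hyps primes_dvd_imp_eq[of p' p] q(4)
      by (auto simp: prime_dvd_mult_iff)
    then show ?thesis using q(1-3) factor.hyps prime_gt_0_nat[of p]
      by (intro bexI[of _ q] exI[of _ "p * m0"]) auto
  qed
qed

text \<open>If infinitely many moduli remain, elimination gives an exact equation over the integers.
  Otherwise no prime has infinite value, and a factorial serves as \<open>q\<close>, leaving only
  the modulus 1. The conclusion is stated by congruences to cover both cases.\<close>

lemma supernatural_local_global:
  fixes H :: "('i \<Rightarrow> int) set" and c :: "'i \<Rightarrow> int"
  assumes q0: "q0 \<in> smooth \<pi>" and I: "finite I"
    and H: "int_subgroup H"
    and c: "\<And>m. nat_dvd_supernatural \<pi> m \<Longrightarrow> coprime m q0 \<Longrightarrow> \<exists>h\<in>H. \<forall>i\<in>I. [h i = c i] (mod int m)"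
  shows "\<exists>q\<in>smooth \<pi>. \<exists>h\<in>H. \<forall>m. nat_dvd_supernatural \<pi> m \<longrightarrow> coprime m (q0 * q) \<longrightarrow>
    (\<forall>i\<in>I. [h i = int q * c i] (mod int m))"
proof -
  define MM where "MM = {m. nat_dvd_supernatural \<pi> m \<and> coprime m q0}"
  \<comment> \<open>The primes of \<open>m0\<close> have infinite value, so they cannot occur in
    \<open>q0\<close>, and \<pi> bounds no multiplicity at them.\<close>
  have mult: "m * m0 \<in> MM" if m: "m \<in> MM"
    and m0: "0 < m0" "\<And>p. prime p \<Longrightarrow> p dvd m0 \<Longrightarrow> p \<notin> finite_primes \<pi>" for m m0
  proof -
    have "coprime m0 q0"
    proof (rule ccontr)
      assume "\<not> coprime m0 q0"
      then obtain p where "prime p" "p dvd m0" "p dvd q0"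
        using not_coprime_primeE by blast
      then show False using m0 q0 by (auto simp: smooth_def)
    qed
    moreover have "enat (multiplicity p (m * m0)) \<le> \<pi> p" if p: "prime p" for p
    proof (cases "p dvd m0")
      case True
      then show ?thesis using m0(2)[OF p] p by (auto simp: finite_primes_def)
    next
      case False
      have "multiplicity p (m * m0) = multiplicity p m"
        using m m0(1) p False
        by (auto simp: prime_elem_multiplicity_mult_distrib MM_def nat_dvd_supernatural_iff not_dvd_imp_multiplicity_0)
      then show ?thesis using m p by (simp add: MM_def nat_dvd_supernatural_iff)
    qed
    ultimately show ?thesis using m m0(1) by (simp add: MM_def nat_dvd_supernatural_iff)
  qed
  show ?thesis
  proof (cases "infinite MM")
    case True
    have "\<exists>q\<in>smooth \<pi>. \<exists>h\<in>H. \<forall>i\<in>I. h i = int q * c i"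
    proof (rule subgroup_local_global[OF smooth_1 smooth_mult _ True I H])
      fix n :: nat assume "0 < n"
      then show "\<exists>q\<in>smooth \<pi>. \<exists>m0. n dvd q * m0 \<and> (\<forall>m\<in>MM. m * m0 \<in> MM)"
        using smooth_factor[of n \<pi>] mult by (metis dvd_refl)
    next
      fix m assume "m \<in> MM"
      then show "\<exists>h\<in>H. \<forall>i\<in>I. [h i = c i] (mod int m)" using c by (simp add: MM_def)
    qed
    then show ?thesis by force
  next
    case False
    then have fin: "finite MM" by simp
    have 1: "1 \<in> MM" using nat_dvd_supernatural_1 by (simp add: MM_def)
    obtain K where K: "\<And>m. m \<in> MM \<Longrightarrow> m \<le> K"
      using fin unfolding finite_nat_set_iff_bounded_le by metis
    have prm: "p \<in> finite_primes \<pi>" if p: "prime p" for p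
    proof (rule ccontr)
      assume np: "p \<notin> finite_primes \<pi>"
      have "p' \<notin> finite_primes \<pi>" if "prime p'" "p' dvd p ^ K" for p'
        using that np p primes_dvd_imp_eq[of p' p] prime_dvd_power[of p' p K] by blast
      \<comment> \<open>A prime of infinite value would put all its powers into the set bounded by
        \<open>K\<close>; the power \<open>p ^ K\<close> already exceeds \<open>K\<close>.\<close>
      then have "p ^ K \<in> MM"
        using mult[OF 1, of "p ^ K"] prime_gt_0_nat[OF p] by simp
      then have "p ^ K \<le> K" by (rule K)
      then show False using power_gt_expt[OF prime_gt_Suc_0_nat[OF p], of K] by simp
    qed
    \<comment> \<open>Every remaining modulus is at most \<open>K\<close>, hence divides this
      factorial, and can be coprime to it only if it is 1.\<close>
    have "fact K \<in> smooth \<pi>" by (simp add: smooth_def prm)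
    moreover have "m = 1" if m: "nat_dvd_supernatural \<pi> m" "coprime m (q0 * fact K)" for m
    proof -
      have "m \<in> MM" using m by (simp add: MM_def)
      then have "m dvd fact K" using m(1) K by (intro dvd_fact) (auto simp: nat_dvd_supernatural_iff Suc_le_eq)
      then show ?thesis using m(2) by (metis coprime_absorb_left coprime_mult_right_iff is_unit_gcd nat_dvd_1_iff_1)
    qed
    moreover have "[0 = x] (mod int m)" if "m = 1" for m and x :: int using that by simp
    ultimately show ?thesis using int_subgroup_zero[OF H] by metis
  qed
qed

text \<open>\<open>N\<close> is the part of \<pi> supported on the primes of \<open>q\<close>, an
  integer because \<pi> is finite at these primes. For a divisor \<open>m\<close> of \<pi>, the
  factor \<open>m1\<close> is \<open>gcd m N\<close>.\<close>

lemma supernatural_split: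
  assumes q: "q \<in> smooth \<pi>"
  shows "\<exists>N n. nat_dvd_supernatural \<pi> N \<and> N dvd q ^ n \<and>
    (\<forall>m. nat_dvd_supernatural \<pi> m \<longrightarrow> (\<exists>m1 m2. m = m1 * m2 \<and> m1 dvd N \<and> coprime m2 q \<and> coprime m1 m2))"
proof -
  define e where "e p = the_enat (\<pi> p)" for p
  have e: "enat (e p) = \<pi> p" if "p \<in> prime_factors q" for p
    using that q by (auto simp: e_def smooth_def finite_primes_def in_prime_factors_iff)
  define N where "N = (\<Prod>p\<in>prime_factors q. p ^ e p)"
  have N0: "0 < N" by (auto simp: N_def in_prime_factors_iff prime_gt_0_nat intro!: prod_pos)
  have mN: "multiplicity p N = (if p \<in> prime_factors q then e p else 0)" if "prime p" for p
    unfolding N_def using that by (intro multiplicity_prod_prime_powers) (auto simp: in_prime_factors_iff)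
  have N: "nat_dvd_supernatural \<pi> N"
    using N0 e by (auto simp: nat_dvd_supernatural_iff mN zero_enat_def[symmetric])
  have "N dvd q ^ (\<Sum>p\<in>prime_factors q. e p)"
    unfolding N_def power_sum by (intro prod_dvd_prod dvd_power_same) (auto simp: in_prime_factors_iff)
  moreover have "\<exists>m1 m2. m = m1 * m2 \<and> m1 dvd N \<and> coprime m2 q \<and> coprime m1 m2"
    if m: "nat_dvd_supernatural \<pi> m" for m
  proof -
    have m0: "0 < m" using m by (simp add: nat_dvd_supernatural_iff)
    obtain m2 where m2: "m = gcd m N * m2" by (metis dvdE gcd_dvd1)
    have m20: "m2 \<noteq> 0" using m2 m0 by (metis mult_0_right less_irrefl)
    have cop: "coprime m2 q"
    proof (rule ccontr)
      assume "\<not> coprime m2 q"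
      then obtain p where p: "prime p" "p dvd m2" "p dvd q"
        using not_coprime_primeE by blast
      \<comment> \<open>At a prime of \<open>q\<close> the factor \<open>gcd m N\<close> already
        contains the full power of \<open>p\<close> in \<open>m\<close>, so nothing is left for
        \<open>m2\<close>.\<close>
      have pq: "p \<in> prime_factors q" using p smooth_pos[OF q] by (simp add: in_prime_factors_iff)
      have "multiplicity p m \<le> e p"
        using m p(1) e[OF pq] by (metis nat_dvd_supernatural_iff enat_ord_simps(1))
      then have "multiplicity p (gcd m N) = multiplicity p m"
        using m0 N0 p pq by (simp add: multiplicity_gcd mN)
      moreover have "multiplicity p m = multiplicity p (gcd m N) + multiplicity p m2"
        using m20 m0 p(1) by (subst m2, subst prime_elem_multiplicity_mult_distrib) auto
      moreover note m20
      then have "multiplicity p m2 \<noteq> 0"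
        using p by (simp add: prime_elem_multiplicity_eq_zero_iff prime_imp_prime_elem)
      ultimately show False by simp
    qed
    moreover have "coprime (gcd m N) m2"
    proof (rule ccontr)
      assume "\<not> coprime (gcd m N) m2"
      then obtain p where p: "prime p" "p dvd gcd m N" "p dvd m2"
        using not_coprime_primeE by blast
      then have "p dvd N" by auto
      then have "p dvd q"
        using \<open>N dvd q ^ _\<close> p(1) by (meson dvd_trans prime_dvd_power)
      then show False using cop p by (meson coprime_common_divisor not_prime_unit)
    qed
    ultimately show ?thesis using m2 by blast
  qed
  ultimately show ?thesis using N by blast
qed

section \<open>Unary implicit operations\<close>

lemma spow_Suc: "0 < n \<Longrightarrow> spow S x (Suc n) = smult S x (spow S x n)"
  by (cases n) (auto simp: spow_def)

lemma spow_1: "spow S x (Suc 0) = x"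
  by (simp add: spow_def)

lemma spow_0: "spow S x 0 = x"
  by (simp add: spow_def)

text \<open>Starts from both 0 and 1: truncated subtraction gives \<open>spow S x 0 = x\<close>, and
  the recursion \<open>spow_Suc\<close> holds only from positive exponents on.\<close>

lemma spow_induct [case_names 0 1 Suc]:
  assumes "P 0" "P (Suc 0)" "\<And>n. 0 < n \<Longrightarrow> P n \<Longrightarrow> P (Suc n)"
  shows "P (n::nat)"
proof (induction n)
  case (Suc n)
  then show ?case using assms by (cases n) auto
qed (rule assms(1))

lemma spow_closed: "is_sgrp S \<Longrightarrow> x \<in> carrier S \<Longrightarrow> spow S x n \<in> carrier S"
  by (induction n rule: spow_induct) (auto simp: spow_0 spow_1 spow_Suc is_sgrp_closed)

lemma spow_free_pro:
  "(S, \<phi>) \<in> gen_sgrps V A \<Longrightarrow> spow (free_pro V A) x n (S, \<phi>) = spow S (x (S, \<phi>)) n"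
  by (induction n rule: spow_induct) (auto simp: spow_0 spow_1 spow_Suc free_pro_smult)

lemma spow_cyc: "0 < n \<Longrightarrow> x < m \<Longrightarrow> spow (cyc m) x n = (n * x) mod m"
  by (induction n rule: spow_induct) (auto simp: spow_1 spow_Suc mod_simps)

lemma spow_eval_word:
  assumes "is_sgrp S" "\<phi> \<in> A \<rightarrow> carrier S" "w \<in> lists A" "w \<noteq> []" "0 < n"
  shows "spow S (eval_word S \<phi> w) n = eval_word S \<phi> (concat (replicate n w))"
  using \<open>0 < n\<close>
proof (induction n rule: spow_induct)
  case (Suc n)
  have "concat (replicate n w) \<in> lists A" "concat (replicate n w) \<noteq> []"
    using assms(3,4) Suc(1) by (auto simp: lists_eq_set)
  then show ?case using Suc assms by (simp add: spow_Suc eval_word_append[OF assms(1,2)])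
qed (simp_all add: spow_1)

section \<open>Convergence along profinite exponent sequences\<close>

lemma eventually_periodic:
  fixes f :: "nat \<Rightarrow> 'x"
  assumes "finite (range f)" "\<And>n. i1 \<le> n \<Longrightarrow> f (Suc n) = g (f n)"
  shows "\<exists>i0 d. 0 < d \<and> (\<forall>i\<ge>i0. f (i + d) = f i)"
proof -
  have "\<not> inj_on f {i1..}"
    using assms(1) finite_subset[of "f ` {i1..}" "range f"] infinite_Ici finite_image_iff by blast
  then obtain i j where ij: "i < j" "f i = f j" "i1 \<le> i"
    by (auto simp: inj_on_def) (metis linorder_neqE_nat)
  have "f (k + (j - i)) = f k" if "i \<le> k" for k
    using that
  proof (induction k rule: dec_induct)
    case base
    then show ?case using ij by simp
  next
    case (step n)
    then show ?case using assms(2)[of n] assms(2)[of "n + (j - i)"] ij by simp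
  qed
  then show ?thesis using ij by (intro exI[of _ i] exI[of _ "j - i"]) auto
qed

lemma periodic_eq:
  fixes f :: "nat \<Rightarrow> 'x"
  assumes per: "\<And>i. i0 \<le> i \<Longrightarrow> f (i + d) = f i" and "i0 \<le> i" "i0 \<le> j" "i mod d = j mod d"
  shows "f i = f j"
proof -
  have *: "f i = f j" if ij: "i0 \<le> i" "i \<le> j" "i mod d = j mod d" for i j
  proof -
    obtain t where t: "j = i + t * d" using ij(2,3)
      by (metis mod_eq_nat2E mult.commute)
    have "f (i + t * d) = f i" for t
    proof (induction t)
      case (Suc t)
      then show ?case using per[of "i + t * d"] ij(1) by (simp add: algebra_simps)
    qed simp
    then show ?thesis using t by simp
  qed
  show ?thesis using *[of i j] *[of j i] assms by (metis nle_le)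
qed

text \<open>Exponent sequences that converge in the profinite completion of the additive semigroup
  of positive integers, and not to a finite exponent.\<close>

definition profinite_seq :: "(nat \<Rightarrow> nat) \<Rightarrow> bool" where
  "profinite_seq e \<longleftrightarrow> filterlim e at_top sequentially \<and>
    (\<forall>d>0. \<exists>c. \<forall>\<^sub>F k in sequentially. e k mod d = c)"

text \<open>An orbit in a finite set is eventually periodic; its period is the modulus at which the
  residue of \<open>e k\<close> has to stabilise, once \<open>e k\<close> has passed the
  preperiod.\<close>

lemma profinite_seq_eventually_const:
  fixes f :: "nat \<Rightarrow> 'x"
  assumes e: "profinite_seq e" and f: "finite (range f)" "\<And>n. i1 \<le> n \<Longrightarrow> f (Suc n) = g (f n)"
  shows "\<exists>c. \<forall>\<^sub>F k in sequentially. f (e k) = c"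
proof -
  obtain i0 d where d: "0 < d" "\<And>i. i0 \<le> i \<Longrightarrow> f (i + d) = f i"
    using eventually_periodic[of f i1 g, OF f] by auto
  obtain c where "\<forall>\<^sub>F k in sequentially. e k mod d = c" using e d by (auto simp: profinite_seq_def)
  moreover have "\<forall>\<^sub>F k in sequentially. i0 \<le> e k"
    using e by (simp add: profinite_seq_def filterlim_at_top)
  ultimately have "\<forall>\<^sub>F k in sequentially. e k mod d = c \<and> i0 \<le> e k" by (rule eventually_conj)
  then obtain K where K: "\<And>k. K \<le> k \<Longrightarrow> e k mod d = c \<and> i0 \<le> e k"
    by (auto simp: eventually_sequentially)
  have "f (e k) = f (e K)" if "K \<le> k" for k
    by (rule periodic_eq[where f = f and d = d and ?i0.0 = i0]) (use d(2) K[OF that] K[of K] in auto)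
  then show ?thesis by (auto simp: eventually_sequentially)
qed

lemma fact_minus_1_mod:
  assumes "0 < d" "d \<le> k" shows "(fact k - 1) mod d = d - (1::nat)"
proof -
  obtain j where j: "fact k = d * j" using dvd_fact[of d k] assms by (auto simp: Suc_le_eq)
  then have "0 < j" using fact_gt_zero[of k, where 'a = nat] by (cases j) auto
  then have "fact k - 1 = (d - 1) + d * (j - 1)" using assms j by (cases j) (auto simp: algebra_simps)
  then show ?thesis using assms by (simp only: mod_mult_self2) simp
qed

lemma fact_minus_1_at_top: "filterlim (\<lambda>k. fact k - 1 :: nat) at_top sequentially"
proof (rule filterlim_at_top_mono[of "\<lambda>k. k - 1"])
  show "filterlim (\<lambda>k. k - 1 :: nat) at_top sequentially"
    by (rule filterlim_minus_const_nat_at_top)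
  show "\<forall>\<^sub>F k in sequentially. k - 1 \<le> fact k - (1::nat)"
    by (simp add: fact_ge_self diff_le_mono)
qed

lemma profinite_seq_fact: "profinite_seq (\<lambda>k. fact k - 1)"
proof -
  have "\<forall>\<^sub>F k in sequentially. (fact k - 1) mod d = d - (1::nat)" if "0 < d" for d
    using fact_minus_1_mod[OF that] by (auto simp: eventually_sequentially)
  then show ?thesis using fact_minus_1_at_top unfolding profinite_seq_def by blast
qed

text \<open>The powers of \<open>p\<close> modulo \<open>d\<close> form an orbit in a finite set, so
  they stabilise along the exponents \<open>k! - 1\<close>, which are already known to be a
  profinite sequence.\<close>

lemma profinite_seq_prime:
  assumes "prime p" shows "profinite_seq (\<lambda>k. p ^ (fact k - 1))"
  unfolding profinite_seq_def
proof (intro conjI allI impI)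
  have p: "1 < p" using assms prime_gt_1_nat by blast
  show "filterlim (\<lambda>k. p ^ (fact k - 1)) at_top sequentially"
    by (rule filterlim_at_top_mono[OF fact_minus_1_at_top])
      (use p in \<open>auto intro!: always_eventually less_imp_le power_gt_expt\<close>)
  fix d :: nat assume "0 < d"
  then have "range (\<lambda>n. p ^ n mod d) \<subseteq> {..<d}"
    by (intro image_subsetI) simp
  then have "finite (range (\<lambda>n. p ^ n mod d))"
    by (rule finite_subset) simp
  then show "\<exists>c. \<forall>\<^sub>F k in sequentially. p ^ (fact k - 1) mod d = c"
    by (rule profinite_seq_eventually_const[OF profinite_seq_fact, where f = "\<lambda>n. p ^ n mod d"
          and g = "\<lambda>x. p * x mod d" and ?i1.0 = 0])
      (simp add: mod_simps)
qed

lemma profinite_seq_sigma: "e \<in> sigma \<pi> \<Longrightarrow> profinite_seq e"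
  using profinite_seq_fact profinite_seq_prime by (auto simp: sigma_def finite_primes_def)

lemma profinite_seq_pos: "profinite_seq e \<Longrightarrow> \<forall>\<^sub>F k in sequentially. n \<le> e k"
  by (simp add: profinite_seq_def filterlim_at_top)

text \<open>The subalgebra is closed under limits that exist; this supplies them. Every coordinate
  stabilises, and any two coordinates of the limit are those of one late power, which gives
  compatibility.\<close>

lemma spow_limit_exists:
  assumes e: "profinite_seq e" and x: "x \<in> carrier (free_pro fin_sgrps A)"
  shows "\<exists>y. limitin (free_pro_topology fin_sgrps A) (\<lambda>k. spow (free_pro fin_sgrps A) x (e k)) y sequentially"
proof -
  let ?f = "\<lambda>k. spow (free_pro fin_sgrps A) x (e k)"
  have f: "?f k \<in> carrier (free_pro fin_sgrps A)" for k
    using spow_closed[OF free_pro_is_sgrp[OF order.refl] x] .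
  have "\<exists>c. \<forall>\<^sub>F k in sequentially. ?f k i = c" if i: "i \<in> gen_sgrps fin_sgrps A" for i
  proof -
    obtain S \<phi> where [simp]: "i = (S, \<phi>)" by (cases i)
    have S: "is_sgrp S" "finite (carrier S)" using gen_sgrps_carrier[OF order.refl] i by auto
    have xS: "x (S, \<phi>) \<in> carrier S" using free_pro_in_carrier[OF order.refl x] i by simp
    have "finite (range (spow S (x (S, \<phi>))))"
      using spow_closed[OF S(1) xS] by (intro finite_subset[OF _ S(2)]) auto
    from profinite_seq_eventually_const[OF e this, of 1 "smult S (x (S, \<phi>))"]
    show ?thesis using i by (simp add: spow_Suc spow_free_pro)
  qed
  then obtain y where y: "\<And>i. i \<in> gen_sgrps fin_sgrps A \<Longrightarrow> \<forall>\<^sub>F k in sequentially. ?f k i = y i"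
    by metis
  let ?y = "restrict y (gen_sgrps fin_sgrps A)"
  have "?y \<in> carrier (free_pro fin_sgrps A)"
    unfolding free_pro_carrier_iff
  proof (intro conjI allI impI)
    fix S \<phi> assume S: "(S, \<phi>) \<in> gen_sgrps fin_sgrps A"
    obtain k where "?f k (S, \<phi>) = y (S, \<phi>)"
      using eventually_happens[OF y[OF S]] by auto
    then show "?y (S, \<phi>) \<in> generated S (\<phi> ` A)"
      using free_pro_generated[OF f S, of k] S by simp
    fix T \<theta> h assume T: "(T, \<theta>) \<in> gen_sgrps fin_sgrps A" "h \<in> sgrp_hom S T" "\<forall>a\<in>A. h (\<phi> a) = \<theta> a"
    obtain k where "?f k (S, \<phi>) = y (S, \<phi>)" "?f k (T, \<theta>) = y (T, \<theta>)"
      using eventually_happens[OF eventually_conj[OF y[OF S] y[OF T(1)]]] by auto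
    then show "h (?y (S, \<phi>)) = ?y (T, \<theta>)"
      using free_pro_compatible[OF f S T(1,2), of k] T S by simp
  qed simp
  then show ?thesis
    using y by (intro exI[of _ ?y]) (simp add: limitin_free_pro_iff[OF order.refl f])
qed

lemma spow_limit_iff:
  assumes x: "x \<in> carrier (free_pro fin_sgrps A)"
  shows "limitin (free_pro_topology fin_sgrps A) (\<lambda>k. spow (free_pro fin_sgrps A) x (e k)) y sequentially \<longleftrightarrow>
    y \<in> carrier (free_pro fin_sgrps A) \<and>
    (\<forall>S \<phi>. (S, \<phi>) \<in> gen_sgrps fin_sgrps A \<longrightarrow> (\<forall>\<^sub>F k in sequentially. y (S, \<phi>) = spow S (x (S, \<phi>)) (e k)))"
proof -
  have "spow (free_pro fin_sgrps A) x (e k) \<in> carrier (free_pro fin_sgrps A)" for k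
    using spow_closed[OF free_pro_is_sgrp[OF order.refl] x] .
  from limitin_free_pro_iff[OF order.refl this] show ?thesis
    by (simp add: spow_free_pro eq_commute Ball_def)
qed

lemma val_spow_limit:
  assumes x: "x \<in> carrier (free_pro fin_sgrps A)" and e: "profinite_seq e" and m: "0 < m"
    and y: "limitin (free_pro_topology fin_sgrps A) (\<lambda>k. spow (free_pro fin_sgrps A) x (e k)) y sequentially"
  shows "\<forall>\<^sub>F k in sequentially. val A m a y = (e k * val A m a x) mod m"
proof -
  have "\<forall>\<^sub>F k in sequentially. y (cyc_gen A m a) = spow (cyc m) (val A m a x) (e k)"
    using y cyc_gen_fin[OF m, of A a] unfolding spow_limit_iff[OF x] val_def cyc_gen_def by blast
  moreover have "\<forall>\<^sub>F k in sequentially. 1 \<le> e k" using e by (rule profinite_seq_pos)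
  ultimately show ?thesis
    by eventually_elim (use val_less[OF m x] in \<open>simp add: val_def[of _ _ _ y] spow_cyc\<close>)
qed

section \<open>Linear arithmetic on exponents inside sets closed under the signature\<close>

definition sig_closed :: "signature \<Rightarrow> 'a set \<Rightarrow> 'a pro set \<Rightarrow> bool" where
  "sig_closed \<sigma> A C \<longleftrightarrow> C \<subseteq> carrier (free_pro fin_sgrps A) \<and>
    (\<forall>x\<in>C. \<forall>y\<in>C. smult (free_pro fin_sgrps A) x y \<in> C) \<and>
    (\<forall>e\<in>\<sigma>. \<forall>x\<in>C. \<forall>y. limitin (free_pro_topology fin_sgrps A)
       (\<lambda>k. spow (free_pro fin_sgrps A) x (e k)) y sequentially \<longrightarrow> y \<in> C)"

lemma sig_subalgebra_carrier:
  "t \<in> sig_subalgebra \<sigma> fin_sgrps A \<Longrightarrow> t \<in> carrier (free_pro fin_sgrps A)"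
proof (induction rule: sig_subalgebra.induct)
  case (unary e x y)
  then show ?case using limitin_topspace[OF unary.hyps(3)] by (simp add: topspace_free_pro)
qed (auto simp: gen_carrier is_sgrp_closed free_pro_is_sgrp)

lemma Cl_carrier: "Some t \<in> Cl A L \<Longrightarrow> t \<in> carrier (free_pro fin_sgrps A)"
  by (auto simp: Cl_def in_closure_of topspace_adjoin_point topspace_free_pro)

lemma Cl_mono: "K \<subseteq> L \<Longrightarrow> Cl A K \<subseteq> Cl A L"
  unfolding Cl_def by (intro closure_of_mono image_mono)

lemma Cl_word:
  assumes "L \<subseteq> lists A" "Some t \<in> Cl A L" "finite F" "F \<subseteq> gen_sgrps fin_sgrps A"
  shows "\<exists>w\<in>L. w \<noteq> [] \<and> (\<forall>S \<phi>. (S, \<phi>) \<in> F \<longrightarrow> t (S, \<phi>) = eval_word S \<phi> w)"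
  using assms(2,3,4) unfolding Some_in_Cl_iff[OF assms(1)] by (elim conjE allE[of _ F]) simp

lemma Cl_mult:
  assumes K: "K \<subseteq> lists A" and L: "L \<subseteq> lists A" and s: "Some s \<in> Cl A K" and t: "Some t \<in> Cl A L"
  shows "Some (smult (free_pro fin_sgrps A) s t) \<in> Cl A {u @ v | u v. u \<in> K \<and> v \<in> L}"
proof -
  have KL: "{u @ v | u v. u \<in> K \<and> v \<in> L} \<subseteq> lists A" using K L by (auto simp: lists_eq_set) blast+
  show ?thesis
    unfolding Some_in_Cl_iff[OF KL]
  proof (intro conjI allI impI)
    show "smult (free_pro fin_sgrps A) s t \<in> carrier (free_pro fin_sgrps A)"
      using Cl_carrier[OF s] Cl_carrier[OF t] by (simp add: is_sgrp_closed free_pro_is_sgrp)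
    fix F assume F: "finite F" "F \<subseteq> gen_sgrps fin_sgrps A"
    obtain u where u: "u \<in> K" "u \<noteq> []" "\<And>S \<phi>. (S, \<phi>) \<in> F \<Longrightarrow> s (S, \<phi>) = eval_word S \<phi> u"
      using Cl_word[OF K s F] by blast
    obtain v where v: "v \<in> L" "v \<noteq> []" "\<And>S \<phi>. (S, \<phi>) \<in> F \<Longrightarrow> t (S, \<phi>) = eval_word S \<phi> v"
      using Cl_word[OF L t F] by blast
    have "smult (free_pro fin_sgrps A) s t (S, \<phi>) = eval_word S \<phi> (u @ v)" if S: "(S, \<phi>) \<in> F" for S \<phi>
    proof -
      have "is_sgrp S" "\<phi> \<in> A \<rightarrow> carrier S" using gen_sgrps_carrier[OF order.refl subsetD[OF F(2) S]] by auto
      moreover have "u \<in> lists A" "v \<in> lists A" using u(1) v(1) K L by auto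
      ultimately show ?thesis
        using u v S subsetD[OF F(2) S] by (simp add: eval_word_append[of S \<phi> A] free_pro_smult)
    qed
    with u v show "\<exists>w\<in>{u @ v | u v. u \<in> K \<and> v \<in> L}. w \<noteq> [] \<and>
      (\<forall>S \<phi>. (S, \<phi>) \<in> F \<longrightarrow> smult (free_pro fin_sgrps A) s t (S, \<phi>) = eval_word S \<phi> w)"
      by (intro bexI[of _ "u @ v"]) auto
  qed
qed

text \<open>A star language contains the powers of its words: a word right for \<open>x\<close> on
  finitely many coordinates, raised to a late exponent of the sequence, is right for the limit on
  them.\<close>

lemma sig_closed_star:
  assumes K: "K \<subseteq> lists A" and \<sigma>: "\<And>e. e \<in> \<sigma> \<Longrightarrow> profinite_seq e"
  shows "sig_closed \<sigma> A {t \<in> sig_subalgebra \<sigma> fin_sgrps A. Some t \<in> Cl A (concat ` lists K)}"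
proof -
  let ?L = "concat ` lists K"
  have L: "?L \<subseteq> lists A" using K by (auto simp: lists_eq_set subset_iff) blast
  have LL: "{u @ v | u v. u \<in> ?L \<and> v \<in> ?L} \<subseteq> ?L"
  proof
    fix w assume "w \<in> {u @ v | u v. u \<in> ?L \<and> v \<in> ?L}"
    then obtain us vs where "us \<in> lists K" "vs \<in> lists K" "w = concat us @ concat vs" by blast
    then show "w \<in> ?L" by (intro image_eqI[of _ _ "us @ vs"]) auto
  qed
  have "Some y \<in> Cl A ?L"
    if e: "e \<in> \<sigma>" and x: "Some x \<in> Cl A ?L"
      and y: "limitin (free_pro_topology fin_sgrps A) (\<lambda>k. spow (free_pro fin_sgrps A) x (e k)) y sequentially"
    for e x y
    unfolding Some_in_Cl_iff[OF L]
  proof (intro conjI allI impI)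
    note y = y[unfolded spow_limit_iff[OF Cl_carrier[OF x]]]
    show "y \<in> carrier (free_pro fin_sgrps A)" using y by blast
    fix F assume F: "finite F" "F \<subseteq> gen_sgrps fin_sgrps A"
    have "\<forall>\<^sub>F k in sequentially. \<forall>i\<in>F. y i = spow (fst i) (x i) (e k)"
      using F y by (intro eventually_ball_finite) auto
    \<comment> \<open>Positivity matters: at exponent 0 \<open>spow\<close> returns
      \<open>x\<close>, whereas the corresponding power of a word is empty.\<close>
    then have "\<forall>\<^sub>F k in sequentially. (\<forall>i\<in>F. y i = spow (fst i) (x i) (e k)) \<and> 1 \<le> e k"
      using profinite_seq_pos[OF \<sigma>[OF e], of 1] by (rule eventually_conj)
    then have "\<exists>k. (\<forall>i\<in>F. y i = spow (fst i) (x i) (e k)) \<and> 1 \<le> e k"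
      by (rule eventually_happens'[OF sequentially_bot])
    then obtain k where k: "\<forall>i\<in>F. y i = spow (fst i) (x i) (e k)" "1 \<le> e k"
      by (elim exE conjE) (rule that)
    obtain w where w: "w \<in> ?L" "w \<noteq> []" "\<And>S \<phi>. (S, \<phi>) \<in> F \<Longrightarrow> x (S, \<phi>) = eval_word S \<phi> w"
      using Cl_word[OF L x F] by blast
    obtain ws where ws: "ws \<in> lists K" "w = concat ws" using w(1) by auto
    have "concat (concat (replicate n ws)) = concat (replicate n w)" for n
      by (induction n) (auto simp: ws)
    moreover have "concat (replicate (e k) ws) \<in> lists K" using ws(1) by (auto simp: lists_eq_set)
    ultimately have "concat (replicate (e k) w) \<in> ?L" by (metis imageI)
    moreover have "concat (replicate (e k) w) \<noteq> []" using w(2) k(2) by (cases "e k") auto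
    moreover have "y (S, \<phi>) = eval_word S \<phi> (concat (replicate (e k) w))" if S: "(S, \<phi>) \<in> F" for S \<phi>
    proof -
      have "is_sgrp S" "\<phi> \<in> A \<rightarrow> carrier S" using gen_sgrps_carrier[OF order.refl subsetD[OF F(2) S]] by auto
      moreover have "w \<in> lists A" using w(1) L by auto
      ultimately show ?thesis
        using bspec[OF k(1) S] w(3)[OF S] spow_eval_word[of S \<phi> A w "e k"] w(2) k(2) by simp
    qed
    ultimately show "\<exists>w\<in>?L. w \<noteq> [] \<and> (\<forall>S \<phi>. (S, \<phi>) \<in> F \<longrightarrow> y (S, \<phi>) = eval_word S \<phi> w)"
      by blast
  qed
  moreover have "Some (smult (free_pro fin_sgrps A) s t) \<in> Cl A ?L"
    if "Some s \<in> Cl A ?L" "Some t \<in> Cl A ?L" for s t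
    using Cl_mult[OF L L that] Cl_mono[OF LL] by blast
  ultimately show ?thesis
    unfolding sig_closed_def
    by (auto simp: sig_subalgebra_carrier sig_subalgebra.mult intro: sig_subalgebra.unary)
qed

text \<open>From \<open>k = m\<close> on the modulus divides \<open>k!\<close>, so the exponent
  \<open>k! - 1\<close> acts as -1.\<close>

lemma eventually_fact_neg:
  fixes y v m :: nat
  assumes "\<forall>\<^sub>F k in sequentially. y = ((fact k - 1) * v) mod m" and m: "0 < m"
  shows "[int y = - int v] (mod int m)"
proof -
  have "\<forall>\<^sub>F k in sequentially. y = ((fact k - 1) * v) mod m \<and> m \<le> k"
    using assms(1) eventually_ge_at_top by (rule eventually_conj)
  then obtain k where k: "y = ((fact k - 1) * v) mod m" "m \<le> k"
    using eventually_happens[of _ sequentially] by auto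
  have "int m dvd int (fact k)" using m k(2) by (simp only: int_dvd_int_iff dvd_fact Suc_le_eq)
  moreover have "int (fact k - 1) = int (fact k) - 1" by (simp add: of_nat_diff)
  ultimately have f: "[int (fact k - 1) = -1] (mod int m)" by (simp add: cong_iff_dvd_diff)
  have "[int y = int (fact k - 1) * int v] (mod int m)"
    unfolding k(1) by (simp add: cong_def zmod_int)
  also have "[int (fact k - 1) * int v = (-1) * int v] (mod int m)"
    using f cong_refl by (rule cong_mult)
  finally show ?thesis by simp
qed

text \<open>From \<open>k = m\<close> on, \<open>totient m\<close> divides \<open>k!\<close>, and
  Euler's theorem makes \<open>p ^ (k! - 1)\<close> an inverse of \<open>p\<close> modulo
  \<open>m\<close>.\<close>

lemma eventually_prime_inverse:
  fixes p y v m :: nat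
  assumes "\<forall>\<^sub>F k in sequentially. y = (p ^ (fact k - 1) * v) mod m" and m: "0 < m" and c: "coprime p m"
  shows "[p * y = v] (mod m)"
proof -
  have "\<forall>\<^sub>F k in sequentially. y = (p ^ (fact k - 1) * v) mod m \<and> m \<le> k"
    using assms(1) eventually_ge_at_top by (rule eventually_conj)
  then obtain k where k: "y = (p ^ (fact k - 1) * v) mod m" "m \<le> k"
    using eventually_happens[of _ sequentially] by auto
  have "totient m dvd fact k"
    using m k(2) totient_le[of m] by (intro dvd_fact) (auto simp: Suc_le_eq)
  then obtain j where j: "fact k = totient m * j" by blast
  have "[p ^ fact k = 1] (mod m)"
    using cong_pow[OF euler_theorem[OF c], of j] by (simp add: j power_mult)
  moreover have "p ^ fact k = p * p ^ (fact k - 1)"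
    using fact_gt_zero[of k, where 'a = nat] by (cases "fact k :: nat") auto
  ultimately have f: "[p * p ^ (fact k - 1) = 1] (mod m)" by simp
  have "[p * y = (p * p ^ (fact k - 1)) * v] (mod m)"
    unfolding k(1) mult.assoc by (intro cong_mult cong_refl) simp
  also have "[(p * p ^ (fact k - 1)) * v = 1 * v] (mod m)"
    using f cong_refl by (rule cong_mult)
  finally show ?thesis by simp
qed

lemma val_smult_cong:
  assumes "0 < m"
  shows "[int (val A m a (smult (free_pro fin_sgrps A) x y)) = int (val A m a x) + int (val A m a y)] (mod int m)"
  using assms by (simp add: val_smult cong_def zmod_int)

context
  fixes \<pi> :: supernatural and A :: "'a set" and C :: "'a pro set"
  assumes C: "sig_closed (sigma \<pi>) A C"
begin

lemma sig_closed_carrier: "x \<in> C \<Longrightarrow> x \<in> carrier (free_pro fin_sgrps A)"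
  using C by (auto simp: sig_closed_def)

lemma sig_closed_smult: "x \<in> C \<Longrightarrow> y \<in> C \<Longrightarrow> smult (free_pro fin_sgrps A) x y \<in> C"
  using C by (auto simp: sig_closed_def)

lemma sig_closed_unary:
  assumes e: "e \<in> sigma \<pi>" and x: "x \<in> C"
  shows "\<exists>y\<in>C. \<forall>m a. 0 < m \<longrightarrow> (\<forall>\<^sub>F k in sequentially. val A m a y = (e k * val A m a x) mod m)"
proof -
  obtain y where y: "limitin (free_pro_topology fin_sgrps A) (\<lambda>k. spow (free_pro fin_sgrps A) x (e k)) y sequentially"
    using spow_limit_exists[OF profinite_seq_sigma[OF e] sig_closed_carrier[OF x]] by blast
  then have "y \<in> C" using C e x unfolding sig_closed_def by blast
  then show ?thesis
    using val_spow_limit[OF sig_closed_carrier[OF x] profinite_seq_sigma[OF e] _ y] by blast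
qed

lemma sig_closed_neg:
  assumes x: "x \<in> C"
  shows "\<exists>y\<in>C. \<forall>m a. 0 < m \<longrightarrow> [int (val A m a y) = - int (val A m a x)] (mod int m)"
proof -
  have "(\<lambda>k. fact k - 1) \<in> sigma \<pi>" by (simp add: sigma_def)
  then obtain y where y: "y \<in> C"
    "\<And>m a. 0 < m \<Longrightarrow> \<forall>\<^sub>F k in sequentially. val A m a y = ((fact k - 1) * val A m a x) mod m"
    using sig_closed_unary[OF _ x] by blast
  have "[int (val A m a y) = - int (val A m a x)] (mod int m)" if "0 < m" for m a
    using y(2)[OF that] that by (rule eventually_fact_neg)
  with y(1) show ?thesis by blast
qed

lemma sig_closed_int_mult:
  assumes x: "x \<in> C"
  shows "\<exists>y\<in>C. \<forall>m a. 0 < m \<longrightarrow> [int (val A m a y) = i * int (val A m a x)] (mod int m)"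
proof -
  obtain x' where x': "x' \<in> C" "\<And>m a. 0 < m \<Longrightarrow> [int (val A m a x') = - int (val A m a x)] (mod int m)"
    using sig_closed_neg[OF x] by blast
  show ?thesis
  proof (induction i rule: int_induct[where k = 0])
    \<comment> \<open>Without an empty word, the zero multiple is realised by \<open>x\<close> times
      its (omega-1)-power.\<close>
    case base
    have "[int (val A m a (smult (free_pro fin_sgrps A) x x')) = 0 * int (val A m a x)] (mod int m)"
      if "0 < m" for m a
      using cong_trans[OF val_smult_cong[OF that] cong_add[OF cong_refl[of "int (val A m a x)"] x'(2)[OF that, of a]]]
      by simp
    then show ?case using sig_closed_smult[OF x x'(1)] by blast
  next
    case (step1 i)
    then obtain y where y: "y \<in> C" "\<And>m a. 0 < m \<Longrightarrow> [int (val A m a y) = i * int (val A m a x)] (mod int m)"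
      by blast
    have "[int (val A m a (smult (free_pro fin_sgrps A) y x)) = (i + 1) * int (val A m a x)] (mod int m)"
      if "0 < m" for m a
      using cong_trans[OF val_smult_cong[OF that] cong_add[OF y(2)[OF that, of a] cong_refl[of "int (val A m a x)"]]]
      by (simp add: algebra_simps)
    then show ?case using sig_closed_smult[OF y(1) x] by blast
  next
    case (step2 i)
    then obtain y where y: "y \<in> C" "\<And>m a. 0 < m \<Longrightarrow> [int (val A m a y) = i * int (val A m a x)] (mod int m)"
      by blast
    have "[int (val A m a (smult (free_pro fin_sgrps A) y x')) = (i - 1) * int (val A m a x)] (mod int m)"
      if "0 < m" for m a
      using cong_trans[OF val_smult_cong[OF that] cong_add[OF y(2)[OF that, of a] x'(2)[OF that, of a]]]
      by (simp add: algebra_simps)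
    then show ?case using sig_closed_smult[OF y(1) x'(1)] by blast
  qed
qed

lemma sig_closed_lin:
  assumes x: "x \<in> C" and z: "z \<in> C"
  shows "\<exists>y\<in>C. \<forall>m a. 0 < m \<longrightarrow>
    [int (val A m a y) = i * int (val A m a x) + j * int (val A m a z)] (mod int m)"
proof -
  obtain x' where x': "x' \<in> C" "\<And>m a. 0 < m \<Longrightarrow> [int (val A m a x') = i * int (val A m a x)] (mod int m)"
    using sig_closed_int_mult[OF x] by blast
  obtain z' where z': "z' \<in> C" "\<And>m a. 0 < m \<Longrightarrow> [int (val A m a z') = j * int (val A m a z)] (mod int m)"
    using sig_closed_int_mult[OF z] by blast
  have "[int (val A m a (smult (free_pro fin_sgrps A) x' z')) = i * int (val A m a x) + j * int (val A m a z)] (mod int m)"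
    if "0 < m" for m a
    using cong_trans[OF val_smult_cong[OF that] cong_add[OF x'(2)[OF that] z'(2)[OF that]]] .
  then show ?thesis using sig_closed_smult[OF x'(1) z'(1)] by blast
qed

text \<open>The vanishing clause holds because the exponents \<open>p ^ (k! - 1)\<close> are
  eventually divisible by any power of \<open>p\<close>. It allows for a factor already present in
  \<open>x\<close>, so that the construction can be iterated over several primes.\<close>

lemma sig_closed_prime_inverse:
  assumes p: "p \<in> finite_primes \<pi>" and x: "x \<in> C"
  shows "\<exists>y\<in>C. \<forall>m a. 0 < m \<longrightarrow> (coprime p m \<longrightarrow> [p * val A m a y = val A m a x] (mod m)) \<and>
    (\<forall>n. m dvd p ^ n * val A m a x \<longrightarrow> val A m a y = 0)"
proof -
  have "(\<lambda>k. p ^ (fact k - 1)) \<in> sigma \<pi>" using p by (auto simp: sigma_def)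
  then obtain y where y: "y \<in> C"
    "\<And>m a. 0 < m \<Longrightarrow> \<forall>\<^sub>F k in sequentially. val A m a y = (p ^ (fact k - 1) * val A m a x) mod m"
    using sig_closed_unary[OF _ x] by blast
  have "[p * val A m a y = val A m a x] (mod m)" if "0 < m" "coprime p m" for m a
    using y(2)[OF that(1)] that by (rule eventually_prime_inverse)
  moreover have "val A m a y = 0" if m: "0 < m" and d: "m dvd p ^ n * val A m a x" for m a n
  proof -
    have "\<forall>\<^sub>F k in sequentially. n \<le> fact k - (1::nat)"
      using fact_minus_1_at_top by (simp add: filterlim_at_top)
    with y(2)[OF m, of a] have "\<forall>\<^sub>F k in sequentially.
      val A m a y = (p ^ (fact k - 1) * val A m a x) mod m \<and> n \<le> fact k - (1::nat)"
      by (rule eventually_conj)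
    then obtain k where k: "val A m a y = (p ^ (fact k - 1) * val A m a x) mod m" "n \<le> fact k - (1::nat)"
      using eventually_happens[of _ sequentially] by auto
    have "p ^ n * val A m a x dvd p ^ (fact k - 1) * val A m a x"
      using k(2) by (intro mult_dvd_mono le_imp_power_dvd dvd_refl)
    then have "m dvd p ^ (fact k - 1) * val A m a x" using d dvd_trans by blast
    then show ?thesis using k(1) by simp
  qed
  ultimately show ?thesis using y(1) by blast
qed

lemma sig_closed_inverse:
  assumes x: "x \<in> C" and "q \<in> smooth \<pi>"
  shows "\<exists>z\<in>C. \<forall>m a. 0 < m \<longrightarrow> (coprime q m \<longrightarrow> [q * val A m a z = val A m a x] (mod m)) \<and>
    (\<forall>n. m dvd q ^ n \<longrightarrow> val A m a z = 0)"
  using assms(2)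
proof (induction q rule: prime_divisors_induct)
  case zero
  then show ?case by (simp add: smooth_def)
next
  case (unit q)
  then show ?case using x val_less[OF _ sig_closed_carrier[OF x], of 1] by (intro bexI[of _ x]) auto
next
  case (factor p q)
  have p: "p \<in> finite_primes \<pi>" and q: "q \<in> smooth \<pi>" using factor by (auto simp: smooth_def)
  obtain z where z: "z \<in> C" "\<And>m a. 0 < m \<Longrightarrow> coprime q m \<Longrightarrow> [q * val A m a z = val A m a x] (mod m)"
    "\<And>m a n. 0 < m \<Longrightarrow> m dvd q ^ n \<Longrightarrow> val A m a z = 0"
    using factor.IH[OF q] by blast
  obtain y where y: "y \<in> C" "\<And>m a. 0 < m \<Longrightarrow> coprime p m \<Longrightarrow> [p * val A m a y = val A m a z] (mod m)"
    "\<And>m a n. 0 < m \<Longrightarrow> m dvd p ^ n * val A m a z \<Longrightarrow> val A m a y = 0"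
    using sig_closed_prime_inverse[OF p z(1)] by blast
  have "[p * q * val A m a y = val A m a x] (mod m)" if m: "0 < m" "coprime (p * q) m" for m a
  proof -
    have "[q * (p * val A m a y) = q * val A m a z] (mod m)"
      using m by (intro cong_mult cong_refl y) auto
    also have "[q * val A m a z = val A m a x] (mod m)" using m by (intro z) auto
    finally show ?thesis by (simp add: ac_simps)
  qed
  moreover have "val A m a y = 0" if m: "0 < m" "m dvd (p * q) ^ n" for m a n
  proof (rule y(3)[OF m(1), of n])
    \<comment> \<open>Modulo \<open>g\<close> the exponent of \<open>z\<close> vanishes by
      induction, and the rest of \<open>m\<close> is absorbed by \<open>p ^ n\<close>.\<close>
    define g where "g = gcd m (q ^ n)"
    have g: "0 < g" "g dvd m" using m by (auto simp: g_def)
    have "val A g a z = 0" by (rule z(3)[OF g(1), of n]) (simp add: g_def)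
    then have "g dvd val A m a z"
      using val_mod[OF m(1) g(2) sig_closed_carrier[OF z(1)], of a] by (simp add: dvd_eq_mod_eq_0)
    then have "p ^ n * g dvd p ^ n * val A m a z" by (rule mult_dvd_mono[OF dvd_refl])
    moreover have "m dvd p ^ n * g"
      using m(2) by (simp add: g_def gcd_mult_distrib_nat power_mult_distrib)
    ultimately show "m dvd p ^ n * val A m a z" by (rule dvd_trans[rotated])
  qed
  ultimately show ?case using y(1) by blast
qed

end

text \<open>Modulo \<open>N\<close> the exponents of \<open>t\<close> are given by \<open>f\<close>; modulo integers prime to \<open>q\<close> they
  are given by the fractions \<open>g / q\<close>.\<close>

definition has_image :: "supernatural \<Rightarrow> 'a set \<Rightarrow> nat \<Rightarrow> nat \<Rightarrow> 'a pro \<Rightarrow> ('a \<Rightarrow> int) \<Rightarrow> ('a \<Rightarrow> int) \<Rightarrow> bool" where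
  "has_image \<pi> A q N t f g \<longleftrightarrow> (\<forall>a\<in>A. [int (val A N a t) = f a] (mod int N)) \<and>
    (\<forall>m. nat_dvd_supernatural \<pi> m \<longrightarrow> coprime m q \<longrightarrow> (\<forall>a\<in>A. [int q * int (val A m a t) = g a] (mod int m)))"

lemma has_image_smult:
  assumes "0 < N" "has_image \<pi> A q N s f g" "has_image \<pi> A q N t f' g'"
  shows "has_image \<pi> A q N (smult (free_pro fin_sgrps A) s t) (\<lambda>x. f x + f' x) (\<lambda>x. g x + g' x)"
  unfolding has_image_def
proof (intro conjI allI impI ballI)
  fix a assume "a \<in> A"
  then show "[int (val A N a (smult (free_pro fin_sgrps A) s t)) = f a + f' a] (mod int N)"
    using assms unfolding has_image_def by (intro cong_trans[OF val_smult_cong cong_add]) auto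
next
  fix m a assume m: "nat_dvd_supernatural \<pi> m" "coprime m q" "a \<in> A"
  have "[int q * int (val A m a (smult (free_pro fin_sgrps A) s t)) =
      int q * (int (val A m a s) + int (val A m a t))] (mod int m)"
    using m by (intro cong_mult cong_refl val_smult_cong) (simp add: nat_dvd_supernatural_iff)
  also have "int q * (int (val A m a s) + int (val A m a t)) = int q * int (val A m a s) + int q * int (val A m a t)"
    by (simp add: algebra_simps)
  also have "[\<dots> = g a + g' a] (mod int m)"
    using assms m unfolding has_image_def by (intro cong_add) auto
  finally show "[int q * int (val A m a (smult (free_pro fin_sgrps A) s t)) = g a + g' a] (mod int m)" .
qed

text \<open>Take \<open>y = i x + (j - i q) z\<close> in exponents, where \<open>z\<close> is
  \<open>x / q\<close> modulo integers prime to \<open>q\<close> and 0 modulo \<open>N\<close>.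
  Modulo \<open>N\<close> only \<open>i f\<close> survives; on the other side \<open>q y\<close>
  becomes \<open>i q f + (j - i q) f = j f\<close>.\<close>

lemma sig_closed_has_image_multiple:
  assumes C: "sig_closed (sigma \<pi>) A C" and x: "x \<in> C" and q: "q \<in> smooth \<pi>" and N: "0 < N" "N dvd q ^ n"
    and im: "has_image \<pi> A q N x f (\<lambda>a. int q * f a)"
  shows "\<exists>y\<in>C. has_image \<pi> A q N y (\<lambda>a. i * f a) (\<lambda>a. j * f a)"
proof -
  obtain z where z: "z \<in> C" "\<And>m a. 0 < m \<Longrightarrow> coprime q m \<Longrightarrow> [q * val A m a z = val A m a x] (mod m)"
    "\<And>m a n. 0 < m \<Longrightarrow> m dvd q ^ n \<Longrightarrow> val A m a z = 0"
    using sig_closed_inverse[OF C x q] by blast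
  obtain y where y: "y \<in> C" "\<And>m a. 0 < m \<Longrightarrow>
    [int (val A m a y) = i * int (val A m a x) + (j - i * int q) * int (val A m a z)] (mod int m)"
    using sig_closed_lin[OF C x z(1)] by blast
  have "has_image \<pi> A q N y (\<lambda>a. i * f a) (\<lambda>a. j * f a)"
    unfolding has_image_def
  proof (intro conjI allI impI ballI)
    fix a assume a: "a \<in> A"
    have "[int (val A N a y) = i * int (val A N a x)] (mod int N)"
      using y(2)[OF N(1), of a] z(3)[OF N, of a] by simp
    also have "[i * int (val A N a x) = i * f a] (mod int N)"
      using im a unfolding has_image_def by (intro cong_mult cong_refl) auto
    finally show "[int (val A N a y) = i * f a] (mod int N)" .
  next
    fix m a assume m: "nat_dvd_supernatural \<pi> m" "coprime m q" "a \<in> A"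
    have m0: "0 < m" using m by (simp add: nat_dvd_supernatural_iff)
    have cop: "coprime q m" using m(2) by (simp add: coprime_commute)
    have "[int q * int (val A m a x) = int q * f a] (mod int m)"
      using im m unfolding has_image_def by auto
    then have xf: "[int (val A m a x) = f a] (mod int m)"
      using cop by (simp add: cong_mult_lcancel)
    have qz: "[int q * int (val A m a z) = int (val A m a x)] (mod int m)"
      using z(2)[OF m0 cop, of a] by (metis cong_int_iff of_nat_mult)
    have "[int q * int (val A m a y) = int q * (i * int (val A m a x) + (j - i * int q) * int (val A m a z))] (mod int m)"
      by (intro cong_mult cong_refl y m0)
    also have "int q * (i * int (val A m a x) + (j - i * int q) * int (val A m a z)) =
        i * (int q * int (val A m a x)) + (j - i * int q) * (int q * int (val A m a z))"
      by (simp add: algebra_simps)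
    also have "[\<dots> = i * (int q * f a) + (j - i * int q) * int (val A m a x)] (mod int m)"
      by (intro cong_add cong_mult cong_refl xf qz)
    also have "[i * (int q * f a) + (j - i * int q) * int (val A m a x) = i * (int q * f a) + (j - i * int q) * f a] (mod int m)"
      by (intro cong_add cong_mult cong_refl xf)
    also have "i * (int q * f a) + (j - i * int q) * f a = j * f a" by (simp add: algebra_simps)
    finally show "[int q * int (val A m a y) = j * f a] (mod int m)" .
  qed
  with y(1) show ?thesis by blast
qed

section \<open>Rational constraints\<close>

text \<open>All \<open>q\<close> and \<open>N\<close> are quantified inside, because the denominator
  is found only after the pieces have been fixed. The independence of \<open>s\<close> and
  \<open>s'\<close> later allows the given solution to be kept modulo \<open>N\<close> while
  fractions are used elsewhere.\<close>

definition piece :: "supernatural \<Rightarrow> 'a set \<Rightarrow> 'a list set \<Rightarrow> ('a \<Rightarrow> int) \<Rightarrow> ('a \<Rightarrow> int) set \<Rightarrow> bool" where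
  "piece \<pi> A L a G \<longleftrightarrow> int_subgroup G \<and>
    (\<forall>q\<in>smooth \<pi>. \<forall>N>0. (\<exists>n. N dvd q ^ n) \<longrightarrow> (\<forall>s\<in>G. \<forall>s'\<in>G.
      \<exists>t\<in>sig_subalgebra (sigma \<pi>) fin_sgrps A. Some t \<in> Cl A L \<and>
        has_image \<pi> A q N t (\<lambda>x. a x + s x) (\<lambda>x. int q * a x + s' x)))"

lemma pieceD:
  assumes "piece \<pi> A L a G" "q \<in> smooth \<pi>" "0 < N" "N dvd q ^ n" "s \<in> G" "s' \<in> G"
  shows "\<exists>t\<in>sig_subalgebra (sigma \<pi>) fin_sgrps A. Some t \<in> Cl A L \<and>
    has_image \<pi> A q N t (\<lambda>x. a x + s x) (\<lambda>x. int q * a x + s' x)"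
  using assms unfolding piece_def by blast

lemma piece_subgroup: "piece \<pi> A L a G \<Longrightarrow> int_subgroup G"
  by (simp add: piece_def)

lemma piece_mono: "piece \<pi> A K a G \<Longrightarrow> K \<subseteq> L \<Longrightarrow> piece \<pi> A L a G"
  unfolding piece_def using Cl_mono[of K L A] by blast

lemma piece_letter:
  assumes "a \<in> A" shows "piece \<pi> A {[a]} (\<lambda>x. of_bool (a = x)) {\<lambda>_. 0}"
  unfolding piece_def
proof (intro conjI ballI allI impI)
  fix q N :: nat and s s' :: "'a \<Rightarrow> int" assume N: "0 < N" and s: "s \<in> {\<lambda>_. 0}" "s' \<in> {\<lambda>_. 0}"
  have "Some (gen fin_sgrps A a) \<in> Cl A {[a]}"
    using assms by (subst Some_in_Cl_iff) (auto simp: gen_carrier gen_apply subset_iff)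
  moreover have "[int (val A m x (gen fin_sgrps A a)) = of_bool (a = x)] (mod int m)"
    if "0 < m" for m x
    using assms that by (simp add: val_gen cong_def zmod_int)
  then have "has_image \<pi> A q N (gen fin_sgrps A a) (\<lambda>x. of_bool (a = x) + s x) (\<lambda>x. int q * of_bool (a = x) + s' x)"
    using s N by (auto simp: has_image_def nat_dvd_supernatural_iff cong_scalar_left)
  ultimately show "\<exists>t\<in>sig_subalgebra (sigma \<pi>) fin_sgrps A. Some t \<in> Cl A {[a]} \<and>
    has_image \<pi> A q N t (\<lambda>x. of_bool (a = x) + s x) (\<lambda>x. int q * of_bool (a = x) + s' x)"
    using sig_subalgebra.gen[OF assms] by blast
qed (simp add: int_subgroup_def)

lemma piece_product:
  assumes K: "K \<subseteq> lists A" and L: "L \<subseteq> lists A" and a: "piece \<pi> A K a G" and b: "piece \<pi> A L b H"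
  shows "piece \<pi> A {u @ v | u v. u \<in> K \<and> v \<in> L} (\<lambda>x. a x + b x) {\<lambda>x. g x + h x | g h. g \<in> G \<and> h \<in> H}"
  unfolding piece_def
proof (intro conjI ballI allI impI)
  note G = piece_subgroup[OF a] and H = piece_subgroup[OF b]
  show "int_subgroup {\<lambda>x. g x + h x | g h. g \<in> G \<and> h \<in> H}"
    unfolding int_subgroup_def
  proof (intro conjI ballI)
    show "(\<lambda>_. 0) \<in> {\<lambda>x. g x + h x | g h. g \<in> G \<and> h \<in> H}"
      using int_subgroup_zero[OF G] int_subgroup_zero[OF H] by force
    fix s s' assume "s \<in> {\<lambda>x. g x + h x | g h. g \<in> G \<and> h \<in> H}" "s' \<in> {\<lambda>x. g x + h x | g h. g \<in> G \<and> h \<in> H}"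
    then obtain g h g' h' where *: "g \<in> G" "g' \<in> G" "h \<in> H" "h' \<in> H"
      "s = (\<lambda>x. g x + h x)" "s' = (\<lambda>x. g' x + h' x)" by blast
    then have "(\<lambda>x. s x - s' x) = (\<lambda>x. (g x - g' x) + (h x - h' x))" by auto
    then show "(\<lambda>x. s x - s' x) \<in> {\<lambda>x. g x + h x | g h. g \<in> G \<and> h \<in> H}"
      using int_subgroup_diff[OF G *(1,2)] int_subgroup_diff[OF H *(3,4)]
      by (intro CollectI exI[of _ "\<lambda>x. g x - g' x"] exI[of _ "\<lambda>x. h x - h' x"] conjI)
  qed
  fix q N :: nat and s s' assume q: "q \<in> smooth \<pi>" and N: "0 < N" "\<exists>n. N dvd q ^ n"
    and "s \<in> {\<lambda>x. g x + h x | g h. g \<in> G \<and> h \<in> H}" "s' \<in> {\<lambda>x. g x + h x | g h. g \<in> G \<and> h \<in> H}"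
  then obtain n g h g' h' where *: "g \<in> G" "g' \<in> G" "h \<in> H" "h' \<in> H" "N dvd q ^ n"
      "s = (\<lambda>x. g x + h x)" "s' = (\<lambda>x. g' x + h' x)" by blast
  obtain t where t: "t \<in> sig_subalgebra (sigma \<pi>) fin_sgrps A" "Some t \<in> Cl A K"
    "has_image \<pi> A q N t (\<lambda>x. a x + g x) (\<lambda>x. int q * a x + g' x)"
    using pieceD[OF a q N(1) *(5,1,2)] by blast
  obtain t' where t': "t' \<in> sig_subalgebra (sigma \<pi>) fin_sgrps A" "Some t' \<in> Cl A L"
    "has_image \<pi> A q N t' (\<lambda>x. b x + h x) (\<lambda>x. int q * b x + h' x)"
    using pieceD[OF b q N(1) *(5,3,4)] by blast
  have "has_image \<pi> A q N (smult (free_pro fin_sgrps A) t t')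
    (\<lambda>x. (a x + b x) + s x) (\<lambda>x. int q * (a x + b x) + s' x)"
    using has_image_smult[OF N(1) t(3) t'(3)] by (simp add: * algebra_simps)
  then show "\<exists>t\<in>sig_subalgebra (sigma \<pi>) fin_sgrps A. Some t \<in> Cl A {u @ v | u v. u \<in> K \<and> v \<in> L} \<and>
    has_image \<pi> A q N t (\<lambda>x. (a x + b x) + s x) (\<lambda>x. int q * (a x + b x) + s' x)"
    using sig_subalgebra.mult[OF t(1) t'(1)] Cl_mult[OF K L t(2) t'(2)] by blast
qed

text \<open>\<open>J\<close> is the set of pieces of \<open>K\<close> used by a word of \<open>K\<^sup>*\<close>.\<close>

definition star_subgroup :: "(('a \<Rightarrow> int) \<times> ('a \<Rightarrow> int) set) set \<Rightarrow> ('a \<Rightarrow> int) set" where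
  "star_subgroup J = {\<lambda>x. \<Sum>i\<in>J. g i x + k i * fst i x | g k. \<forall>i\<in>J. g i \<in> snd i}"

lemma star_subgroupI: "(\<And>i. i \<in> J \<Longrightarrow> g i \<in> snd i) \<Longrightarrow> (\<And>x. s x = (\<Sum>i\<in>J. g i x + k i * fst i x)) \<Longrightarrow> s \<in> star_subgroup J"
  unfolding star_subgroup_def by blast

lemma star_subgroupE:
  assumes "s \<in> star_subgroup J"
  obtains g k where "\<And>i. i \<in> J \<Longrightarrow> g i \<in> snd i" "\<And>x. s x = (\<Sum>i\<in>J. g i x + k i * fst i x)"
  using assms unfolding star_subgroup_def by blast

lemma int_subgroup_star_subgroup:
  assumes "\<And>i. i \<in> J \<Longrightarrow> int_subgroup (snd i)" shows "int_subgroup (star_subgroup J)"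
  unfolding int_subgroup_def
proof (intro conjI ballI)
  show "(\<lambda>_. 0) \<in> star_subgroup J"
    by (rule star_subgroupI[where g = "\<lambda>_ _. 0" and k = "\<lambda>_. 0"]) (simp_all add: int_subgroup_zero assms)
  fix s s' assume s: "s \<in> star_subgroup J" "s' \<in> star_subgroup J"
  from s(1) obtain g k where g: "\<And>i. i \<in> J \<Longrightarrow> g i \<in> snd i" "\<And>x. s x = (\<Sum>i\<in>J. g i x + k i * fst i x)"
    by (elim star_subgroupE) blast
  from s(2) obtain g' k' where g': "\<And>i. i \<in> J \<Longrightarrow> g' i \<in> snd i" "\<And>x. s' x = (\<Sum>i\<in>J. g' i x + k' i * fst i x)"
    by (elim star_subgroupE) blast
  show "(\<lambda>x. s x - s' x) \<in> star_subgroup J"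
  proof (rule star_subgroupI[where g = "\<lambda>i x. g i x - g' i x" and k = "\<lambda>i. k i - k' i"])
    show "(\<lambda>x. g i x - g' i x) \<in> snd i" if "i \<in> J" for i
      using int_subgroup_diff[OF assms[OF that] g(1)[OF that] g'(1)[OF that]] .
  qed (auto simp: g(2) g'(2) sum_subtractf[symmetric] algebra_simps intro!: sum.cong)
qed

text \<open>A word realising the coset is multiplied by an element whose exponents are multiples of
  \<open>a\<close> alone. These multiples, with unrelated coefficients on the two sides, are what
  the star adds to the subgroup.\<close>

lemma piece_star_one:
  assumes K: "K \<subseteq> lists A" and i: "piece \<pi> A K a G" and q: "q \<in> smooth \<pi>" and N: "0 < N" "N dvd q ^ n"
    and g: "g \<in> G" "g' \<in> G"
  shows "\<exists>t\<in>sig_subalgebra (sigma \<pi>) fin_sgrps A. Some t \<in> Cl A (concat ` lists K) \<and>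
    has_image \<pi> A q N t (\<lambda>x. a x + (g x + k * a x)) (\<lambda>x. int q * a x + (g' x + k' * a x))"
proof -
  define C where "C = {t \<in> sig_subalgebra (sigma \<pi>) fin_sgrps A. Some t \<in> Cl A (concat ` lists K)}"
  have C: "sig_closed (sigma \<pi>) A C"
    unfolding C_def by (rule sig_closed_star[OF K profinite_seq_sigma])
  have "K \<subseteq> concat ` lists K"
  proof
    fix w assume "w \<in> K"
    then show "w \<in> concat ` lists K" by (intro image_eqI[of _ _ "[w]"]) auto
  qed
  then have sub: "Cl A K \<subseteq> Cl A (concat ` lists K)" by (rule Cl_mono)
  obtain t where t: "t \<in> C" "has_image \<pi> A q N t (\<lambda>x. a x + g x) (\<lambda>x. int q * a x + g' x)"
    using pieceD[OF i q N g] sub unfolding C_def by blast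
  \<comment> \<open>Zero lies in the subgroup, so the base point itself is realised, with the same
    integral exponents on both sides.\<close>
  obtain x where x: "x \<in> C" "has_image \<pi> A q N x a (\<lambda>x. int q * a x)"
    using pieceD[OF i q N int_subgroup_zero int_subgroup_zero] piece_subgroup[OF i] sub unfolding C_def by auto
  obtain y where y: "y \<in> C" "has_image \<pi> A q N y (\<lambda>x. k * a x) (\<lambda>x. k' * a x)"
    using sig_closed_has_image_multiple[OF C x(1) q N x(2)] by blast
  have "smult (free_pro fin_sgrps A) t y \<in> C" using sig_closed_smult[OF C t(1) y(1)] .
  moreover have "has_image \<pi> A q N (smult (free_pro fin_sgrps A) t y)
      (\<lambda>x. a x + (g x + k * a x)) (\<lambda>x. int q * a x + (g' x + k' * a x))"
    using has_image_smult[OF N(1) t(2) y(2)] by (simp add: add.assoc)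
  ultimately show ?thesis unfolding C_def by blast
qed

text \<open>Each piece of \<open>J\<close> contributes one factor, which accounts for the sum of
  base points; the product runs over a nonempty set because there is no empty product.\<close>

lemma piece_star:
  assumes K: "K \<subseteq> lists A" and J: "finite J" "J \<noteq> {}" "\<And>i. i \<in> J \<Longrightarrow> piece \<pi> A K (fst i) (snd i)"
  shows "piece \<pi> A (concat ` lists K) (\<lambda>x. \<Sum>i\<in>J. fst i x) (star_subgroup J)"
  unfolding piece_def
proof (intro conjI ballI allI impI)
  show "int_subgroup (star_subgroup J)" using J(3) by (intro int_subgroup_star_subgroup piece_subgroup)
  fix q N :: nat and s s'
  assume q: "q \<in> smooth \<pi>" and N: "0 < N" "\<exists>n. N dvd q ^ n" and s: "s \<in> star_subgroup J" "s' \<in> star_subgroup J"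
  obtain n where n: "N dvd q ^ n" using N(2) by blast
  define C where "C = {t \<in> sig_subalgebra (sigma \<pi>) fin_sgrps A. Some t \<in> Cl A (concat ` lists K)}"
  have C: "sig_closed (sigma \<pi>) A C"
    unfolding C_def by (rule sig_closed_star[OF K profinite_seq_sigma])
  from s(1) obtain g k where g: "\<And>i. i \<in> J \<Longrightarrow> g i \<in> snd i" "\<And>x. s x = (\<Sum>i\<in>J. g i x + k i * fst i x)"
    by (elim star_subgroupE) blast
  from s(2) obtain g' k' where g': "\<And>i. i \<in> J \<Longrightarrow> g' i \<in> snd i" "\<And>x. s' x = (\<Sum>i\<in>J. g' i x + k' i * fst i x)"
    by (elim star_subgroupE) blast
  have one: "\<exists>t\<in>C. has_image \<pi> A q N t (\<lambda>x. fst i x + (g i x + k i * fst i x)) (\<lambda>x. int q * fst i x + (g' i x + k' i * fst i x))"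
    if "i \<in> J" for i
    using piece_star_one[OF K J(3)[OF that] q N(1) n g(1)[OF that] g'(1)[OF that], of "k i" "k' i"] unfolding C_def by blast
  have "\<exists>t\<in>C. has_image \<pi> A q N t (\<lambda>x. \<Sum>i\<in>J. fst i x + (g i x + k i * fst i x))
      (\<lambda>x. \<Sum>i\<in>J. int q * fst i x + (g' i x + k' i * fst i x))"
    using J(1,2) one
  proof (induction J rule: finite_ne_induct)
    case (singleton i)
    then show ?case by simp
  next
    case (insert i J)
    obtain t where t: "t \<in> C" "has_image \<pi> A q N t (\<lambda>x. fst i x + (g i x + k i * fst i x)) (\<lambda>x. int q * fst i x + (g' i x + k' i * fst i x))"
      using insert.prems[of i] by auto
    obtain t' where t': "t' \<in> C" "has_image \<pi> A q N t' (\<lambda>x. \<Sum>i\<in>J. fst i x + (g i x + k i * fst i x))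
      (\<lambda>x. \<Sum>i\<in>J. int q * fst i x + (g' i x + k' i * fst i x))"
      using insert.IH insert.prems by blast
    show ?case
      using sig_closed_smult[OF C t(1) t'(1)] has_image_smult[OF N(1) t(2) t'(2)]
      by (auto simp: insert.hyps)
  qed
  then have "\<exists>t\<in>C. has_image \<pi> A q N t (\<lambda>x. (\<Sum>i\<in>J. fst i x) + s x) (\<lambda>x. int q * (\<Sum>i\<in>J. fst i x) + s' x)"
    by (simp only: sum.distrib[of "\<lambda>i. fst i _"] sum.distrib[of "\<lambda>i. int q * fst i _"] sum_distrib_left g(2) g'(2))
  then show "\<exists>t\<in>sig_subalgebra (sigma \<pi>) fin_sgrps A. Some t \<in> Cl A (concat ` lists K) \<and>
    has_image \<pi> A q N t (\<lambda>x. (\<Sum>i\<in>J. fst i x) + s x) (\<lambda>x. int q * (\<Sum>i\<in>J. fst i x) + s' x)"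
    unfolding C_def by blast
qed

text \<open>Induction on the list of factors, collecting in \<open>J\<close> the pieces met. The
  first use of a piece enters the sum of base points, every further use raises its coefficient in
  the subgroup; empty factors are skipped.\<close>

lemma star_cover:
  assumes P: "finite P" and cov: "\<And>w. w \<in> K \<Longrightarrow> w \<noteq> [] \<Longrightarrow> \<exists>i\<in>P. (\<lambda>x. int (count_list w x) - fst i x) \<in> snd i"
    and lat: "\<And>i. i \<in> P \<Longrightarrow> int_subgroup (snd i)"
  shows "ws \<in> lists K \<Longrightarrow> concat ws \<noteq> [] \<Longrightarrow>
    \<exists>J\<subseteq>P. J \<noteq> {} \<and> (\<lambda>x. int (count_list (concat ws) x) - (\<Sum>i\<in>J. fst i x)) \<in> star_subgroup J"
proof (induction ws)
  case (Cons u ws)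
  have u: "u \<in> K" and ws: "ws \<in> lists K" using Cons.prems by auto
  show ?case
  proof (cases "u = []")
    case True
    then show ?thesis using Cons.IH[OF ws] Cons.prems by simp
  next
    case False
    obtain i where i: "i \<in> P" "(\<lambda>x. int (count_list u x) - fst i x) \<in> snd i" using cov[OF u False] by blast
    define h where "h = (\<lambda>x. int (count_list u x) - fst i x)"
    have cu: "int (count_list u x) = h x + fst i x" for x by (simp add: h_def)
    have h: "h \<in> snd i" using i(2) by (simp add: h_def)
    show ?thesis
    proof (cases "concat ws = []")
      case True
      then have "concat (u # ws) = u" by simp
      then have "(\<lambda>x. int (count_list (concat (u # ws)) x) - (\<Sum>i\<in>{i}. fst i x)) \<in> star_subgroup {i}"
        by (intro star_subgroupI[where g = "\<lambda>_. h" and k = "\<lambda>_. 0"]) (use h in \<open>simp_all add: h_def del: concat.simps\<close>)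
      then show ?thesis using i(1) by (intro exI[of _ "{i}"]) auto
    next
      case False
      then obtain J where J: "J \<subseteq> P" "J \<noteq> {}"
        "(\<lambda>x. int (count_list (concat ws) x) - (\<Sum>i\<in>J. fst i x)) \<in> star_subgroup J"
        using Cons.IH[OF ws] by blast
      have fJ: "finite J" using J(1) P finite_subset by blast
      from J(3) obtain g k where g: "\<And>j. j \<in> J \<Longrightarrow> g j \<in> snd j"
        "\<And>x. int (count_list (concat ws) x) - (\<Sum>i\<in>J. fst i x) = (\<Sum>j\<in>J. g j x + k j * fst j x)"
        by (elim star_subgroupE) blast
      show ?thesis
      proof (cases "i \<in> J")
        case True
        \<comment> \<open>The base point of a repeated piece goes into its coefficient.\<close>
        define g' where "g' j x = g j x + (if j = i then h x else 0)" for j x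
        define k' where "k' j = k j + (if j = i then 1 else 0)" for j
        have "(\<Sum>j\<in>J. g' j x + k' j * fst j x) =
            (\<Sum>j\<in>J. (g j x + k j * fst j x) + (if j = i then h x + fst i x else 0))" for x
          by (intro sum.cong) (auto simp: g'_def k'_def algebra_simps)
        then have *: "(\<Sum>j\<in>J. g' j x + k' j * fst j x) = (\<Sum>j\<in>J. g j x + k j * fst j x) + (h x + fst i x)" for x
          using True fJ by (simp add: sum.distrib)
        have "(\<lambda>x. int (count_list (concat (u # ws)) x) - (\<Sum>i\<in>J. fst i x)) \<in> star_subgroup J"
        proof (rule star_subgroupI[where g = g' and k = k'])
          show "g' j \<in> snd j" if "j \<in> J" for j
            using int_subgroup_add[OF lat[OF i(1)] g(1)[OF True] h] g(1)[OF that]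
            by (cases "j = i") (simp_all add: g'_def[abs_def])
          show "int (count_list (concat (u # ws)) x) - (\<Sum>i\<in>J. fst i x) = (\<Sum>j\<in>J. g' j x + k' j * fst j x)" for x
            using g(2)[of x] cu[of x] by (simp add: *)
        qed
        then show ?thesis using J(1,2) by blast
      next
        case False
        \<comment> \<open>The base point of a new piece is counted by the sum over
          \<open>insert i J\<close>, hence its coefficient is 0.\<close>
        define g' where "g' = g(i := h)"
        define k' where "k' = k(i := 0)"
        have *: "(\<Sum>j\<in>insert i J. g' j x + k' j * fst j x) = h x + (\<Sum>j\<in>J. g j x + k j * fst j x)" for x
        proof -
          have "(\<Sum>j\<in>J. g' j x + k' j * fst j x) = (\<Sum>j\<in>J. g j x + k j * fst j x)"
            using False by (intro sum.cong) (auto simp: g'_def k'_def)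
          then show ?thesis using False fJ by (simp add: g'_def k'_def)
        qed
        have "(\<lambda>x. int (count_list (concat (u # ws)) x) - (\<Sum>i\<in>insert i J. fst i x)) \<in> star_subgroup (insert i J)"
        proof (rule star_subgroupI[where g = g' and k = k'])
          show "g' j \<in> snd j" if "j \<in> insert i J" for j
            using that g(1)[of j] h by (cases "j = i") (simp_all add: g'_def)
          show "int (count_list (concat (u # ws)) x) - (\<Sum>i\<in>insert i J. fst i x) = (\<Sum>j\<in>insert i J. g' j x + k' j * fst j x)" for x
            unfolding * using g(2)[of x] cu[of x] False fJ by simp
        qed
        then show ?thesis using J(1) i(1) by (intro exI[of _ "insert i J"]) auto
      qed
    qed
  qed
qed simp

text \<open>Only nonempty words have to be covered: a variable takes its value in the semigroup,
  where the empty word approximates nothing.\<close>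

definition piece_cover ::
  "supernatural \<Rightarrow> 'a set \<Rightarrow> 'a list set \<Rightarrow> (('a \<Rightarrow> int) \<times> ('a \<Rightarrow> int) set) set \<Rightarrow> bool" where
  "piece_cover \<pi> A L P \<longleftrightarrow> finite P \<and> (\<forall>i\<in>P. piece \<pi> A L (fst i) (snd i)) \<and>
    (\<forall>w\<in>L. w \<noteq> [] \<longrightarrow> (\<exists>i\<in>P. (\<lambda>x. int (count_list w x) - fst i x) \<in> snd i))"

lemma piece_coverD:
  assumes "piece_cover \<pi> A L P"
  shows "finite P" "i \<in> P \<Longrightarrow> piece \<pi> A L (fst i) (snd i)"
    "w \<in> L \<Longrightarrow> w \<noteq> [] \<Longrightarrow> \<exists>i\<in>P. (\<lambda>x. int (count_list w x) - fst i x) \<in> snd i"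
  using assms unfolding piece_cover_def by auto

lemma piece_coverI:
  assumes "finite P" "\<And>i. i \<in> P \<Longrightarrow> piece \<pi> A L (fst i) (snd i)"
    "\<And>w. w \<in> L \<Longrightarrow> w \<noteq> [] \<Longrightarrow> \<exists>i\<in>P. (\<lambda>x. int (count_list w x) - fst i x) \<in> snd i"
  shows "\<exists>P. piece_cover \<pi> A L P"
  unfolding piece_cover_def using assms by (intro exI[of _ P] conjI ballI impI)

text \<open>Parikh's argument by induction on rational expressions, with cosets of subgroups in
  place of linear sets: the profinite closure turns nonnegative coefficients into integral
  ones.\<close>

lemma rational_pieces:
  assumes "rational A L"
  shows "\<exists>P. piece_cover \<pi> A L P"
  using assms
proof (induction rule: rational.induct)
  case empty
  then show ?case by (intro piece_coverI[of "{}"]) auto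
next
  case epsilon
  then show ?case by (intro piece_coverI[of "{}"]) auto
next
  case (letter a)
  then show ?case using piece_letter[of a A \<pi>]
    by (intro piece_coverI[of "{(\<lambda>x. of_bool (a = x), {\<lambda>_. 0})}"]) auto
next
  case (union K L)
  then obtain P Q where P: "piece_cover \<pi> A K P" and Q: "piece_cover \<pi> A L Q" by blast
  note P = piece_coverD[OF P] and Q = piece_coverD[OF Q]
  show ?case
  proof (rule piece_coverI[of "P \<union> Q"])
    show "piece \<pi> A (K \<union> L) (fst i) (snd i)" if "i \<in> P \<union> Q" for i
      using that piece_mono[OF P(2), of i "K \<union> L"] piece_mono[OF Q(2), of i "K \<union> L"] by blast
    show "\<exists>i\<in>P \<union> Q. (\<lambda>x. int (count_list w x) - fst i x) \<in> snd i" if "w \<in> K \<union> L" "w \<noteq> []" for w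
      using that P(3)[of w] Q(3)[of w] by blast
  qed (use P(1) Q(1) in simp)
next
  case (product K L)
  have KL: "K \<subseteq> lists A" "L \<subseteq> lists A"
    using rational_subset_lists[OF product.hyps(1)] rational_subset_lists[OF product.hyps(2)] .
  obtain P Q where P: "piece_cover \<pi> A K P" and Q: "piece_cover \<pi> A L Q" using product.IH by blast
  note P = piece_coverD[OF P] and Q = piece_coverD[OF Q]
  let ?KL = "{u @ v | u v. u \<in> K \<and> v \<in> L}"
  define R where "R = (\<lambda>(i, j). ((\<lambda>x. fst i x + fst j x) :: 'a \<Rightarrow> int, {\<lambda>x. g x + h x | g h. g \<in> snd i \<and> h \<in> snd j})) ` (P \<times> Q)"
  \<comment> \<open>Covers describe nonempty words only, so products with an empty factor are
    handled by the pieces of the other language.\<close>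
  define P' where "P' = (if [] \<in> L then P else {})"
  define Q' where "Q' = (if [] \<in> K then Q else {})"
  have "piece \<pi> A ?KL (fst i) (snd i)" if "i \<in> P' \<union> Q' \<union> R" for i
  proof -
    have "piece \<pi> A ?KL (fst i) (snd i)" if "i \<in> P'"
      using that P(2)[of i] by (auto simp: P'_def split: if_splits intro!: piece_mono[of \<pi> A K])
    moreover have "piece \<pi> A ?KL (fst i) (snd i)" if "i \<in> Q'"
      using that Q(2)[of i] by (auto simp: Q'_def split: if_splits intro!: piece_mono[of \<pi> A L])
    moreover have "piece \<pi> A ?KL (fst i) (snd i)" if "i \<in> R"
      using that piece_product[OF KL P(2) Q(2)] by (auto simp: R_def)
    ultimately show ?thesis using that by blast
  qed
  moreover have "\<exists>i\<in>P' \<union> Q' \<union> R. (\<lambda>x. int (count_list w x) - fst i x) \<in> snd i" if w: "w \<in> ?KL" "w \<noteq> []" for w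
  proof -
    obtain u v where uv: "u \<in> K" "v \<in> L" "w = u @ v" using w(1) by blast
    consider "u = []" | "v = []" | "u \<noteq> []" "v \<noteq> []" by blast
    then show ?thesis
    proof cases
      case 1
      then show ?thesis using Q(3)[of v] uv w(2) by (auto simp: Q'_def)
    next
      case 2
      then show ?thesis using P(3)[of u] uv w(2) by (auto simp: P'_def)
    next
      case 3
      obtain i where i: "i \<in> P" "(\<lambda>x. int (count_list u x) - fst i x) \<in> snd i" using P(3)[OF uv(1) 3(1)] by blast
      obtain j where j: "j \<in> Q" "(\<lambda>x. int (count_list v x) - fst j x) \<in> snd j" using Q(3)[OF uv(2) 3(2)] by blast
      have "(\<lambda>x. int (count_list w x) - (fst i x + fst j x)) =
          (\<lambda>x. (int (count_list u x) - fst i x) + (int (count_list v x) - fst j x))"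
        by (auto simp: uv(3))
      then have "(\<lambda>x. int (count_list w x) - (fst i x + fst j x)) \<in> {\<lambda>x. g x + h x | g h. g \<in> snd i \<and> h \<in> snd j}"
        using i(2) j(2)
        by (intro CollectI exI[of _ "\<lambda>x. int (count_list u x) - fst i x"]
            exI[of _ "\<lambda>x. int (count_list v x) - fst j x"] conjI)
      moreover have "((\<lambda>x. fst i x + fst j x), {\<lambda>x. g x + h x | g h. g \<in> snd i \<and> h \<in> snd j}) \<in> R"
        unfolding R_def using i(1) j(1) by (intro image_eqI[of _ _ "(i, j)"]) auto
      ultimately show ?thesis by (intro bexI[OF _ UnI2]) (simp_all only: fst_conv snd_conv)
    qed
  qed
  moreover have "finite (P' \<union> Q' \<union> R)" using P(1) Q(1) by (auto simp: P'_def Q'_def R_def)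
  ultimately show ?case by (intro piece_coverI[of "P' \<union> Q' \<union> R"])
next
  case (star K)
  have K: "K \<subseteq> lists A" using star.hyps by (rule rational_subset_lists)
  obtain P where P: "piece_cover \<pi> A K P" using star.IH by blast
  note P = piece_coverD[OF P]
  \<comment> \<open>One piece for each possible set of pieces of \<open>K\<close> occurring in a
    word; finiteness of \<open>P\<close> keeps this finite.\<close>
  define R where "R = (\<lambda>J. ((\<lambda>x. \<Sum>i\<in>J. fst i x) :: 'a \<Rightarrow> int, star_subgroup J)) ` {J. J \<subseteq> P \<and> J \<noteq> {}}"
  have "finite R" unfolding R_def using P(1) by auto
  moreover have "piece \<pi> A (concat ` lists K) (fst i) (snd i)" if i: "i \<in> R" for i
  proof -
    obtain J where J: "J \<subseteq> P" "J \<noteq> {}" "i = ((\<lambda>x. \<Sum>i\<in>J. fst i x), star_subgroup J)"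
      using i unfolding R_def by blast
    then show ?thesis using piece_star[OF K finite_subset[OF J(1) P(1)] J(2), of \<pi>] P(2) by auto
  qed
  moreover have "\<exists>i\<in>R. (\<lambda>x. int (count_list w x) - fst i x) \<in> snd i" if w: "w \<in> concat ` lists K" "w \<noteq> []" for w
  proof -
    obtain ws where ws: "ws \<in> lists K" "w = concat ws" using w(1) by blast
    obtain J where J: "J \<subseteq> P" "J \<noteq> {}" "(\<lambda>x. int (count_list w x) - (\<Sum>i\<in>J. fst i x)) \<in> star_subgroup J"
      using star_cover[OF P(1,3) piece_subgroup[OF P(2)] ws(1)] w(2) ws(2) by blast
    have "((\<lambda>x. \<Sum>i\<in>J. fst i x), star_subgroup J) \<in> R" using J(1,2) by (auto simp: R_def)
    then show ?thesis by (rule bexI[rotated]) (simp only: fst_conv snd_conv J(3))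
  qed
  ultimately show ?case by (intro piece_coverI[of R])
qed

text \<open>A compactness argument: if each of the finitely many pieces failed at some divisor of
  \<pi>, all would fail at a common multiple, but a word approximating \<open>t\<close> at that
  modulus lies in one of them.\<close>

lemma solution_piece:
  assumes A: "finite A" and L: "rational A L" and t: "Some t \<in> Cl A L"
  shows "\<exists>a G. piece \<pi> A L a G \<and> (\<forall>m. nat_dvd_supernatural \<pi> m \<longrightarrow>
    (\<exists>s\<in>G. \<forall>x\<in>A. [int (val A m x t) = a x + s x] (mod int m)))"
proof -
  obtain P where P: "piece_cover \<pi> A L P" using rational_pieces[OF L] by blast
  note P = piece_coverD[OF P]
  have Ls: "L \<subseteq> lists A" using L by (rule rational_subset_lists)
  define ok where "ok i m \<longleftrightarrow> (\<exists>s\<in>snd i. \<forall>x\<in>A. [int (val A m x t) = fst i x + s x] (mod int m))"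
    for i :: "('a \<Rightarrow> int) \<times> ('a \<Rightarrow> int) set" and m
  have "\<exists>i\<in>P. \<forall>m. nat_dvd_supernatural \<pi> m \<longrightarrow> ok i m"
  proof (rule ccontr)
    assume "\<not> (\<exists>i\<in>P. \<forall>m. nat_dvd_supernatural \<pi> m \<longrightarrow> ok i m)"
    then obtain f where f: "\<And>i. i \<in> P \<Longrightarrow> nat_dvd_supernatural \<pi> (f i) \<and> \<not> ok i (f i)" by metis
    \<comment> \<open>The least common multiple of the moduli of failure still divides
      \<pi>.\<close>
    have "\<exists>M. nat_dvd_supernatural \<pi> M \<and> (\<forall>i\<in>Q. f i dvd M)" if "finite Q" "Q \<subseteq> P" for Q
      using that
    proof (induction Q)
      case empty
      then show ?case using nat_dvd_supernatural_1 by blast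
    next
      case (insert i Q)
      then obtain M where "nat_dvd_supernatural \<pi> M" "\<forall>i\<in>Q. f i dvd M" by auto
      then show ?case
        using f[of i] insert.prems nat_dvd_supernatural_lcm[of \<pi> "f i" M]
        by (intro exI[of _ "lcm (f i) M"]) auto
    qed
    from this[OF P(1) order.refl] obtain M where M: "nat_dvd_supernatural \<pi> M" "\<And>i. i \<in> P \<Longrightarrow> f i dvd M"
      by (elim exE conjE) (rule that, assumption, erule bspec)
    have M0: "0 < M" using M(1) by (simp add: nat_dvd_supernatural_iff)
    have "cyc_gen A M ` A \<subseteq> gen_sgrps fin_sgrps A" using cyc_gen_fin[OF M0] by auto
    then obtain w where w: "w \<in> L" "w \<noteq> []"
      "\<And>S \<phi>. (S, \<phi>) \<in> cyc_gen A M ` A \<Longrightarrow> t (S, \<phi>) = eval_word S \<phi> w"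
      using Cl_word[OF Ls t finite_imageI[OF A]] by metis
    obtain i where i: "i \<in> P" "(\<lambda>x. int (count_list w x) - fst i x) \<in> snd i" using P(3)[OF w(1,2)] by blast
    have "[int (val A (f i) x t) = fst i x + (int (count_list w x) - fst i x)] (mod int (f i))" if x: "x \<in> A" for x
    proof -
      have "val A M x t = count_list w x mod M"
        by (rule val_approx[OF A x M0 _ w(2,3)]) (use w(1) Ls x in auto)
      then have "val A (f i) x t = count_list w x mod f i"
        using val_mod[OF M0 M(2)[OF i(1)] Cl_carrier[OF t], of x] mod_mod_cancel[OF M(2)[OF i(1)]] by metis
      then show ?thesis by (simp add: cong_def zmod_int)
    qed
    then have "ok i (f i)" unfolding ok_def by (intro bexI[OF _ i(2)] ballI)
    then show False using f[OF i(1)] by blast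
  qed
  then obtain i where "i \<in> P" "\<And>m. nat_dvd_supernatural \<pi> m \<Longrightarrow> ok i m" by blast
  then show ?thesis using P(2) unfolding ok_def by (intro exI[of _ "fst i"] exI[of _ "snd i"]) simp
qed

section \<open>Systems of equations\<close>

definition has_fractions :: "'a set \<Rightarrow> nat \<Rightarrow> ('a \<Rightarrow> int) \<Rightarrow> 'a pro \<Rightarrow> bool" where
  "has_fractions A q n t \<longleftrightarrow> (\<forall>m a. 0 < m \<longrightarrow> coprime m q \<longrightarrow> a \<in> A \<longrightarrow>
    [int q * int (val A m a t) = n a] (mod int m))"

lemma has_fractionsI:
  "(\<And>m a. 0 < m \<Longrightarrow> coprime m q \<Longrightarrow> a \<in> A \<Longrightarrow> [int q * int (val A m a t) = n a] (mod int m)) \<Longrightarrow>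
    has_fractions A q n t"
  by (simp add: has_fractions_def)

lemma has_fractionsD:
  "has_fractions A q n t \<Longrightarrow> 0 < m \<Longrightarrow> coprime m q \<Longrightarrow> a \<in> A \<Longrightarrow>
    [int q * int (val A m a t) = n a] (mod int m)"
  by (simp add: has_fractions_def)

text \<open>Multiplication adds fractions, the (omega-1)-power negates them, and the operation for
  \<open>p\<close> enlarges the denominator by \<open>p\<close>.\<close>

lemma sig_denominator:
  assumes "t \<in> sig_subalgebra (sigma \<pi>) fin_sgrps A"
  shows "\<exists>q\<in>smooth \<pi>. \<exists>n. has_fractions A q n t"
  using assms
proof (induction rule: sig_subalgebra.induct)
  case (gen b)
  have "has_fractions A 1 (\<lambda>a. of_bool (b = a)) (gen fin_sgrps A b)"
    using gen by (intro has_fractionsI) (simp add: val_gen unique_euclidean_semiring_class.cong_def zmod_int)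
  then show ?case using smooth_1 by blast
next
  case (mult x y)
  obtain q n where q: "q \<in> smooth \<pi>" "has_fractions A q n x" using mult.IH(1) by blast
  obtain q' n' where q': "q' \<in> smooth \<pi>" "has_fractions A q' n' y" using mult.IH(2) by blast
  have "[int (q * q') * int (val A m a (smult (free_pro fin_sgrps A) x y)) = int q' * n a + int q * n' a] (mod int m)"
    if m: "0 < m" "coprime m (q * q')" "a \<in> A" for m a
  proof -
    have "[int (q * q') * int (val A m a (smult (free_pro fin_sgrps A) x y)) =
      int (q * q') * (int (val A m a x) + int (val A m a y))] (mod int m)"
      using m(1) by (intro cong_mult cong_refl val_smult_cong)
    also have "int (q * q') * (int (val A m a x) + int (val A m a y)) =
      int q' * (int q * int (val A m a x)) + int q * (int q' * int (val A m a y))" by (simp add: algebra_simps)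
    also have "[\<dots> = int q' * n a + int q * n' a] (mod int m)"
      using m by (intro cong_add cong_mult cong_refl has_fractionsD[OF q(2)] has_fractionsD[OF q'(2)]) auto
    finally show ?thesis .
  qed
  then have "has_fractions A (q * q') (\<lambda>a. int q' * n a + int q * n' a) (smult (free_pro fin_sgrps A) x y)"
    by (rule has_fractionsI)
  then show ?case using smooth_mult[OF q(1) q'(1)] by blast
next
  case (unary e x y)
  have x: "x \<in> carrier (free_pro fin_sgrps A)" using unary.hyps(2) by (rule sig_subalgebra_carrier)
  have ev: "\<forall>\<^sub>F k in sequentially. val A m a y = (e k * val A m a x) mod m" if "0 < m" for m a
    using val_spow_limit[OF x profinite_seq_sigma[OF unary.hyps(1)] that unary.hyps(3)] .
  obtain q n where q: "q \<in> smooth \<pi>" "has_fractions A q n x" using unary.IH by blast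
  from unary.hyps(1) consider "e = (\<lambda>k. fact k - 1)" | p where "p \<in> finite_primes \<pi>" "e = (\<lambda>k. p ^ (fact k - 1))"
    by (auto simp: sigma_def)
  then show ?case
  proof cases
    case 1
    have "[int q * int (val A m a y) = - n a] (mod int m)" if m: "0 < m" "coprime m q" "a \<in> A" for m a
    proof -
      have "[int (val A m a y) = - int (val A m a x)] (mod int m)"
        using ev[OF m(1), unfolded 1] m(1) by (rule eventually_fact_neg)
      then have "[int q * int (val A m a y) = int q * - int (val A m a x)] (mod int m)"
        by (intro cong_mult cong_refl)
      also have "int q * - int (val A m a x) = - (int q * int (val A m a x))" by simp
      also have "[\<dots> = - n a] (mod int m)" using has_fractionsD[OF q(2) m] by (simp add: cong_minus_minus_iff)
      finally show ?thesis .
    qed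
    then have "has_fractions A q (\<lambda>a. - n a) y" by (rule has_fractionsI)
    then show ?thesis using q(1) by blast
  next
    case (2 p)
    have p: "p \<in> smooth \<pi>"
    proof -
      have "prime p" using 2(1) by (simp add: finite_primes_def)
      moreover have "p' = p" if "prime p'" "p' dvd p" for p'
        using primes_dvd_imp_eq[of p' p] that \<open>prime p\<close> by blast
      ultimately show ?thesis using 2(1) prime_gt_0_nat[of p] by (auto simp: smooth_def)
    qed
    have "[int (q * p) * int (val A m a y) = n a] (mod int m)" if m: "0 < m" "coprime m (q * p)" "a \<in> A" for m a
    proof -
      have "coprime p m" using m(2) by (simp add: coprime_commute)
      with ev[OF m(1), unfolded 2(2)] m(1) have "[p * val A m a y = val A m a x] (mod m)"
        by (rule eventually_prime_inverse)
      then have "[int p * int (val A m a y) = int (val A m a x)] (mod int m)" by (metis cong_int_iff of_nat_mult)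
      then have "[int q * (int p * int (val A m a y)) = int q * int (val A m a x)] (mod int m)"
        by (intro cong_mult cong_refl)
      also have "[int q * int (val A m a x) = n a] (mod int m)" using m by (intro has_fractionsD[OF q(2)]) auto
      finally show ?thesis by (simp add: mult.assoc)
    qed
    then have "has_fractions A (q * p) n y" by (rule has_fractionsI)
    then show ?thesis using smooth_mult[OF q(1) p] by blast
  qed
qed

lemma has_fractions_scale:
  assumes "has_fractions A q n t"
  shows "has_fractions A (q * r) (\<lambda>a. int r * n a) t"
proof (rule has_fractionsI)
  fix m a assume "0 < m" "coprime m (q * r)" "a \<in> A"
  then have "[int r * (int q * int (val A m a t)) = int r * n a] (mod int m)"
    by (intro cong_mult cong_refl has_fractionsD[OF assms]) auto
  then show "[int (q * r) * int (val A m a t) = int r * n a] (mod int m)" by (simp add: ac_simps)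
qed

lemma sig_common_denominator:
  assumes "finite U" "U \<subseteq> sig_subalgebra (sigma \<pi>) fin_sgrps A"
  shows "\<exists>q\<in>smooth \<pi>. \<exists>n. \<forall>t\<in>U. has_fractions A q (n t) t"
  using assms
proof (induction U)
  case empty
  then show ?case using smooth_1 by blast
next
  case (insert t U)
  obtain q n where q: "q \<in> smooth \<pi>" "has_fractions A q n t"
    using sig_denominator[of t \<pi> A] insert.prems by blast
  obtain q' n' where q': "q' \<in> smooth \<pi>" "\<forall>s\<in>U. has_fractions A q' (n' s) s"
    using insert.IH insert.prems by blast
  define n2 where "n2 s = (if s = t then (\<lambda>a. int q' * n a) else (\<lambda>a. int q * n' s a))" for s
  have "has_fractions A (q * q') (n2 s) s" if s: "s \<in> insert t U" for s
    using s has_fractions_scale[OF q(2), of q'] has_fractions_scale[of A q' "n' s" s q] q'(2)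
    by (auto simp: n2_def mult.commute[of q' q])
  then show ?case using smooth_mult[OF q(1) q'(1)] by blast
qed

text \<open>Turns an equation into a homogeneous linear condition on the exponents of the images of
  the generators, with coefficients depending only on \<open>u\<close> and \<open>v\<close>.\<close>

lemma val_cont_hom_eq_iff:
  assumes \<delta>: "\<delta> \<in> cont_hom fin_sgrps B fin_sgrps A" and B: "finite B" and m: "0 < m"
    and u: "u \<in> carrier (free_pro fin_sgrps B)" and v: "v \<in> carrier (free_pro fin_sgrps B)"
  shows "val A m a (\<delta> u) = val A m a (\<delta> v) \<longleftrightarrow>
    [(\<Sum>y\<in>B. (int (val B m y u) - int (val B m y v)) * int (val A m a (\<delta> (gen fin_sgrps B y)))) = 0] (mod int m)"
proof -
  let ?S = "\<lambda>u. \<Sum>y\<in>B. val B m y u * val A m a (\<delta> (gen fin_sgrps B y))"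
  have "val A m a (\<delta> u) = val A m a (\<delta> v) \<longleftrightarrow> [?S u = ?S v] (mod m)"
    by (simp only: val_cont_hom[OF \<delta> B m u, of a] val_cont_hom[OF \<delta> B m v, of a] unique_euclidean_semiring_class.cong_def)
  also have "\<dots> \<longleftrightarrow> [int (?S u) = int (?S v)] (mod int m)" by (simp only: cong_int_iff)
  also have "\<dots> \<longleftrightarrow> [int (?S u) - int (?S v) = 0] (mod int m)" by (simp add: cong_iff_dvd_diff cong_0_iff)
  also have "int (?S u) - int (?S v) =
      (\<Sum>y\<in>B. (int (val B m y u) - int (val B m y v)) * int (val A m a (\<delta> (gen fin_sgrps B y))))"
    by (simp add: sum_subtractf[symmetric] algebra_simps)
  finally show ?thesis .
qed

theorem corollary3p19:
  fixes \<pi> :: supernatural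
  assumes "recursive_supernatural \<pi>"
  shows "completely_reducible TYPE('v) TYPE('a) (sigma \<pi>) (Ab \<pi>)"
  unfolding completely_reducible_def reducible_for_def
proof (intro allI impI)
  fix X P :: "'v set" and A :: "'a set" and E L w
  assume "is_system (sigma \<pi>) X P A E L w"
  then have X: "finite X" and P: "finite P" and XP: "X \<inter> P = {}" and A: "finite A" and E: "finite E"
    and Esig: "E \<subseteq> sig_subalgebra (sigma \<pi>) fin_sgrps (X \<union> P) \<times> sig_subalgebra (sigma \<pi>) fin_sgrps (X \<union> P)"
    and L: "\<And>x. x \<in> X \<Longrightarrow> rational A (L x)"
    and w: "\<And>p. p \<in> P \<Longrightarrow> w p \<in> sig_subalgebra (sigma \<pi>) fin_sgrps A"
    by (auto simp: is_system_def)
  assume "\<exists>\<delta>. is_solution (Ab \<pi>) X P A E L w \<delta>"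
  then obtain \<delta> where \<delta>: "\<delta> \<in> cont_hom fin_sgrps (X \<union> P) fin_sgrps A"
    and \<delta>X: "\<And>x. x \<in> X \<Longrightarrow> Some (\<delta> (gen fin_sgrps (X \<union> P) x)) \<in> Cl A (L x)"
    and \<delta>P: "\<And>p. p \<in> P \<Longrightarrow> \<delta> (gen fin_sgrps (X \<union> P) p) = w p"
    and \<delta>E: "\<And>u v. (u, v) \<in> E \<Longrightarrow> satisfies (Ab \<pi>) A (\<delta> u) (\<delta> v)"
    by (fastforce simp: is_solution_def)
  define B where "B = X \<union> P"
  note BXP = B_def[symmetric]
  note \<delta> = \<delta>[unfolded BXP] and \<delta>X = \<delta>X[unfolded BXP] and \<delta>P = \<delta>P[unfolded BXP] and Esig = Esig[unfolded BXP]
  have B: "finite B" using X P by (simp add: B_def)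
  let ?d = "nat_dvd_supernatural \<pi>"
  let ?e = "\<lambda>y. \<delta> (gen fin_sgrps B y)"
  have Ecar: "fst e \<in> carrier (free_pro fin_sgrps B)" "snd e \<in> carrier (free_pro fin_sgrps B)" if "e \<in> E" for e
    using that Esig sig_subalgebra_carrier by force+
  have d0: "0 < m" if "?d m" for m using that by (simp add: nat_dvd_supernatural_iff)
  have sumB: "sum f B = sum f X + sum f P" for f :: "'v \<Rightarrow> int"
    unfolding B_def by (rule sum.union_disjoint[OF X P XP])
  have "\<forall>x\<in>X. \<exists>a G. piece \<pi> A (L x) a G \<and> (\<forall>m. ?d m \<longrightarrow>
    (\<exists>s\<in>G. \<forall>b\<in>A. [int (val A m b (?e x)) = a b + s b] (mod int m)))"
    using solution_piece[OF A L \<delta>X] by blast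
  then obtain \<alpha> G where pc: "\<And>x. x \<in> X \<Longrightarrow> piece \<pi> A (L x) (\<alpha> x) (G x)"
    and sol: "\<And>x m. x \<in> X \<Longrightarrow> ?d m \<Longrightarrow> \<exists>s\<in>G x. \<forall>b\<in>A. [int (val A m b (?e x)) = \<alpha> x b + s b] (mod int m)"
    by metis
  have sol: "\<exists>s. (\<forall>x\<in>X. s x \<in> G x) \<and> (\<forall>x\<in>X. \<forall>b\<in>A. [int (val A m b (?e x)) = \<alpha> x b + s x b] (mod int m))"
    if "?d m" for m
    using sol[OF _ that] by metis
  have lat: "\<And>x. x \<in> X \<Longrightarrow> int_subgroup (G x)" using pc piece_subgroup by blast
  have "finite (fst ` E \<union> snd ` E)" "fst ` E \<union> snd ` E \<subseteq> sig_subalgebra (sigma \<pi>) fin_sgrps B"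
    using E Esig by auto
  from sig_common_denominator[OF this] obtain q1 n1 where q1: "q1 \<in> smooth \<pi>"
    "\<forall>t\<in>fst ` E \<union> snd ` E. has_fractions B q1 (n1 t) t" by blast
  have "finite (w ` P)" "w ` P \<subseteq> sig_subalgebra (sigma \<pi>) fin_sgrps A" using P w by auto
  from sig_common_denominator[OF this] obtain q2 n2 where q2: "q2 \<in> smooth \<pi>"
    "\<forall>t\<in>w ` P. has_fractions A q2 (n2 t) t" by blast
  \<comment> \<open>\<open>q1\<close> is a denominator for the coefficients of the equations,
    \<open>q2\<close> one for the parameters.\<close>
  define q0 where "q0 = q1 * q2"
  have q0: "q0 \<in> smooth \<pi>" unfolding q0_def using q1(1) q2(1) by (rule smooth_mult)
  define D where "D m e y = int (val B m y (fst e)) - int (val B m y (snd e))" for m e y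
  \<comment> \<open>Numerators over the common denominator: \<open>d\<close> represents
    \<open>q0 * D\<close>, and \<open>\<kappa>\<close> represents \<open>q0\<close> times the
    exponents of the parameters.\<close>
  define d where "d e y = int q2 * (n1 (fst e) y - n1 (snd e) y)" for e y
  define \<kappa> where "\<kappa> p a = int q1 * n2 (w p) a" for p a
  have D: "[int q0 * D m e y = d e y] (mod int m)"
    if m: "0 < m" "coprime m q0" and "e \<in> E" "y \<in> B" for m e y
  proof -
    have c: "coprime m q1" using m by (simp add: q0_def)
    have "[int q2 * (int q1 * int (val B m y (fst e)) - int q1 * int (val B m y (snd e))) = d e y] (mod int m)"
      unfolding d_def using that q1(2) by (intro cong_mult cong_diff cong_refl has_fractionsD[of B q1] c) auto
    then show ?thesis by (simp add: q0_def D_def algebra_simps)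
  qed
  have \<kappa>: "[int q0 * int (val A m a (w p)) = \<kappa> p a] (mod int m)"
    if m: "0 < m" "coprime m q0" and "p \<in> P" "a \<in> A" for m p a
  proof -
    have c: "coprime m q2" using m by (simp add: q0_def)
    have "[int q1 * (int q2 * int (val A m a (w p))) = \<kappa> p a] (mod int m)"
      unfolding \<kappa>_def using that q2(2) by (intro cong_mult cong_refl has_fractionsD[of A q2] c) auto
    then show ?thesis by (simp add: q0_def algebra_simps)
  qed
  have \<delta>0: "[(\<Sum>y\<in>B. D m e y * int (val A m a (?e y))) = 0] (mod int m)"
    if m: "?d m" and e: "e \<in> E" and a: "a \<in> A" for m e a
  proof -
    have "satisfies (Ab \<pi>) A (\<delta> (fst e)) (\<delta> (snd e))" using \<delta>E[of "fst e" "snd e"] e by simp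
    then have "val A m a (\<delta> (fst e)) = val A m a (\<delta> (snd e))"
      using m a satisfies_Ab_iff[OF A cont_hom_carrier[OF \<delta> Ecar(1)[OF e]] cont_hom_carrier[OF \<delta> Ecar(2)[OF e]]]
      by blast
    then show ?thesis
      using val_cont_hom_eq_iff[OF \<delta> B d0[OF m] Ecar[OF e]] unfolding D_def by blast
  qed
  \<comment> \<open>Each equation and letter gives a row, multiplied by \<open>q0 * q0\<close>. The
    part depending on the subgroup elements is \<open>h\<close>; base points and parameters form the
    right-hand side \<open>c\<close>.\<close>
  define h where "h g i = (\<Sum>x\<in>X. int q0 * d (fst i) x * g x (snd i))" for g :: "'v \<Rightarrow> 'a \<Rightarrow> int" and i :: "('v pro \<times> 'v pro) \<times> 'a"
  define H where "H = {h g | g. \<forall>x\<in>X. g x \<in> G x}"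
  define c where "c i = - ((\<Sum>x\<in>X. int q0 * d (fst i) x * \<alpha> x (snd i)) + (\<Sum>p\<in>P. d (fst i) p * \<kappa> p (snd i)))"
    for i
  have latH: "int_subgroup H"
    unfolding int_subgroup_def
  proof (intro conjI ballI)
    have "(\<lambda>_. 0) = h (\<lambda>_ _. 0)" by (auto simp: h_def)
    then show "(\<lambda>_. 0) \<in> H" unfolding H_def using int_subgroup_zero[OF lat] by blast
    fix k k' assume "k \<in> H" "k' \<in> H"
    then obtain g g' where g: "\<forall>x\<in>X. g x \<in> G x" "k = h g" "\<forall>x\<in>X. g' x \<in> G x" "k' = h g'"
      unfolding H_def by blast
    have "(\<lambda>i. k i - k' i) = h (\<lambda>x a. g x a - g' x a)"
      by (auto simp: g(2,4) h_def sum_subtractf[symmetric] algebra_simps)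
    moreover have "\<forall>x\<in>X. (\<lambda>a. g x a - g' x a) \<in> G x" using g lat int_subgroup_diff by blast
    ultimately show "(\<lambda>i. k i - k' i) \<in> H" unfolding H_def by blast
  qed
  have loc: "\<exists>k\<in>H. \<forall>i\<in>E \<times> A. [k i = c i] (mod int m)" if m: "?d m" "coprime m q0" for m
  proof -
    obtain s where s: "\<forall>x\<in>X. s x \<in> G x"
      "\<And>x b. x \<in> X \<Longrightarrow> b \<in> A \<Longrightarrow> [int (val A m b (?e x)) = \<alpha> x b + s x b] (mod int m)"
      using sol[OF m(1)] by blast
    have "[h s (e, a) = c (e, a)] (mod int m)" if e: "e \<in> E" and a: "a \<in> A" for e a
    proof -
      have "[(\<Sum>x\<in>X. (int q0 * D m e x) * (int q0 * int (val A m a (?e x)))) =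
          (\<Sum>x\<in>X. d e x * (int q0 * (\<alpha> x a + s x a)))] (mod int m)"
        by (intro cong_sum cong_mult cong_refl D d0 m e s(2) a) (auto simp: B_def)
      moreover have "[(\<Sum>p\<in>P. (int q0 * D m e p) * (int q0 * int (val A m a (?e p)))) =
          (\<Sum>p\<in>P. d e p * \<kappa> p a)] (mod int m)"
      proof (intro cong_sum cong_mult)
        fix p assume p: "p \<in> P"
        then show "[int q0 * D m e p = d e p] (mod int m)" by (intro D d0 m e) (simp add: B_def)
        show "[int q0 * int (val A m a (?e p)) = \<kappa> p a] (mod int m)"
          unfolding \<delta>P[OF p] by (intro \<kappa> d0 m p a)
      qed
      ultimately have f1: "[(\<Sum>y\<in>B. (int q0 * D m e y) * (int q0 * int (val A m a (?e y)))) =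
        (\<Sum>x\<in>X. d e x * (int q0 * (\<alpha> x a + s x a))) + (\<Sum>p\<in>P. d e p * \<kappa> p a)] (mod int m)"
        unfolding sumB by (rule cong_add)
      have eq1: "(\<Sum>y\<in>B. (int q0 * D m e y) * (int q0 * int (val A m a (?e y)))) =
          int q0 * int q0 * (\<Sum>y\<in>B. D m e y * int (val A m a (?e y)))"
        by (simp add: sum_distrib_left ac_simps)
      have f2: "[int q0 * int q0 * (\<Sum>y\<in>B. D m e y * int (val A m a (?e y))) = int q0 * int q0 * 0] (mod int m)"
        by (intro cong_mult cong_refl \<delta>0 m e a)
      have eq2: "(\<Sum>x\<in>X. d e x * (int q0 * (\<alpha> x a + s x a))) + (\<Sum>p\<in>P. d e p * \<kappa> p a) = h s (e, a) - c (e, a)"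
        by (simp add: h_def c_def algebra_simps sum.distrib)
      have "[h s (e, a) - c (e, a) = 0] (mod int m)"
        using cong_trans[OF cong_sym[OF f1[unfolded eq1 eq2]] f2] by simp
      then show ?thesis by (simp add: cong_iff_dvd_diff cong_0_iff)
    qed
    then have "\<forall>i\<in>E \<times> A. [h s i = c i] (mod int m)" by auto
    moreover have "h s \<in> H" using s(1) by (auto simp: H_def)
    ultimately show ?thesis by (rule bexI)
  qed
  obtain q k where q: "q \<in> smooth \<pi>" and k: "k \<in> H"
    "\<And>m i. ?d m \<Longrightarrow> coprime m (q0 * q) \<Longrightarrow> i \<in> E \<times> A \<Longrightarrow> [k i = int q * c i] (mod int m)"
    using supernatural_local_global[OF q0 finite_cartesian_product[OF E A] latH loc] by blast
  obtain g where g: "\<And>x. x \<in> X \<Longrightarrow> g x \<in> G x" "k = h g" using k(1) unfolding H_def by blast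
  have qq: "q0 * q \<in> smooth \<pi>" using q0 q by (rule smooth_mult)
  obtain N n where N: "?d N" "N dvd (q0 * q) ^ n"
    "\<And>m. ?d m \<Longrightarrow> \<exists>m1 m2. m = m1 * m2 \<and> m1 dvd N \<and> coprime m2 (q0 * q) \<and> coprime m1 m2"
    using supernatural_split[OF qq] by blast
  \<comment> \<open>Modulo \<open>N\<close> the exponents of the given solution are kept.\<close>
  obtain s where s: "\<And>x. x \<in> X \<Longrightarrow> s x \<in> G x"
    "\<And>x b. x \<in> X \<Longrightarrow> b \<in> A \<Longrightarrow> [int (val A N b (?e x)) = \<alpha> x b + s x b] (mod int N)"
    using sol[OF N(1)] by blast
  \<comment> \<open>Modulo divisors of \<pi> prime to \<open>q0 * q\<close> the new exponents are
    \<open>\<alpha> x + g x / q\<close>; over the denominator \<open>q0 * q\<close> this gives the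
    summand \<open>q0 * g x\<close>, still in \<open>G x\<close>.\<close>
  have "\<forall>x\<in>X. \<exists>t. t \<in> sig_subalgebra (sigma \<pi>) fin_sgrps A \<and> Some t \<in> Cl A (L x) \<and>
    has_image \<pi> A (q0 * q) N t (\<lambda>b. \<alpha> x b + s x b) (\<lambda>b. int (q0 * q) * \<alpha> x b + int q0 * g x b)"
    using pieceD[OF pc qq d0[OF N(1)] N(2) s(1) int_subgroup_mult[OF lat g(1)]] by (simp only: Bex_def) blast
  from bchoice[OF this] obtain t where t: "\<And>x. x \<in> X \<Longrightarrow> t x \<in> sig_subalgebra (sigma \<pi>) fin_sgrps A"
    "\<And>x. x \<in> X \<Longrightarrow> Some (t x) \<in> Cl A (L x)"
    "\<And>x. x \<in> X \<Longrightarrow> has_image \<pi> A (q0 * q) N (t x) (\<lambda>b. \<alpha> x b + s x b) (\<lambda>b. int (q0 * q) * \<alpha> x b + int q0 * g x b)"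
    by (elim exE) (simp only: Ball_def, blast)
  define T where "T y = (if y \<in> X then t y else w y)" for y
  define \<epsilon> where "\<epsilon> = subst_hom B A T"
  have T: "T y \<in> carrier (free_pro fin_sgrps A)" if "y \<in> B" for y
  proof -
    have "T y \<in> sig_subalgebra (sigma \<pi>) fin_sgrps A" using that t(1) w by (auto simp: T_def B_def)
    then show ?thesis by (rule sig_subalgebra_carrier)
  qed
  have \<epsilon>: "\<epsilon> \<in> cont_hom fin_sgrps B fin_sgrps A"
    unfolding \<epsilon>_def by (rule subst_hom_cont_hom[OF T])
  have \<epsilon>gen: "\<epsilon> (gen fin_sgrps B y) = T y" if "y \<in> B" for y
    unfolding \<epsilon>_def using T that by (rule subst_hom_gen)
  have TP: "T p = w p" if "p \<in> P" for p using that XP by (auto simp: T_def)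
  have crit: "val A m a (\<epsilon> (fst e)) = val A m a (\<epsilon> (snd e)) \<longleftrightarrow>
      [(\<Sum>y\<in>B. D m e y * int (val A m a (T y))) = 0] (mod int m)" if "0 < m" "e \<in> E" for m a e
  proof -
    have "(\<Sum>y\<in>B. D m e y * int (val A m a (\<epsilon> (gen fin_sgrps B y)))) = (\<Sum>y\<in>B. D m e y * int (val A m a (T y)))"
      by (intro sum.cong) (auto simp: \<epsilon>gen)
    then show ?thesis
      using val_cont_hom_eq_iff[OF \<epsilon> B that(1) Ecar[OF that(2)], of a] unfolding D_def by simp
  qed
  have eqN: "val A N a (\<epsilon> (fst e)) = val A N a (\<epsilon> (snd e))" if e: "e \<in> E" and a: "a \<in> A" for e a
  proof -
    have "[int (val A N a (T y)) = int (val A N a (?e y))] (mod int N)" if "y \<in> B" for y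
    proof (cases "y \<in> X")
      case True
      then have "[int (val A N a (t y)) = \<alpha> y a + s y a] (mod int N)"
        using t(3) a unfolding has_image_def by blast
      then show ?thesis using True cong_trans[OF _ cong_sym[OF s(2)[OF True a]]] by (simp add: T_def)
    next
      case False
      then have "y \<in> P" using that by (simp add: B_def)
      then show ?thesis by (simp add: TP \<delta>P)
    qed
    then have "[(\<Sum>y\<in>B. D N e y * int (val A N a (T y))) = (\<Sum>y\<in>B. D N e y * int (val A N a (?e y)))] (mod int N)"
      by (intro cong_sum cong_mult cong_refl)
    then show ?thesis
      unfolding crit[OF d0[OF N(1)] e] using \<delta>0[OF N(1) e a] by (rule cong_trans)
  qed
  have eqm: "val A m a (\<epsilon> (fst e)) = val A m a (\<epsilon> (snd e))"
    if m: "?d m" "coprime m (q0 * q)" and e: "e \<in> E" and a: "a \<in> A" for m e a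
  proof -
    have mq0: "coprime m q0" using m(2) by simp
    \<comment> \<open>This factor clears the denominator \<open>q0\<close> of the coefficients and
      \<open>q0 * q\<close> of the unknowns, and it is invertible modulo \<open>m\<close>.\<close>
    let ?q = "int q0 * int q0 * int q"
    have cop: "coprime ?q (int m)" using m(2) by (simp add: coprime_commute)
    have "[(\<Sum>x\<in>X. (int q0 * D m e x) * (int (q0 * q) * int (val A m a (T x)))) =
        (\<Sum>x\<in>X. d e x * (int (q0 * q) * \<alpha> x a + int q0 * g x a))] (mod int m)"
    proof (intro cong_sum cong_mult)
      fix x assume x: "x \<in> X"
      then show "[int q0 * D m e x = d e x] (mod int m)" by (intro D d0 m mq0 e) (simp add: B_def)
      show "[int (q0 * q) * int (val A m a (T x)) = int (q0 * q) * \<alpha> x a + int q0 * g x a] (mod int m)"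
        using t(3)[OF x] m a x unfolding has_image_def by (simp add: T_def)
    qed
    moreover have "[(\<Sum>p\<in>P. (int q0 * D m e p) * (int q * (int q0 * int (val A m a (T p))))) =
        (\<Sum>p\<in>P. d e p * (int q * \<kappa> p a))] (mod int m)"
    proof (intro cong_sum cong_mult cong_refl)
      fix p assume p: "p \<in> P"
      then show "[int q0 * D m e p = d e p] (mod int m)" by (intro D d0 m mq0 e) (simp add: B_def)
      show "[int q0 * int (val A m a (T p)) = \<kappa> p a] (mod int m)"
        unfolding TP[OF p] by (intro \<kappa> d0 m mq0 p a)
    qed
    ultimately have f1: "[(\<Sum>x\<in>X. (int q0 * D m e x) * (int (q0 * q) * int (val A m a (T x)))) +
        (\<Sum>p\<in>P. (int q0 * D m e p) * (int q * (int q0 * int (val A m a (T p))))) =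
        (\<Sum>x\<in>X. d e x * (int (q0 * q) * \<alpha> x a + int q0 * g x a)) + (\<Sum>p\<in>P. d e p * (int q * \<kappa> p a))] (mod int m)"
      by (rule cong_add)
    have eq1: "(\<Sum>x\<in>X. (int q0 * D m e x) * (int (q0 * q) * int (val A m a (T x)))) +
        (\<Sum>p\<in>P. (int q0 * D m e p) * (int q * (int q0 * int (val A m a (T p))))) =
        ?q * (\<Sum>y\<in>B. D m e y * int (val A m a (T y)))"
      unfolding sumB distrib_left sum_distrib_left by (simp add: ac_simps)
    have eq2: "(\<Sum>x\<in>X. d e x * (int (q0 * q) * \<alpha> x a + int q0 * g x a)) + (\<Sum>p\<in>P. d e p * (int q * \<kappa> p a)) =
        k (e, a) - int q * c (e, a)"
      by (simp add: g(2) h_def c_def algebra_simps sum.distrib sum_distrib_left)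
    have f2: "[k (e, a) - int q * c (e, a) = 0] (mod int m)"
      using k(2)[OF m, of "(e, a)"] e a by (simp add: cong_iff_dvd_diff cong_0_iff)
    have "[?q * (\<Sum>y\<in>B. D m e y * int (val A m a (T y))) = ?q * 0] (mod int m)"
      using cong_trans[OF f1[unfolded eq1 eq2] f2] by simp
    then have "[(\<Sum>y\<in>B. D m e y * int (val A m a (T y))) = 0] (mod int m)"
      using cong_mult_lcancel[OF cop] by blast
    then show ?thesis unfolding crit[OF d0[OF m(1)] e] .
  qed
  have "is_solution (Ab \<pi>) X P A E L w \<epsilon>"
    unfolding is_solution_def BXP
  proof (intro conjI ballI)
    show "\<epsilon> \<in> cont_hom fin_sgrps B fin_sgrps A" by (rule \<epsilon>)
    show "Some (\<epsilon> (gen fin_sgrps B x)) \<in> Cl A (L x)" if "x \<in> X" for x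
      using that \<epsilon>gen[of x] t(2)[of x] by (simp add: B_def T_def)
    show "\<epsilon> (gen fin_sgrps B p) = w p" if "p \<in> P" for p
      using that \<epsilon>gen[of p] TP[of p] by (simp add: B_def)
    fix e assume e: "e \<in> E"
    note car = cont_hom_carrier[OF \<epsilon> Ecar(1)[OF e]] cont_hom_carrier[OF \<epsilon> Ecar(2)[OF e]]
    have "val A m a (\<epsilon> (fst e)) = val A m a (\<epsilon> (snd e))" if m: "?d m" and a: "a \<in> A" for m a
    proof -
      \<comment> \<open>Chinese remainders: \<open>m1\<close> is settled by the values kept modulo
        \<open>N\<close>, \<open>m2\<close> by the fractions.\<close>
      obtain m1 m2 where m12: "m = m1 * m2" "m1 dvd N" "coprime m2 (q0 * q)" "coprime m1 m2"
        using N(3)[OF m] by blast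
      have "val A m1 a (\<epsilon> (fst e)) = val A m1 a (\<epsilon> (snd e))"
        using val_mod[OF d0[OF N(1)] m12(2) car(1), of a] val_mod[OF d0[OF N(1)] m12(2) car(2), of a] eqN[OF e a]
        by simp
      then have 1: "[val A m a (\<epsilon> (fst e)) = val A m a (\<epsilon> (snd e))] (mod m1)"
        using val_mod[OF d0[OF m] _ car(1), of m1 a] val_mod[OF d0[OF m] _ car(2), of m1 a] m12(1)
        by (simp add: unique_euclidean_semiring_class.cong_def)
      have "?d m2" using m by (rule nat_dvd_supernatural_dvd) (simp add: m12(1))
      then have "val A m2 a (\<epsilon> (fst e)) = val A m2 a (\<epsilon> (snd e))" using m12(3) e a by (rule eqm)
      then have 2: "[val A m a (\<epsilon> (fst e)) = val A m a (\<epsilon> (snd e))] (mod m2)"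
        using val_mod[OF d0[OF m] _ car(1), of m2 a] val_mod[OF d0[OF m] _ car(2), of m2 a] m12(1)
        by (simp add: unique_euclidean_semiring_class.cong_def)
      have "[val A m a (\<epsilon> (fst e)) = val A m a (\<epsilon> (snd e))] (mod m)"
        unfolding m12(1) by (rule coprime_cong_mult_nat[OF 1[unfolded m12(1)] 2[unfolded m12(1)] m12(4)])
      then show ?thesis
        using val_less[OF d0[OF m] car(1)] val_less[OF d0[OF m] car(2)] by (simp add: unique_euclidean_semiring_class.cong_def)
    qed
    then have "satisfies (Ab \<pi>) A (\<epsilon> (fst e)) (\<epsilon> (snd e))"
      unfolding satisfies_Ab_iff[OF A car] by blast
    then show "case e of (u, v) \<Rightarrow> satisfies (Ab \<pi>) A (\<epsilon> u) (\<epsilon> v)" by (simp add: case_prod_beta)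
  qed
  moreover have "\<forall>x\<in>X. \<epsilon> (gen fin_sgrps B x) \<in> sig_subalgebra (sigma \<pi>) fin_sgrps A"
    using \<epsilon>gen t(1) by (auto simp: B_def T_def)
  ultimately show "\<exists>\<delta>. is_solution (Ab \<pi>) X P A E L w \<delta> \<and>
      (\<forall>x\<in>X. \<delta> (gen fin_sgrps (X \<union> P) x) \<in> sig_subalgebra (sigma \<pi>) fin_sgrps A)"
    unfolding BXP by blast
qed

end
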